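(* Let $H$ be a CQG algebra with antipode $S$, let $\iota:A\to H$ be (the inclusion of) a right coideal $*$-subalgebra, and let $E:H\to A$ be the right $A$-module, right $H$-comodule splitting of $\iota$ (so $E\circ\iota=\mathrm{id}_A$) described in the context. Then $E$ is completely positive, in the sense that $$\sum_{i,j=1}^n a_i^*E(x_i^*x_j)a_j\ge 0\quad\text{in }A_u$$ for all $n$ and all $x_1,\dots,x_n\in H$, $a_1,\dots,a_n\in A$, if and only if $A$ is invariant under $S^2$, i.e. $S^2(A)=A$.
   Context: All objects are over $\mathbb{C}$. A Hopf $*$-algebra is a complex Hopf algebra that is also a $*$-algebra, such that the comultiplication $\Delta$ and counit $\varepsilon$ are $*$-algebra maps. For a finite-dimensional right $H$-comodule $M$ (coaction $m\mapsto m_0\otimes m_1$), let $M^*$ be its dual comodule (coaction determined by $\langle f_0,m\rangle f_1=\langle f,m_0\rangle S(m_1)$) and $\overline{M}$ the complex conjugate vector space with coaction $m\mapsto m_0\otimes m_1^*$. An inner product on $M$ (regarded as a linear map $\overline{M}\to M^*$) is compatible if this map is a map of $H$-comodules. A CQG algebra is a Hopf $*$-algebra for which every finite-dimensional right comodule admits a compatible inner product. A right coideal $*$-subalgebra is a unital subalgebra $A\subseteq H$ closed under $*$ with $\Delta(A)\subseteq A\otimes H$. Put $A^+=A\cap\ker\varepsilon$, $C=H/HA^+$ (a quotient left $H$-module coalgebra of $H$, which is cosemisimple in this setting), and $\pi:H\to C$ the quotient map. Let $h_C:C\to\mathbb{C}$ be the unique unital integral on $C$: the linear functional with $h_C(\pi(1))=1$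 such that $c\mapsto h_C(c)\pi(1)$ is a right $C$-comodule map $C\to\mathbb{C}\pi(1)$, i.e. $h_C(c_1)c_2=h_C(c)\pi(1)$ for all $c\in C$. The map $E$ is given by $E(x)=h_C(\pi(x_1))\,x_2$ (Sweedler notation); it takes values in $A$, restricts to the identity on $A$, and is a map of right $A$-modules and right $H$-comodules. $H_u$ denotes the completion of $H$ with respect to its maximal (universal) $C^*$-norm (the norm of $x$ being the supremum of its norms in $*$-representations of $H$ on Hilbert spaces), and $A_u$ is the closure of $A$ in $H_u$. *)

theory Defs
  imports
    "HOL-Analysis.Analysis"
    "HOL-Library.Function_Algebras"
    "HOL-Library.Poly_Mapping"
begin

section \<open>Complex vector spaces and \<open>*\<close>-algebras\<close>

class complex_vector = ab_group_add +
  fixes scaleC :: "complex \<Rightarrow> 'a \<Rightarrow> 'a"  (infixr "*\<^sub>C" 75)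
  assumes scaleC_add_right: "c *\<^sub>C (x + y) = c *\<^sub>C x + c *\<^sub>C y"
    and scaleC_add_left: "(c + d) *\<^sub>C x = c *\<^sub>C x + d *\<^sub>C x"
    and scaleC_scaleC: "c *\<^sub>C d *\<^sub>C x = (c * d) *\<^sub>C x"
    and scaleC_one: "1 *\<^sub>C x = x"

global_interpretation cvec: vector_space "scaleC :: complex \<Rightarrow> 'a \<Rightarrow> 'a::complex_vector"
  by unfold_locales (simp_all add: scaleC_add_right scaleC_add_left scaleC_scaleC scaleC_one)

abbreviation clinear :: "('a::complex_vector \<Rightarrow> 'b::complex_vector) \<Rightarrow> bool"
  where "clinear \<equiv> Vector_Spaces.linear scaleC scaleC"

lemma clinear_iff:
  "clinear f \<longleftrightarrow> (\<forall>x y. f (x + y) = f x + f y) \<and> (\<forall>c x. f (c *\<^sub>C x) = c *\<^sub>C f x)"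
  unfolding Vector_Spaces.linear_def module_hom_def module_hom_axioms_def
  by (auto intro: cvec.vector_space_axioms cvec.module_axioms)

definition cbilinear :: "('a::complex_vector \<Rightarrow> 'b::complex_vector \<Rightarrow> 'c::complex_vector) \<Rightarrow> bool"
  where "cbilinear f \<longleftrightarrow> (\<forall>y. clinear (\<lambda>x. f x y)) \<and> (\<forall>x. clinear (f x))"

class complex_algebra_1 = complex_vector + ring_1 +
  assumes scaleC_mult_left: "(c *\<^sub>C x) * y = c *\<^sub>C (x * y)"
    and scaleC_mult_right: "x * (c *\<^sub>C y) = c *\<^sub>C (x * y)"

class star_algebra = complex_algebra_1 +
  fixes star :: "'a \<Rightarrow> 'a"
  assumes star_add: "star (x + y) = star x + star y"
    and star_scaleC: "star (c *\<^sub>C x) = cnj c *\<^sub>C star x"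
    and star_mult: "star (x * y) = star y * star x"
    and star_star: "star (star x) = x"

class cstar_algebra = star_algebra + real_normed_algebra_1 + complete_space +
  assumes scaleR_scaleC: "r *\<^sub>R x = complex_of_real r *\<^sub>C x"
    and norm_scaleC: "norm (c *\<^sub>C x) = cmod c * norm x"
    and cstar_identity: "norm (star x * x) = norm x ^ 2"

instantiation complex :: complex_vector
begin
definition scaleC_complex :: "complex \<Rightarrow> complex \<Rightarrow> complex"
  where "scaleC_complex = (*)"
instance by standard (simp_all add: scaleC_complex_def algebra_simps)
end

instantiation "fun" :: (type, complex_vector) complex_vector
begin
definition scaleC_fun :: "complex \<Rightarrow> ('a \<Rightarrow> 'b) \<Rightarrow> 'a \<Rightarrow> 'b"
  where "scaleC_fun c f = (\<lambda>x. c *\<^sub>C f x)"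
instance
  by standard
    (simp_all add: scaleC_fun_def fun_eq_iff scaleC_add_right scaleC_add_left scaleC_scaleC scaleC_one)
end

text \<open>The complex conjugate vector space of \<open>'a\<close>.\<close>

datatype 'a cconj = Conj (unConj: 'a)

instantiation cconj :: (complex_vector) complex_vector
begin
definition zero_cconj :: "'a cconj" where "zero_cconj = Conj 0"
definition plus_cconj :: "'a cconj \<Rightarrow> 'a cconj \<Rightarrow> 'a cconj"
  where "plus_cconj x y = Conj (unConj x + unConj y)"
definition minus_cconj :: "'a cconj \<Rightarrow> 'a cconj \<Rightarrow> 'a cconj"
  where "minus_cconj x y = Conj (unConj x - unConj y)"
definition uminus_cconj :: "'a cconj \<Rightarrow> 'a cconj"
  where "uminus_cconj x = Conj (- unConj x)"
definition scaleC_cconj :: "complex \<Rightarrow> 'a cconj \<Rightarrow> 'a cconj"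
  where "scaleC_cconj c x = Conj (cnj c *\<^sub>C unConj x)"
instance
  by standard
    (simp_all add: zero_cconj_def plus_cconj_def minus_cconj_def uminus_cconj_def scaleC_cconj_def
      scaleC_add_right scaleC_add_left scaleC_scaleC scaleC_one add.assoc add.commute
      flip: add_uminus_conv_diff)
end


section \<open>Algebraic tensor products\<close>

instantiation poly_mapping :: (type, complex_vector) complex_vector
begin
lift_definition scaleC_poly_mapping :: "complex \<Rightarrow> ('a \<Rightarrow>\<^sub>0 'b) \<Rightarrow> 'a \<Rightarrow>\<^sub>0 'b"
  is "\<lambda>c f x. c *\<^sub>C f x"
  by (rule finite_subset[rotated]) auto
instance
  by standard
    (transfer; simp add: fun_eq_iff scaleC_add_right scaleC_add_left scaleC_scaleC scaleC_one)+
end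

text \<open>The tensor product is the free vector space on \<open>'a \<times> 'b\<close> modulo the bilinearity relations.\<close>

abbreviation free_gen :: "'a \<Rightarrow> 'b \<Rightarrow> ('a \<times> 'b) \<Rightarrow>\<^sub>0 complex"
  where "free_gen x y \<equiv> Poly_Mapping.single (x, y) 1"

definition tensor_rel :: "(('a::complex_vector \<times> 'b::complex_vector) \<Rightarrow>\<^sub>0 complex) set"
  where "tensor_rel = cvec.span
    ({free_gen (x + x') y - free_gen x y - free_gen x' y | x x' y. True} \<union>
     {free_gen x (y + y') - free_gen x y - free_gen x y' | x y y'. True} \<union>
     {free_gen (c *\<^sub>C x) y - c *\<^sub>C free_gen x y | c x y. True} \<union>
     {free_gen x (c *\<^sub>C y) - c *\<^sub>C free_gen x y | c x y. True})"

lemma subspace_tensor_rel: "cvec.subspace tensor_rel"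
  unfolding tensor_rel_def by (rule cvec.subspace_span)

quotient_type (overloaded) ('a, 'b) tensor =
  "('a::complex_vector \<times> 'b::complex_vector) \<Rightarrow>\<^sub>0 complex" / "\<lambda>p q. p - q \<in> tensor_rel"
proof (rule equivpI)
  show "reflp (\<lambda>p q. p - q \<in> (tensor_rel :: (('a \<times> 'b) \<Rightarrow>\<^sub>0 complex) set))"
    by (rule reflpI) (simp add: cvec.subspace_0[OF subspace_tensor_rel])
  show "symp (\<lambda>p q. p - q \<in> (tensor_rel :: (('a \<times> 'b) \<Rightarrow>\<^sub>0 complex) set))"
    by (rule sympI) (metis cvec.subspace_neg[OF subspace_tensor_rel] minus_diff_eq)
  show "transp (\<lambda>p q. p - q \<in> (tensor_rel :: (('a \<times> 'b) \<Rightarrow>\<^sub>0 complex) set))"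
    by (rule transpI) (auto dest: cvec.subspace_add[OF subspace_tensor_rel])
qed

instantiation tensor :: (complex_vector, complex_vector) complex_vector
begin
lift_definition zero_tensor :: "('a, 'b) tensor" is 0 .
lift_definition plus_tensor :: "('a, 'b) tensor \<Rightarrow> ('a, 'b) tensor \<Rightarrow> ('a, 'b) tensor" is "(+)"
  by (metis cvec.subspace_add[OF subspace_tensor_rel] add_diff_add)
lift_definition minus_tensor :: "('a, 'b) tensor \<Rightarrow> ('a, 'b) tensor \<Rightarrow> ('a, 'b) tensor" is "(-)"
proof -
  fix p p' q q' :: "('a \<times> 'b) \<Rightarrow>\<^sub>0 complex"
  assume "p - p' \<in> tensor_rel" "q - q' \<in> tensor_rel"
  then have "(p - p') - (q - q') \<in> tensor_rel"
    by (rule cvec.subspace_diff[OF subspace_tensor_rel])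
  then show "(p - q) - (p' - q') \<in> tensor_rel"
    by (simp add: algebra_simps)
qed
lift_definition uminus_tensor :: "('a, 'b) tensor \<Rightarrow> ('a, 'b) tensor" is "uminus"
  by (metis cvec.subspace_neg[OF subspace_tensor_rel] minus_diff_minus)
lift_definition scaleC_tensor :: "complex \<Rightarrow> ('a, 'b) tensor \<Rightarrow> ('a, 'b) tensor" is "scaleC"
  by (metis cvec.subspace_scale[OF subspace_tensor_rel] cvec.scale_right_diff_distrib)
instance
  by standard
    (transfer; simp add: algebra_simps scaleC_add_right scaleC_add_left scaleC_scaleC scaleC_one
      cvec.subspace_0[OF subspace_tensor_rel])+
end

lift_definition tensor_of :: "'a::complex_vector \<Rightarrow> 'b::complex_vector \<Rightarrow> ('a, 'b) tensor"
    (infixl "\<otimes>" 73)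
  is free_gen .

definition free_extend ::
    "('a \<Rightarrow> 'b \<Rightarrow> 'c::complex_vector) \<Rightarrow> (('a \<times> 'b) \<Rightarrow>\<^sub>0 complex) \<Rightarrow> 'c"
  where "free_extend f p =
    (\<Sum>k\<in>Poly_Mapping.keys p. Poly_Mapping.lookup p k *\<^sub>C f (fst k) (snd k))"

text \<open>For bilinear \<open>f\<close>, \<open>tlift f\<close> is the linear map with \<open>tlift f (x \<otimes> y) = f x y\<close>, so
  \<open>tlift (\<lambda>x\<^sub>1 x\<^sub>2. f x\<^sub>1 x\<^sub>2) (\<Delta> x)\<close> is what Sweedler notation writes as \<open>f x\<^sub>1 x\<^sub>2\<close>.
  It is only meaningful for bilinear \<open>f\<close>.\<close>

definition tlift ::
    "('a::complex_vector \<Rightarrow> 'b::complex_vector \<Rightarrow> 'c::complex_vector) \<Rightarrow> ('a, 'b) tensor \<Rightarrow> 'c"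
  where "tlift f t = free_extend f (rep_tensor t)"

lemma free_extend_superset:
  assumes "finite K" "Poly_Mapping.keys p \<subseteq> K"
  shows "free_extend f p = (\<Sum>k\<in>K. Poly_Mapping.lookup p k *\<^sub>C f (fst k) (snd k))"
  unfolding free_extend_def using assms
  by (intro sum.mono_neutral_left) (auto simp: in_keys_iff)

lemma clinear_free_extend: "clinear (free_extend f)"
proof -
  have "free_extend f (p + q) = free_extend f p + free_extend f q" for p q
  proof -
    let ?K = "Poly_Mapping.keys p \<union> Poly_Mapping.keys q"
    have "Poly_Mapping.keys (p + q) \<subseteq> ?K" by (rule keys_add)
    then show ?thesis
      by (simp add: free_extend_superset[of ?K] lookup_add scaleC_add_left sum.distrib)
  qed
  moreover have "free_extend f (c *\<^sub>C p) = c *\<^sub>C free_extend f p" for c p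
  proof -
    have "Poly_Mapping.keys (c *\<^sub>C p) \<subseteq> Poly_Mapping.keys p"
      by (auto simp: in_keys_iff scaleC_poly_mapping.rep_eq scaleC_complex_def)
    then show ?thesis
      by (simp add: free_extend_superset[of "Poly_Mapping.keys p"] scaleC_poly_mapping.rep_eq
          scaleC_complex_def cvec.scale_sum_right scaleC_scaleC)
  qed
  ultimately show ?thesis by (simp add: clinear_iff)
qed

lemma free_extend_gen: "free_extend f (free_gen x y) = f x y"
  by (simp add: free_extend_def scaleC_one)

lemma free_extend_rel:
  assumes "cbilinear f" "p \<in> tensor_rel"
  shows "free_extend f p = 0"
proof -
  interpret L: Vector_Spaces.linear scaleC scaleC "free_extend f" by (rule clinear_free_extend)
  show ?thesis
    using assms(2) unfolding tensor_rel_def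
  proof (induction rule: cvec.span_induct_alt)
    case base
    show ?case by (rule L.zero)
  next
    case (step c x y)
    have "free_extend f x = 0"
      using step(1) assms(1)
      by (auto simp: L.diff L.scale free_extend_gen cbilinear_def clinear_iff)
    then show ?case by (simp add: L.add L.scale step)
  qed
qed

lemma tlift_abs:
  assumes "cbilinear f"
  shows "tlift f (abs_tensor p) = free_extend f p"
proof -
  interpret L: Vector_Spaces.linear scaleC scaleC "free_extend f" by (rule clinear_free_extend)
  have "rep_tensor (abs_tensor p) - p \<in> tensor_rel"
    using Quotient3_rep_abs[OF Quotient3_tensor, of p]
    by (simp add: cvec.subspace_0[OF subspace_tensor_rel])
  then have "free_extend f (rep_tensor (abs_tensor p) - p) = 0"
    by (rule free_extend_rel[OF assms])
  then show ?thesis by (simp add: tlift_def L.diff)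
qed

lemma tlift_pure: "cbilinear f \<Longrightarrow> tlift f (x \<otimes> y) = f x y"
  by (simp add: tensor_of.abs_eq tlift_abs free_extend_gen)

lemma tlift_linear:
  assumes "cbilinear f"
  shows "clinear (tlift f)"
proof -
  interpret L: Vector_Spaces.linear scaleC scaleC "free_extend f" by (rule clinear_free_extend)
  have "tlift f (s + t) = tlift f s + tlift f t" for s t
    by (induction s rule: tensor.abs_induct, induction t rule: tensor.abs_induct)
      (simp add: plus_tensor.abs_eq tlift_abs[OF assms] L.add)
  moreover have "tlift f (c *\<^sub>C t) = c *\<^sub>C tlift f t" for c t
    by (induction t rule: tensor.abs_induct)
      (simp add: scaleC_tensor.abs_eq tlift_abs[OF assms] L.scale)
  ultimately show ?thesis by (simp add: clinear_iff)
qed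

lemma tensor_of_bilinear: "cbilinear (\<otimes>)"
  unfolding cbilinear_def clinear_iff
proof (intro conjI allI; transfer)
  fix x x' :: 'a and y y' :: 'b and c
  show "free_gen (x + x') y - (free_gen x y + free_gen x' y) \<in> tensor_rel"
    unfolding tensor_rel_def diff_diff_eq[symmetric] by (rule cvec.span_base) blast
  show "free_gen (c *\<^sub>C x) y - c *\<^sub>C free_gen x y \<in> tensor_rel"
    unfolding tensor_rel_def by (rule cvec.span_base) blast
  show "free_gen x (y + y') - (free_gen x y + free_gen x y') \<in> tensor_rel"
    unfolding tensor_rel_def diff_diff_eq[symmetric] by (rule cvec.span_base) blast
  show "free_gen x (c *\<^sub>C y) - c *\<^sub>C free_gen x y \<in> tensor_rel"
    unfolding tensor_rel_def by (rule cvec.span_base) blast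
qed

lemmas tensor_of_simps = tensor_of_bilinear[unfolded cbilinear_def clinear_iff]

lemma tensor_of_add_left: "(x + x') \<otimes> y = x \<otimes> y + x' \<otimes> y"
  and tensor_of_add_right: "x \<otimes> (y + y') = x \<otimes> y + x \<otimes> y'"
  and tensor_of_scale_left: "(c *\<^sub>C x) \<otimes> y = c *\<^sub>C (x \<otimes> y)"
  and tensor_of_scale_right: "x \<otimes> (c *\<^sub>C y) = c *\<^sub>C (x \<otimes> y)"
  using tensor_of_simps by blast+

lemma tensor_induct [case_names pure add]:
  assumes pure: "\<And>x y. P (x \<otimes> y)" and add: "\<And>s t. P s \<Longrightarrow> P t \<Longrightarrow> P (s + t)"
  shows "P t"
proof (induction t rule: tensor.abs_induct)
  case (1 p)
  show ?case
  proof (induction p rule: update_induct)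
    case const
    have "(0 :: 'a) \<otimes> (0 :: 'b) = 0"
      using tensor_of_scale_left[of 0 "0 :: 'a" "0 :: 'b"] by simp
    then show ?case using pure[of 0 0] by (simp add: zero_tensor.abs_eq)
  next
    case (update p k c)
    obtain x y where k: "k = (x, y)" by fastforce
    have "Poly_Mapping.single k c = c *\<^sub>C free_gen x y"
      by (rule poly_mapping_eqI)
        (simp add: k scaleC_poly_mapping.rep_eq lookup_single scaleC_complex_def when_def)
    then have *: "abs_tensor (Poly_Mapping.single k c) = (c *\<^sub>C x) \<otimes> y"
      unfolding tensor_of_scale_left by (simp add: tensor_of.abs_eq scaleC_tensor.abs_eq)
    have "Poly_Mapping.update k c p = p + Poly_Mapping.single k c"
      using update(1) by (intro poly_mapping_eqI)
        (auto simp: lookup_update lookup_add lookup_single when_def in_keys_iff)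
    then have "abs_tensor (Poly_Mapping.update k c p) = abs_tensor p + (c *\<^sub>C x) \<otimes> y"
      by (simp add: plus_tensor.abs_eq flip: *)
    then show ?case by (simp add: add pure update)
  qed
qed

lemma tlift_add_fun: "tlift (\<lambda>x y. f x y + g x y) t = tlift f t + tlift g t"
  by (simp add: tlift_def free_extend_def scaleC_add_right sum.distrib)

lemma tlift_scale_fun: "tlift (\<lambda>x y. c *\<^sub>C f x y) t = c *\<^sub>C tlift f t"
  by (simp add: tlift_def free_extend_def cvec.scale_sum_right scaleC_scaleC mult.commute)

lemma ex_functional:
  assumes "x \<noteq> (0 :: 'a::complex_vector)"
  shows "\<exists>\<phi> :: 'a \<Rightarrow> complex. clinear \<phi> \<and> \<phi> x = 1"
proof -
  interpret P: vector_space_pair "scaleC :: complex \<Rightarrow> 'a \<Rightarrow> 'a"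
      "scaleC :: complex \<Rightarrow> complex \<Rightarrow> complex" ..
  have "cvec.independent {x}"
    using assms by simp
  from P.linear_independent_extend[OF this, of "\<lambda>_. 1"] show ?thesis by auto
qed

lemma tensor_of_nonzero:
  assumes "x \<noteq> 0" "y \<noteq> 0"
  shows "x \<otimes> y \<noteq> 0"
proof
  obtain \<phi> \<psi> where \<phi>: "clinear \<phi>" "\<phi> x = (1::complex)" and \<psi>: "clinear \<psi>" "\<psi> y = (1::complex)"
    using ex_functional assms by metis
  have b: "cbilinear (\<lambda>x y. \<phi> x * \<psi> y)"
    using \<phi>(1) \<psi>(1) unfolding cbilinear_def clinear_iff
    by (simp add: scaleC_complex_def algebra_simps)
  assume "x \<otimes> y = 0"
  then have "tlift (\<lambda>x y. \<phi> x * \<psi> y) (x \<otimes> y) = 0"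
    using tlift_linear[OF b] by (metis clinear_iff cvec.scale_zero_left)
  then show False by (simp add: tlift_pure[OF b] \<phi> \<psi>)
qed

instantiation tensor :: (complex_algebra_1, complex_algebra_1) complex_algebra_1
begin

definition one_tensor :: "('a, 'b) tensor" where "one_tensor = 1 \<otimes> 1"

definition times_tensor :: "('a, 'b) tensor \<Rightarrow> ('a, 'b) tensor \<Rightarrow> ('a, 'b) tensor"
  where "times_tensor s t = tlift (\<lambda>a b. tlift (\<lambda>c d. (a * c) \<otimes> (b * d)) t) s"

instance
proof
  have in_bil: "cbilinear (\<lambda>c d. (a * c) \<otimes> (b * d))" for a :: 'a and b :: 'b
    by (simp add: cbilinear_def clinear_iff distrib_left scaleC_mult_right
        tensor_of_add_left tensor_of_add_right tensor_of_scale_left tensor_of_scale_right)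
  have out_bil: "cbilinear (\<lambda>a b. tlift (\<lambda>c d. (a * c) \<otimes> (b * d)) t)" for t :: "('a, 'b) tensor"
    by (simp add: cbilinear_def clinear_iff distrib_right scaleC_mult_left
        tensor_of_add_left tensor_of_add_right tensor_of_scale_left tensor_of_scale_right
        tlift_add_fun tlift_scale_fun)
  note lin = tlift_linear[OF in_bil, unfolded clinear_iff]
  note lin' = tlift_linear[OF out_bil, unfolded clinear_iff]
  have pure: "(a \<otimes> b) * (c \<otimes> d) = (a * c) \<otimes> (b * d)" for a c :: 'a and b d :: 'b
    unfolding times_tensor_def tlift_pure[OF out_bil] by (rule tlift_pure[OF in_bil])
  have right: "r * (s + t) = r * s + r * t" for r s t :: "('a, 'b) tensor"
    by (simp add: times_tensor_def lin tlift_add_fun)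
  have left: "(s + t) * r = s * r + t * r" for r s t :: "('a, 'b) tensor"
    by (simp add: times_tensor_def lin')
  fix r s t :: "('a, 'b) tensor" and k :: complex
  show "(k *\<^sub>C s) * t = k *\<^sub>C (s * t)"
    by (simp add: times_tensor_def lin')
  show "s * (k *\<^sub>C t) = k *\<^sub>C (s * t)"
    by (simp add: times_tensor_def lin tlift_scale_fun)
  show "r * s * t = r * (s * t)"
  proof (induction r rule: tensor_induct)
    case (pure a b)
    show ?case
    proof (induction s rule: tensor_induct)
      case (pure c d)
      show ?case
        by (induction t rule: tensor_induct)
          (simp_all add: \<open>\<And>a b c d. (a \<otimes> b) * (c \<otimes> d) = (a * c) \<otimes> (b * d)\<close> right mult.assoc)
    qed (simp add: left right)
  qed (simp add: left)
  show "1 * t = t" and "t * 1 = t"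
    by (induction t rule: tensor_induct) (simp_all add: one_tensor_def pure left right)
  show "(r + s) * t = r * t + s * t" by (rule left)
  show "r * (s + t) = r * s + r * t" by (rule right)
  show "0 \<noteq> (1 :: ('a, 'b) tensor)"
    unfolding one_tensor_def by (metis tensor_of_nonzero zero_neq_one)
qed

end

lemma tensor_mult_pure:
  fixes a c :: "'a::complex_algebra_1" and b d :: "'b::complex_algebra_1"
  shows "(a \<otimes> b) * (c \<otimes> d) = (a * c) \<otimes> (b * d)"
proof -
  have 1: "cbilinear (\<lambda>c d. (a * c) \<otimes> (b * d))" for a :: 'a and b :: 'b
    by (simp add: cbilinear_def clinear_iff distrib_left scaleC_mult_right
        tensor_of_add_left tensor_of_add_right tensor_of_scale_left tensor_of_scale_right)
  have 2: "cbilinear (\<lambda>a b. tlift (\<lambda>c d. (a * c) \<otimes> (b * d)) t)" for t :: "('a, 'b) tensor"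
    by (simp add: cbilinear_def clinear_iff distrib_right scaleC_mult_left
        tensor_of_add_left tensor_of_add_right tensor_of_scale_left tensor_of_scale_right
        tlift_add_fun tlift_scale_fun)
  show ?thesis unfolding times_tensor_def tlift_pure[OF 2] by (rule tlift_pure[OF 1])
qed

instantiation tensor :: (star_algebra, star_algebra) star_algebra
begin

text \<open>The antilinear map \<open>a \<otimes> b \<mapsto> star a \<otimes> star b\<close>, as a linear map to the conjugate space.\<close>

definition star_tensor :: "('a, 'b) tensor \<Rightarrow> ('a, 'b) tensor"
  where "star_tensor t = unConj (tlift (\<lambda>a b. Conj (star a \<otimes> star b)) t)"

instance
proof
  have bil: "cbilinear (\<lambda>(a :: 'a) (b :: 'b). Conj (star a \<otimes> star b))"
    by (simp add: cbilinear_def clinear_iff star_add star_scaleC plus_cconj_def scaleC_cconj_def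
        tensor_of_add_left tensor_of_add_right tensor_of_scale_left tensor_of_scale_right)
  have pure: "star (a \<otimes> b) = star a \<otimes> star b" for a :: 'a and b :: 'b
    by (simp add: star_tensor_def tlift_pure[OF bil])
  have add: "star (s + t) = star s + star t" for s t :: "('a, 'b) tensor"
    using tlift_linear[OF bil] by (simp add: star_tensor_def clinear_iff plus_cconj_def)
  fix s t :: "('a, 'b) tensor" and c :: complex
  show "star (s + t) = star s + star t" by (rule add)
  show "star (c *\<^sub>C t) = cnj c *\<^sub>C star t"
    using tlift_linear[OF bil] by (simp add: star_tensor_def clinear_iff scaleC_cconj_def)
  show "star (star t) = t"
    by (induction t rule: tensor_induct) (simp_all add: pure add star_star)
  show "star (s * t) = star t * star s"
  proof (induction s rule: tensor_induct)
    case (pure a b)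
    show ?case
      by (induction t rule: tensor_induct)
        (simp_all add: \<open>\<And>a b. star (a \<otimes> b) = star a \<otimes> star b\<close> add tensor_mult_pure star_mult
          distrib_left distrib_right)
  qed (simp add: add distrib_left distrib_right)
qed

end

text \<open>The tensor product of linear maps, and the associativity isomorphism.\<close>

definition tmap :: "('a::complex_vector \<Rightarrow> 'c::complex_vector) \<Rightarrow>
    ('b::complex_vector \<Rightarrow> 'd::complex_vector) \<Rightarrow> ('a, 'b) tensor \<Rightarrow> ('c, 'd) tensor"
  where "tmap f g = tlift (\<lambda>x y. f x \<otimes> g y)"

definition tassoc :: "(('a::complex_vector, 'b::complex_vector) tensor, 'c::complex_vector) tensor
    \<Rightarrow> ('a, ('b, 'c) tensor) tensor"
  where "tassoc = tlift (\<lambda>s z. tlift (\<lambda>x y. x \<otimes> (y \<otimes> z)) s)"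

text \<open>For subspaces \<open>V\<close> and \<open>W\<close>, the image of the (injective) map from the tensor product of
  \<open>V\<close> and \<open>W\<close> to that of the ambient spaces.\<close>

definition tensor_sub :: "'a::complex_vector set \<Rightarrow> 'b::complex_vector set \<Rightarrow> ('a, 'b) tensor set"
  where "tensor_sub V W = cvec.span {x \<otimes> y | x y. x \<in> V \<and> y \<in> W}"



section \<open>Hopf \<open>*\<close>-algebras and their comodules\<close>

definition coalgebra ::
    "('c::complex_vector \<Rightarrow> ('c, 'c) tensor) \<Rightarrow> ('c \<Rightarrow> complex) \<Rightarrow> bool"
  where "coalgebra \<Delta> \<epsilon> \<longleftrightarrow> clinear \<Delta> \<and> clinear \<epsilon> \<and>
    (\<forall>x. tassoc (tmap \<Delta> id (\<Delta> x)) = tmap id \<Delta> (\<Delta> x)) \<and>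
    (\<forall>x. tlift (\<lambda>x\<^sub>1 x\<^sub>2. \<epsilon> x\<^sub>1 *\<^sub>C x\<^sub>2) (\<Delta> x) = x) \<and>
    (\<forall>x. tlift (\<lambda>x\<^sub>1 x\<^sub>2. \<epsilon> x\<^sub>2 *\<^sub>C x\<^sub>1) (\<Delta> x) = x)"

definition hopf_star_algebra ::
    "('h::star_algebra \<Rightarrow> ('h, 'h) tensor) \<Rightarrow> ('h \<Rightarrow> complex) \<Rightarrow> ('h \<Rightarrow> 'h) \<Rightarrow> bool"
  where "hopf_star_algebra \<Delta> \<epsilon> S \<longleftrightarrow> coalgebra \<Delta> \<epsilon> \<and>
    \<Delta> 1 = 1 \<and> (\<forall>x y. \<Delta> (x * y) = \<Delta> x * \<Delta> y) \<and>
    \<epsilon> 1 = 1 \<and> (\<forall>x y. \<epsilon> (x * y) = \<epsilon> x * \<epsilon> y) \<and>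
    clinear S \<and>
    (\<forall>x. tlift (\<lambda>x\<^sub>1 x\<^sub>2. S x\<^sub>1 * x\<^sub>2) (\<Delta> x) = \<epsilon> x *\<^sub>C 1) \<and>
    (\<forall>x. tlift (\<lambda>x\<^sub>1 x\<^sub>2. x\<^sub>1 * S x\<^sub>2) (\<Delta> x) = \<epsilon> x *\<^sub>C 1) \<and>
    (\<forall>x. \<Delta> (star x) = star (\<Delta> x)) \<and> (\<forall>x. \<epsilon> (star x) = cnj (\<epsilon> x))"

text \<open>A comodule is carried by a subspace \<open>M\<close> of a vector space type. Throughout, linear data on
  \<open>M\<close> (coactions, comodule maps, functionals, sesquilinear forms) are given by maps defined on the
  ambient space, of which only the values on \<open>M\<close> matter; every linear map on \<open>M\<close> arises this way.\<close>

definition comodule :: "('h::complex_vector \<Rightarrow> ('h, 'h) tensor) \<Rightarrow> ('h \<Rightarrow> complex) \<Rightarrow>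
    'm::complex_vector set \<Rightarrow> ('m \<Rightarrow> ('m, 'h) tensor) \<Rightarrow> bool"
  where "comodule \<Delta> \<epsilon> M \<delta> \<longleftrightarrow> cvec.subspace M \<and> clinear \<delta> \<and>
    (\<forall>m\<in>M. \<delta> m \<in> tensor_sub M UNIV) \<and>
    (\<forall>m\<in>M. tassoc (tmap \<delta> id (\<delta> m)) = tmap id \<Delta> (\<delta> m)) \<and>
    (\<forall>m\<in>M. tlift (\<lambda>m\<^sub>0 m\<^sub>1. \<epsilon> m\<^sub>1 *\<^sub>C m\<^sub>0) (\<delta> m) = m)"

definition comodule_map :: "'m::complex_vector set \<Rightarrow> ('m \<Rightarrow> ('m, 'h::complex_vector) tensor) \<Rightarrow>
    'n::complex_vector set \<Rightarrow> ('n \<Rightarrow> ('n, 'h) tensor) \<Rightarrow> ('m \<Rightarrow> 'n) \<Rightarrow> bool"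
  where "comodule_map M \<delta> N \<delta>' \<phi> \<longleftrightarrow> clinear \<phi> \<and> \<phi> ` M \<subseteq> N \<and>
    (\<forall>m\<in>M. \<delta>' (\<phi> m) = tmap \<phi> id (\<delta> m))"

definition finite_dim :: "'m::complex_vector set \<Rightarrow> bool"
  where "finite_dim M \<longleftrightarrow> (\<exists>B. finite B \<and> M = cvec.span B)"

definition restrict_to :: "'m set \<Rightarrow> ('m \<Rightarrow> complex) \<Rightarrow> 'm \<Rightarrow> complex"
  where "restrict_to M f = (\<lambda>m. if m \<in> M then f m else 0)"

definition dual_space :: "'m::complex_vector set \<Rightarrow> ('m \<Rightarrow> complex) set"
  where "dual_space M = {restrict_to M f | f. clinear f}"

text \<open>The condition \<open>\<langle>f\<^sub>0, m\<rangle> f\<^sub>1 = \<langle>f, m\<^sub>0\<rangle> S m\<^sub>1\<close>; on the right a linear extension \<open>f\<close>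
  of the functional is used, as \<open>tlift\<close> needs a bilinear map on the ambient spaces.\<close>

definition dual_coaction :: "('h \<Rightarrow> 'h) \<Rightarrow> 'm::complex_vector set \<Rightarrow>
    ('m \<Rightarrow> ('m, 'h::complex_vector) tensor) \<Rightarrow>
    (('m \<Rightarrow> complex) \<Rightarrow> ('m \<Rightarrow> complex, 'h) tensor) \<Rightarrow> bool"
  where "dual_coaction S M \<delta> \<delta>' \<longleftrightarrow> clinear \<delta>' \<and>
    (\<forall>f\<in>dual_space M. \<delta>' f \<in> tensor_sub (dual_space M) UNIV) \<and>
    (\<forall>f. clinear f \<longrightarrow> (\<forall>m\<in>M. tlift (\<lambda>f\<^sub>0 f\<^sub>1. f\<^sub>0 m *\<^sub>C f\<^sub>1) (\<delta>' (restrict_to M f)) =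
      tlift (\<lambda>m\<^sub>0 m\<^sub>1. f m\<^sub>0 *\<^sub>C S m\<^sub>1) (\<delta> m)))"

text \<open>The coaction \<open>m \<mapsto> m\<^sub>0 \<otimes> star m\<^sub>1\<close> on the conjugate space; the outer \<open>Conj\<close> makes the
  antilinear map \<open>m\<^sub>0 \<otimes> m\<^sub>1 \<mapsto> Conj m\<^sub>0 \<otimes> star m\<^sub>1\<close> linear.\<close>

definition conj_coaction :: "('m::complex_vector \<Rightarrow> ('m, 'h::star_algebra) tensor) \<Rightarrow>
    'm cconj \<Rightarrow> ('m cconj, 'h) tensor"
  where "conj_coaction \<delta> m =
    unConj (tlift (\<lambda>m\<^sub>0 m\<^sub>1. Conj (Conj m\<^sub>0 \<otimes> star m\<^sub>1)) (\<delta> (unConj m)))"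

text \<open>Inner products are antilinear in the first argument.\<close>

definition inner_product_on :: "'m::complex_vector set \<Rightarrow> ('m \<Rightarrow> 'm \<Rightarrow> complex) \<Rightarrow> bool"
  where "inner_product_on M ip \<longleftrightarrow>
    (\<forall>m. clinear (ip m)) \<and>
    (\<forall>n m m'. ip (m + m') n = ip m n + ip m' n) \<and> (\<forall>n c m. ip (c *\<^sub>C m) n = cnj c * ip m n) \<and>
    (\<forall>m\<in>M. \<forall>n\<in>M. ip n m = cnj (ip m n)) \<and>
    (\<forall>m\<in>M. m \<noteq> 0 \<longrightarrow> Im (ip m m) = 0 \<and> Re (ip m m) > 0)"

definition compatible :: "('h \<Rightarrow> 'h) \<Rightarrow> 'm::complex_vector set \<Rightarrow>
    ('m \<Rightarrow> ('m, 'h::star_algebra) tensor) \<Rightarrow> ('m \<Rightarrow> 'm \<Rightarrow> complex) \<Rightarrow> bool"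
  where "compatible S M \<delta> ip \<longleftrightarrow> (\<exists>\<delta>'. dual_coaction S M \<delta> \<delta>' \<and>
    comodule_map (Conj ` M) (conj_coaction \<delta>) (dual_space M) \<delta>'
      (\<lambda>m. restrict_to M (ip (unConj m))))"

text \<open>Every finite-dimensional comodule is isomorphic to one carried by a subspace of the sequence
  space \<open>nat \<Rightarrow> complex\<close>.\<close>

definition CQG_algebra ::
    "('h::star_algebra \<Rightarrow> ('h, 'h) tensor) \<Rightarrow> ('h \<Rightarrow> complex) \<Rightarrow> ('h \<Rightarrow> 'h) \<Rightarrow> bool"
  where "CQG_algebra \<Delta> \<epsilon> S \<longleftrightarrow> hopf_star_algebra \<Delta> \<epsilon> S \<and>
    (\<forall>(M :: (nat \<Rightarrow> complex) set) \<delta>. finite_dim M \<and> comodule \<Delta> \<epsilon> M \<delta> \<longrightarrow>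
      (\<exists>ip. inner_product_on M ip \<and> compatible S M \<delta> ip))"


section \<open>Coideal \<open>*\<close>-subalgebras and the map \<open>E\<close>\<close>

definition right_coideal_star_subalgebra ::
    "('h::star_algebra \<Rightarrow> ('h, 'h) tensor) \<Rightarrow> 'h set \<Rightarrow> bool"
  where "right_coideal_star_subalgebra \<Delta> A \<longleftrightarrow> cvec.subspace A \<and> 1 \<in> A \<and>
    (\<forall>a\<in>A. \<forall>b\<in>A. a * b \<in> A) \<and> (\<forall>a\<in>A. star a \<in> A) \<and>
    (\<forall>a\<in>A. \<Delta> a \<in> tensor_sub A UNIV)"

text \<open>The left ideal \<open>H A\<^sup>+\<close>, where \<open>A\<^sup>+ = A \<inter> ker \<epsilon>\<close>.\<close>

definition ideal_plus :: "('h::star_algebra \<Rightarrow> complex) \<Rightarrow> 'h set \<Rightarrow> 'h set"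
  where "ideal_plus \<epsilon> A = cvec.span {x * a | x a. a \<in> A \<and> \<epsilon> a = 0}"

text \<open>\<open>\<pi>\<close> exhibits \<open>'c\<close> as the quotient space of \<open>'h\<close> by \<open>V\<close>, and \<open>\<Delta>\<^sub>C\<close> and \<open>\<epsilon>\<^sub>C\<close> are the
  induced coalgebra structure. For given \<open>V\<close> these data are unique up to unique isomorphism.\<close>

definition quotient_coalgebra :: "('h::complex_vector \<Rightarrow> ('h, 'h) tensor) \<Rightarrow> ('h \<Rightarrow> complex) \<Rightarrow>
    'h set \<Rightarrow> ('h \<Rightarrow> 'c::complex_vector) \<Rightarrow> ('c \<Rightarrow> ('c, 'c) tensor) \<Rightarrow> ('c \<Rightarrow> complex) \<Rightarrow> bool"
  where "quotient_coalgebra \<Delta> \<epsilon> V \<pi> \<Delta>\<^sub>C \<epsilon>\<^sub>C \<longleftrightarrow>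
    clinear \<pi> \<and> surj \<pi> \<and> {x. \<pi> x = 0} = V \<and> coalgebra \<Delta>\<^sub>C \<epsilon>\<^sub>C \<and>
    (\<forall>x. \<Delta>\<^sub>C (\<pi> x) = tmap \<pi> \<pi> (\<Delta> x)) \<and> (\<forall>x. \<epsilon>\<^sub>C (\<pi> x) = \<epsilon> x)"

definition unital_integral ::
    "('c::complex_vector \<Rightarrow> ('c, 'c) tensor) \<Rightarrow> 'c \<Rightarrow> ('c \<Rightarrow> complex) \<Rightarrow> bool"
  where "unital_integral \<Delta>\<^sub>C e h \<longleftrightarrow> clinear h \<and> h e = 1 \<and>
    (\<forall>c. tlift (\<lambda>c\<^sub>1 c\<^sub>2. h c\<^sub>1 *\<^sub>C c\<^sub>2) (\<Delta>\<^sub>C c) = h c *\<^sub>C e)"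

definition coideal_expectation :: "('h::complex_vector \<Rightarrow> ('h, 'h) tensor) \<Rightarrow>
    ('h \<Rightarrow> 'c) \<Rightarrow> ('c \<Rightarrow> complex) \<Rightarrow> 'h \<Rightarrow> 'h"
  where "coideal_expectation \<Delta> \<pi> h x = tlift (\<lambda>x\<^sub>1 x\<^sub>2. h (\<pi> x\<^sub>1) *\<^sub>C x\<^sub>2) (\<Delta> x)"


section \<open>The universal \<open>C\<^sup>*\<close>-completion\<close>

text \<open>The Hilbert space of square-summable families on \<open>B\<close>, as functions vanishing off \<open>B\<close>.\<close>

definition l2 :: "'i set \<Rightarrow> ('i \<Rightarrow> complex) set"
  where "l2 B = {f. (\<forall>i. i \<notin> B \<longrightarrow> f i = 0) \<and> (\<lambda>i. (cmod (f i))\<^sup>2) summable_on UNIV}"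

definition l2_inner :: "('i \<Rightarrow> complex) \<Rightarrow> ('i \<Rightarrow> complex) \<Rightarrow> complex"
  where "l2_inner f g = (\<Sum>\<^sub>\<infinity>i. cnj (f i) * g i)"

definition l2_norm :: "('i \<Rightarrow> complex) \<Rightarrow> real"
  where "l2_norm f = sqrt (\<Sum>\<^sub>\<infinity>i. (cmod (f i))\<^sup>2)"

definition bounded_operator :: "'i set \<Rightarrow> (('i \<Rightarrow> complex) \<Rightarrow> 'i \<Rightarrow> complex) \<Rightarrow> bool"
  where "bounded_operator B T \<longleftrightarrow> T ` l2 B \<subseteq> l2 B \<and>
    (\<forall>f\<in>l2 B. \<forall>g\<in>l2 B. T (f + g) = T f + T g) \<and>
    (\<forall>c. \<forall>f\<in>l2 B. T (c *\<^sub>C f) = c *\<^sub>C T f) \<and>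
    (\<exists>K. \<forall>f\<in>l2 B. l2_norm (T f) \<le> K * l2_norm f)"

definition operator_norm :: "'i set \<Rightarrow> (('i \<Rightarrow> complex) \<Rightarrow> 'i \<Rightarrow> complex) \<Rightarrow> real"
  where "operator_norm B T = (SUP f\<in>{f \<in> l2 B. l2_norm f \<le> 1}. l2_norm (T f))"

definition star_rep ::
    "'i set \<Rightarrow> ('h::star_algebra \<Rightarrow> ('i \<Rightarrow> complex) \<Rightarrow> 'i \<Rightarrow> complex) \<Rightarrow> bool"
  where "star_rep B \<rho> \<longleftrightarrow> (\<forall>x. bounded_operator B (\<rho> x)) \<and>
    (\<forall>f\<in>l2 B. \<rho> 1 f = f \<and>
      (\<forall>x y. \<rho> (x + y) f = \<rho> x f + \<rho> y f) \<and>
      (\<forall>c x. \<rho> (c *\<^sub>C x) f = c *\<^sub>C \<rho> x f) \<and>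
      (\<forall>x y. \<rho> (x * y) f = \<rho> x (\<rho> y f))) \<and>
    (\<forall>x. \<forall>f\<in>l2 B. \<forall>g\<in>l2 B. l2_inner (\<rho> (star x) f) g = l2_inner f (\<rho> x g))"

text \<open>Quantifying over the spaces \<open>l2 B\<close> with \<open>B \<subseteq> 'h\<close> accounts for all Hilbert spaces: the norm
  of \<open>x\<close> in a representation is the supremum of its norms in cyclic subrepresentations, and these
  have a dense subset of cardinality at most that of \<open>'h\<close>, hence an orthonormal basis indexed by
  some \<open>B \<subseteq> 'h\<close>. The supremum is finite for CQG algebras, which are spanned by matrix coefficients
  of unitary comodules.\<close>

definition universal_norm :: "'h::star_algebra \<Rightarrow> real"
  where "universal_norm x = Sup {operator_norm B (\<rho> x) | (B :: 'h set) \<rho>. star_rep B \<rho>}"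

text \<open>\<open>j\<close> exhibits \<open>'u\<close> as the completion of \<open>'h\<close> in its universal norm; again, this is unique
  up to unique isomorphism.\<close>

definition universal_completion :: "('h::star_algebra \<Rightarrow> 'u::cstar_algebra) \<Rightarrow> bool"
  where "universal_completion j \<longleftrightarrow> clinear j \<and> j 1 = 1 \<and> (\<forall>x y. j (x * y) = j x * j y) \<and>
    (\<forall>x. j (star x) = star (j x)) \<and> (\<forall>x. norm (j x) = universal_norm x) \<and>
    closure (range j) = UNIV"

definition positive_in :: "'u::cstar_algebra set \<Rightarrow> 'u \<Rightarrow> bool"
  where "positive_in B z \<longleftrightarrow> (\<exists>b\<in>B. z = star b * b)"

end

theory Submission
  imports Defs
begin

text \<open>
  Write \<open>h\<close> for the Haar functional, \<open>\<phi> = h\<^sub>C \<circ> \<pi>\<close>, and \<open>P\<close> for the projection of \<open>H\<close> onto \<open>A\<close> that is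
  orthogonal for the inner product \<open>h (y x\<^sup>*)\<close>. Both \<open>E\<close> and \<open>P\<close> are right \<open>A\<close>-linear and right
  colinear, \<open>\<epsilon> \<circ> P\<close> annihilates \<open>H A\<^sup>+\<close>, and \<open>h \<circ> E = h\<close>; together this forces \<open>E = P\<close>, and
  \<open>\<phi> = \<epsilon> \<circ> P\<close>. Self-adjointness of \<open>P\<close> gives \<open>\<phi> (S\<^sup>-\<^sup>1 z) = cnj (\<phi> (z\<^sup>*))\<close>.

  If \<open>E\<close> is completely positive, composing with the one-dimensional representation \<open>\<epsilon>\<close> shows that
  \<open>\<phi>\<close> is positive, hence hermitian, hence \<open>\<phi> \<circ> S = \<phi>\<close>; then \<open>P\<close> commutes with \<open>S\<^sup>2\<close>, and so
  \<open>S\<^sup>2 A = A\<close>.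

  Conversely, \<open>S\<^sup>2 A = A\<close> gives \<open>\<phi> \<circ> S\<^sup>2 = \<phi>\<close> by uniqueness of \<open>P\<close>, and since \<open>\<phi>\<close> is idempotent for
  the convolution it is hermitian. So \<open>P\<close> is a \<open>*\<close>-preserving \<open>A\<close>-bimodule map, and it remains to see
  that \<open>P (y\<^sup>* y)\<close> is positive in \<open>A\<^sub>u\<close>. The matrix \<open>P (x\<^sub>i\<^sup>* x\<^sub>k)\<close> is positive on the pre-Hilbert space
  \<open>A\<^sup>n\<close>; a moment estimate extends this to \<open>H\<^sup>n\<close>, which yields \<open>\<phi> \<ge> 0\<close> on all of \<open>H\<close>. Then
  \<open>P (y\<^sup>* y) = \<phi> (y\<^sub>1\<^sup>* y\<^sub>1) y\<^sub>2\<^sup>* y\<^sub>2\<close> is positive in every representation, and a square root is found by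
  expanding \<open>sqrt (1 - t)\<close>.
\<close>

section \<open>Linear algebra\<close>

text \<open>Orthogonality for \<open>h (y (star x))\<close> reads \<open>h ((x - P x) a) = 0\<close>
  for \<open>a\<close> in \<open>A\<close>, and such relations survive right multiplication by
  \<open>A\<close>; this makes \<open>P\<close> right \<open>A\<close>-linear. Left linearity has to
  come from \<open>P\<close> commuting with \<open>star\<close>, which interchanges this inner
  product with \<open>h ((star x) y)\<close>; there \<open>S\<^sup>2\<close> enters.

  The CQG hypothesis provides inner products on finite-dimensional comodules only, so the Haar
  functional, its positivity and the projection are obtained from finite-dimensional pieces of
  \<open>H\<close>.

  The moment estimate stands in for the isometry of an inclusion of C*-algebras: a matrix over
  \<open>A\<close> is seen to be positive only on vectors from \<open>A\<close>, while recovering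
  \<phi> takes vectors with entries in \<open>S H\<close>. Since \<open>h\<close> is in general no
  trace, a fixed vector is moved out of the form by a modular relation
  \<open>h (z c) = h (c' z)\<close>.

  Norm bounds are stated for all positive functionals at once, so that they apply to
  \<open>h\<close> and to every representation. The square root must lie in
  \<open>A\<^sub>u\<close>, not merely in the completion of \<open>H\<close>; hence it is a limit of
  polynomials in an element of \<open>A\<close>.\<close>

lemma clinear_add: "clinear f \<Longrightarrow> f (x + y) = f x + f y"
  and clinear_scale: "clinear f \<Longrightarrow> f (c *\<^sub>C x) = c *\<^sub>C f x"
  by (simp_all add: clinear_iff)

lemma clinear_zero: "clinear f \<Longrightarrow> f 0 = 0"
  using clinear_scale[of f 0 0] by simp

lemma clinear_diff: "clinear f \<Longrightarrow> f (x - y) = f x - f y"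
  using clinear_add[of f "x - y" y] by simp

lemma clinear_sum: "clinear f \<Longrightarrow> f (\<Sum>i\<in>I. g i) = (\<Sum>i\<in>I. f (g i))"
proof -
  assume f: "clinear f"
  show ?thesis
    by (induction I rule: infinite_finite_induct)
      (simp_all add: clinear_zero[OF f] clinear_add[OF f])
qed

lemmas clin = clinear_add clinear_scale clinear_zero clinear_diff clinear_sum

lemma clinearI: "(\<And>x y. f (x + y) = f x + f y) \<Longrightarrow> (\<And>c x. f (c *\<^sub>C x) = c *\<^sub>C f x) \<Longrightarrow> clinear f"
  by (simp add: clinear_iff)

lemma clinear_compose: "clinear f \<Longrightarrow> clinear g \<Longrightarrow> clinear (\<lambda>x. f (g x))"
  by (simp add: clinear_iff)

lemma clinear_ident: "clinear (\<lambda>x. x)"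
  by (simp add: clinear_iff)

lemma clinear_mult_left: "clinear (\<lambda>x. c * x)" and clinear_mult_right: "clinear (\<lambda>x. x * c)"
  for c :: "'a::complex_algebra_1"
  by (simp_all add: clinear_iff distrib_left distrib_right scaleC_mult_left scaleC_mult_right)

lemma scaleC_complex [simp]: "c *\<^sub>C (d::complex) = c * d"
  by (simp add: scaleC_complex_def)

text \<open>Reduces identities between vectors to scalar ones: after pairing with an arbitrary
  functional, \<open>slice_commute\<close> moves slices from one leg of a tensor to the other. This
  plays the role of Sweedler calculus below.\<close>

lemma functional_ext:
  assumes "\<And>g :: 'a::complex_vector \<Rightarrow> complex. clinear g \<Longrightarrow> g x = g y"
  shows "x = y"
proof (rule ccontr)
  assume "x \<noteq> y"
  then obtain g :: "'a \<Rightarrow> complex" where g: "clinear g" "g (x - y) = 1"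
    using ex_functional[of "x - y"] by auto
  then show False
    using assms[OF g(1)] clinear_diff[OF g(1), of x y] by simp
qed

lemma cbilinear_scale_left: "clinear f \<Longrightarrow> clinear g \<Longrightarrow> cbilinear (\<lambda>a b. f a *\<^sub>C g b)"
  and cbilinear_scale_right: "clinear f \<Longrightarrow> clinear g \<Longrightarrow> cbilinear (\<lambda>a b. f b *\<^sub>C g a)"
  by (simp_all add: cbilinear_def clinear_iff scaleC_add_right scaleC_add_left scaleC_scaleC mult.commute)

definition hamel :: "'a::complex_vector set"
  where "hamel = cvec.extend_basis {}"

definition coord :: "'a::complex_vector \<Rightarrow> 'a \<Rightarrow> complex"
  where "coord b x = cvec.representation hamel x b"

lemma hamel_indep: "cvec.independent (hamel :: 'a::complex_vector set)"
  and hamel_span: "cvec.span (hamel :: 'a::complex_vector set) = UNIV"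
  by (simp_all add: hamel_def cvec.independent_extend_basis cvec.span_extend_basis cvec.independent_empty)

lemma clinear_coord: "clinear (coord b)"
  unfolding coord_def
  by (rule clinearI)
    (simp_all add: cvec.representation_add cvec.representation_scale hamel_indep hamel_span)

lemma coord_expand:
  assumes "finite F" "{b. coord b x \<noteq> 0} \<subseteq> F"
  shows "(\<Sum>b\<in>F. coord b x *\<^sub>C b) = x"
proof -
  have "(\<Sum>b\<in>F. coord b x *\<^sub>C b) = (\<Sum>b | coord b x \<noteq> 0. coord b x *\<^sub>C b)"
    using assms by (intro sum.mono_neutral_right) auto
  also have "\<dots> = x"
    unfolding coord_def
    by (rule cvec.sum_nonzero_representation_eq) (simp_all add: hamel_indep hamel_span)
  finally show ?thesis .
qed

lemma finite_coord: "finite {b. coord b x \<noteq> 0}"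
  unfolding coord_def by (rule cvec.finite_representation)

section \<open>Slices of tensors\<close>

definition rslice :: "('b \<Rightarrow> complex) \<Rightarrow> ('a::complex_vector, 'b::complex_vector) tensor \<Rightarrow> 'a"
  where "rslice g = tlift (\<lambda>a b. g b *\<^sub>C a)"

definition lslice :: "('a \<Rightarrow> complex) \<Rightarrow> ('a::complex_vector, 'b::complex_vector) tensor \<Rightarrow> 'b"
  where "lslice f = tlift (\<lambda>a b. f a *\<^sub>C b)"

lemma rslice_pure: "clinear g \<Longrightarrow> rslice g (a \<otimes> b) = g b *\<^sub>C a"
  and lslice_pure: "clinear f \<Longrightarrow> lslice f (a \<otimes> b) = f a *\<^sub>C b"
  unfolding rslice_def lslice_def
  by (simp_all add: tlift_pure cbilinear_scale_left cbilinear_scale_right clinear_ident)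

lemma clinear_rslice: "clinear g \<Longrightarrow> clinear (rslice g)"
  and clinear_lslice: "clinear f \<Longrightarrow> clinear (lslice f)"
  unfolding rslice_def lslice_def
  by (simp_all add: tlift_linear cbilinear_scale_left cbilinear_scale_right clinear_ident)

lemmas rslice_simps = rslice_pure clin[OF clinear_rslice]
lemmas lslice_simps = lslice_pure clin[OF clinear_lslice]

lemma slice_commute:
  assumes "clinear f" "clinear g"
  shows "f (rslice g t) = g (lslice f t)"
  by (induction t rule: tensor_induct)
    (simp_all add: rslice_simps lslice_simps assms clinear_add[OF assms(1)] clinear_add[OF assms(2)]
      clinear_scale[OF assms(1)] clinear_scale[OF assms(2)])

lemma clinear_tensor_left: "clinear (\<lambda>x. x \<otimes> y)" and clinear_tensor_right: "clinear (\<lambda>y. x \<otimes> y)"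
  by (simp_all add: clinear_iff tensor_of_add_left tensor_of_add_right tensor_of_scale_left
      tensor_of_scale_right)

lemmas tensor_sum_left = clinear_sum[OF clinear_tensor_left]
lemmas tensor_sum_right = clinear_sum[OF clinear_tensor_right]

text \<open>The second leg is expanded in the Hamel basis. The claim is made for every finite
  superset \<open>F'\<close> so that the supports of two summands can be merged in the
  induction.\<close>

lemma tensor_expand_aux:
  "\<exists>F. finite F \<and> (\<forall>F'. finite F' \<longrightarrow> F \<subseteq> F' \<longrightarrow> (\<Sum>b\<in>F'. rslice (coord b) t \<otimes> b) = t)"
proof (induction t rule: tensor_induct)
  case (pure x y)
  have "(\<Sum>b\<in>F'. rslice (coord b) (x \<otimes> y) \<otimes> b) = x \<otimes> y"
    if "finite F'" "{b. coord b y \<noteq> 0} \<subseteq> F'" for F'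
  proof -
    have "(\<Sum>b\<in>F'. rslice (coord b) (x \<otimes> y) \<otimes> b) = x \<otimes> (\<Sum>b\<in>F'. coord b y *\<^sub>C b)"
      by (simp add: rslice_pure clinear_coord tensor_sum_right tensor_of_scale_left
          tensor_of_scale_right)
    then show ?thesis by (simp add: coord_expand[OF that])
  qed
  then show ?case using finite_coord[of y] by blast
next
  case (add s t)
  then obtain F G where F: "finite F" and G: "finite G"
    and s: "\<forall>F'. finite F' \<longrightarrow> F \<subseteq> F' \<longrightarrow> (\<Sum>b\<in>F'. rslice (coord b) s \<otimes> b) = s"
    and t: "\<forall>F'. finite F' \<longrightarrow> G \<subseteq> F' \<longrightarrow> (\<Sum>b\<in>F'. rslice (coord b) t \<otimes> b) = t"
    by blast
  have "(\<Sum>b\<in>F'. rslice (coord b) (s + t) \<otimes> b) = s + t"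
    if "finite F'" "F \<union> G \<subseteq> F'" for F'
    using that s t by (simp add: rslice_simps clinear_coord tensor_of_add_left sum.distrib)
  then show ?case using F G by (intro exI[of _ "F \<union> G"]) blast
qed

lemma tensor_expand: "\<exists>F. finite F \<and> (\<Sum>b\<in>F. rslice (coord b) t \<otimes> b) = t"
  using tensor_expand_aux[of t] by blast

text \<open>The coefficients in the expansion over the Hamel basis are themselves right slices, so a
  tensor with vanishing slices is zero.\<close>

lemma tensor_ext:
  assumes "\<And>g. clinear g \<Longrightarrow> rslice g s = rslice g t"
  shows "s = t"
proof -
  obtain F where F: "(\<Sum>b\<in>F. rslice (coord b) (s - t) \<otimes> b) = s - t"
    using tensor_expand[of "s - t"] by blast
  have "rslice g (s - t) = 0" if "clinear g" for g
    using assms[OF that] by (simp add: rslice_simps that)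
  then have "(\<Sum>b\<in>F. rslice (coord b) (s - t) \<otimes> b) = 0"
    by (simp add: clinear_coord clinear_zero[OF clinear_tensor_left])
  with F show ?thesis by simp
qed

lemma rslice_tensor_sub:
  assumes "t \<in> tensor_sub V W" "cvec.subspace V" "clinear g"
  shows "rslice g t \<in> V"
  using assms(1) unfolding tensor_sub_def
proof (induction rule: cvec.span_induct_alt)
  case base
  show ?case by (simp add: rslice_simps assms cvec.subspace_0)
next
  case (step c x y)
  then show ?case
    by (auto simp: rslice_simps assms intro!: cvec.subspace_add cvec.subspace_scale)
qed

lemma tensor_mult_sum:
  fixes p :: "'i \<Rightarrow> 'a::complex_algebra_1" and q :: "'i \<Rightarrow> 'b::complex_algebra_1"
  shows "(\<Sum>i\<in>I. p i \<otimes> q i) * (\<Sum>k\<in>K. r k \<otimes> s k) = (\<Sum>i\<in>I. \<Sum>k\<in>K. (p i * r k) \<otimes> (q i * s k))"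
  by (simp add: sum_product tensor_mult_pure)

lemma star_zero: "star 0 = (0::'a::star_algebra)"
  using star_scaleC[of 0 "0::'a"] by simp

lemma star_sum: "star (\<Sum>i\<in>I. f i) = (\<Sum>i\<in>I. star (f i :: 'a::star_algebra))"
  by (induction I rule: infinite_finite_induct) (simp_all add: star_zero star_add)

lemma star_diff: "star (x - y) = star x - star (y::'a::star_algebra)"
  using star_add[of "x - y" y] by (simp add: eq_diff_eq)

lemma star_one: "star 1 = (1::'a::star_algebra)"
  using star_mult[of "star 1" "1::'a"] star_star[of "1::'a"] by simp

lemma star_pure: "star (a \<otimes> b) = star a \<otimes> star (b::'b::star_algebra)" for a :: "'a::star_algebra"
proof -
  have "cbilinear (\<lambda>(a :: 'a) (b :: 'b). Conj (star a \<otimes> star b))"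
    by (simp add: cbilinear_def clinear_iff star_add star_scaleC plus_cconj_def scaleC_cconj_def
        tensor_of_add_left tensor_of_add_right tensor_of_scale_left tensor_of_scale_right)
  then show ?thesis by (simp add: star_tensor_def tlift_pure)
qed

lemma clinear_cnj_star:
  fixes g :: "'a::star_algebra \<Rightarrow> complex"
  assumes "clinear g"
  shows "clinear (\<lambda>z. cnj (g (star z)))"
  by (rule clinearI) (simp_all add: star_add star_scaleC clin[OF assms])

section \<open>Finite-dimensional subspaces\<close>

definition dual_system :: "nat \<Rightarrow> (nat \<Rightarrow> 'a::complex_vector) \<Rightarrow> (nat \<Rightarrow> 'a \<Rightarrow> complex) \<Rightarrow> bool"
  where "dual_system n d g \<longleftrightarrow> (\<forall>i<n. clinear (g i)) \<and>
    (\<forall>i<n. \<forall>j<n. g i (d j) = (if i = j then 1 else 0))"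

lemma dual_system_expand:
  assumes "dual_system n d g" "x \<in> cvec.span (d ` {..<n})"
  shows "(\<Sum>i<n. g i x *\<^sub>C d i) = x"
  using assms(2)
proof (induction rule: cvec.span_induct_alt)
  case base
  have "g i 0 = 0" if "i < n" for i
    using assms(1) that by (auto simp: dual_system_def intro: clinear_zero)
  then show ?case by simp
next
  case (step c x y)
  then obtain j where j: "j < n" "x = d j" by auto
  have "g i (c *\<^sub>C x + y) *\<^sub>C d i = (if i = j then c *\<^sub>C d i else 0) + g i y *\<^sub>C d i" if "i < n" for i
  proof -
    have "clinear (g i)" "g i x = (if i = j then 1 else 0)"
      using assms(1) that j by (auto simp: dual_system_def)
    then show ?thesis
      by (simp add: clinear_add[of "g i"] clinear_scale[of "g i"] scaleC_add_left)
  qed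
  then have "(\<Sum>i<n. g i (c *\<^sub>C x + y) *\<^sub>C d i) =
      (\<Sum>i<n. if i = j then c *\<^sub>C d i else 0) + (\<Sum>i<n. g i y *\<^sub>C d i)"
    by (simp add: sum.distrib)
  then show ?case using j step by simp
qed

lemma exists_dual_system:
  assumes "finite (B :: 'a::complex_vector set)"
  shows "\<exists>n d g. dual_system n d g \<and> cvec.span (d ` {..<n}) = cvec.span B"
proof -
  interpret P: vector_space_pair "scaleC :: complex \<Rightarrow> 'a \<Rightarrow> 'a"
      "scaleC :: complex \<Rightarrow> complex \<Rightarrow> complex" ..
  obtain B0 where B0: "B0 \<subseteq> B" "cvec.independent B0" "B \<subseteq> cvec.span B0"
    using cvec.maximal_independent_subset[of B] by blast
  have "finite B0" using B0 assms by (auto intro: finite_subset)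
  obtain d where d: "bij_betw d {..<card B0} B0"
    using bij_betw_from_nat_into_finite[OF \<open>finite B0\<close>] by blast
  have "\<exists>g. clinear g \<and> (\<forall>x\<in>B0. g x = (if x = d i then 1 else 0 :: complex))" for i
    using P.linear_independent_extend[OF B0(2), of "\<lambda>x. if x = d i then 1 else 0"] by auto
  then obtain g where g: "\<And>i. clinear (g i)"
      "\<And>i x. x \<in> B0 \<Longrightarrow> g i x = (if x = d i then 1 else 0 :: complex)"
    by metis
  have "dual_system (card B0) d g"
    unfolding dual_system_def
  proof (intro conjI allI impI)
    fix i j assume "i < card B0" "j < card B0"
    moreover have "d j \<in> B0" using d \<open>j < card B0\<close> by (auto simp: bij_betw_def)
    ultimately show "g i (d j) = (if i = j then 1 else 0)"
      using d g(2)[of "d j" i] by (auto simp: bij_betw_def inj_on_def)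
  qed (rule g)
  moreover have "cvec.span (d ` {..<card B0}) = cvec.span B"
    using d B0 by (metis bij_betw_def cvec.span_eq cvec.span_superset subset_trans)
  ultimately show ?thesis by blast
qed

text \<open>The antipode of a matrix corepresentation is its inverse matrix. How \<open>S\<close>
  behaves under products, \<Delta> and \<open>star\<close> is derived below by exhibiting a left and
  a right inverse of one matrix, whose entries may lie in a tensor product.\<close>

lemma left_inverse_eq_right_inverse:
  fixes L R X :: "'i \<Rightarrow> 'i \<Rightarrow> 'a::ring_1"
  assumes "finite I"
    and L: "\<And>i j. i \<in> I \<Longrightarrow> j \<in> I \<Longrightarrow> (\<Sum>k\<in>I. L i k * X k j) = (if i = j then 1 else 0)"
    and R: "\<And>i j. i \<in> I \<Longrightarrow> j \<in> I \<Longrightarrow> (\<Sum>k\<in>I. X i k * R k j) = (if i = j then 1 else 0)"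
    and ij: "i \<in> I" "j \<in> I"
  shows "L i j = R i j"
proof -
  have "L i j = (\<Sum>k\<in>I. L i k * (if k = j then 1 else 0))"
    using ij \<open>finite I\<close> by (simp add: if_distrib[of "(*) _"] cong: if_cong)
  also have "\<dots> = (\<Sum>k\<in>I. L i k * (\<Sum>l\<in>I. X k l * R l j))"
    using ij R by (intro sum.cong) simp_all
  also have "\<dots> = (\<Sum>k\<in>I. \<Sum>l\<in>I. L i k * X k l * R l j)"
    by (simp add: sum_distrib_left mult.assoc)
  also have "\<dots> = (\<Sum>l\<in>I. (\<Sum>k\<in>I. L i k * X k l) * R l j)"
    by (subst sum.swap) (simp add: sum_distrib_right)
  also have "\<dots> = (\<Sum>l\<in>I. (if i = l then 1 else 0) * R l j)"
    using ij L by (intro sum.cong) simp_all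
  also have "\<dots> = R i j"
    using ij \<open>finite I\<close> by (simp add: if_distrib[of "\<lambda>x. x * _"] cong: if_cong)
  finally show ?thesis .
qed

section \<open>Convolution and matrix corepresentations\<close>

lemma tmap_pure: "clinear f \<Longrightarrow> clinear g \<Longrightarrow> tmap f g (x \<otimes> y) = f x \<otimes> g y"
  and clinear_tmap: "clinear f \<Longrightarrow> clinear g \<Longrightarrow> clinear (tmap f g)"
proof -
  assume f: "clinear f" and g: "clinear g"
  have b: "cbilinear (\<lambda>x y. f x \<otimes> g y)"
    by (simp add: cbilinear_def clinear_iff tensor_of_simps clinear_add[OF f] clinear_scale[OF f]
        clinear_add[OF g] clinear_scale[OF g])
  show "tmap f g (x \<otimes> y) = f x \<otimes> g y" "clinear (tmap f g)"
    unfolding tmap_def by (simp_all add: tlift_pure[OF b] tlift_linear[OF b])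
qed

lemma tassoc_pure: "tassoc ((x \<otimes> y) \<otimes> z) = x \<otimes> (y \<otimes> z)"
  and clinear_tassoc: "clinear tassoc"
proof -
  have 1: "cbilinear (\<lambda>x y. x \<otimes> (y \<otimes> z))" for z
    by (simp add: cbilinear_def clinear_iff tensor_of_simps)
  have 2: "cbilinear (\<lambda>s z. tlift (\<lambda>x y. x \<otimes> (y \<otimes> z)) s)"
    by (simp add: cbilinear_def clinear_iff tensor_of_simps tlift_add_fun tlift_scale_fun
        clin[OF tlift_linear[OF 1]])
  show "tassoc ((x \<otimes> y) \<otimes> z) = x \<otimes> (y \<otimes> z)" "clinear tassoc"
    unfolding tassoc_def by (simp_all add: tlift_pure[OF 2] tlift_pure[OF 1] tlift_linear[OF 2])
qed

lemma lslice_tassoc: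
  assumes "clinear f"
  shows "lslice f (tassoc w) = tmap (lslice f) (\<lambda>x. x) w"
proof (induction w rule: tensor_induct)
  case (pure t z)
  note lin = clin[OF clinear_tassoc] clin[OF clinear_lslice[OF assms]]
  show ?case
    by (induction t rule: tensor_induct)
      (simp_all add: tassoc_pure lslice_pure assms tmap_pure clinear_lslice clinear_ident
        tensor_of_add_left tensor_of_scale_left lin clin[OF clinear_tmap])
qed (simp add: clin[OF clinear_tassoc] lslice_simps assms clin[OF clinear_tmap]
    clinear_lslice clinear_ident)

lemma lslice_tmap:
  assumes f: "clinear f" and D: "clinear D" and k: "clinear k"
  shows "lslice f (tmap D k w) = k (lslice (\<lambda>x. f (D x)) w)"
proof -
  note lin = clinear_compose[OF f D] f D k clin[OF clinear_tmap[OF D k]] tmap_pure[OF D k]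
    clin[OF k] lslice_simps
  show ?thesis by (induction w rule: tensor_induct) (simp_all add: lin)
qed

lemma rslice_tmap:
  assumes f: "clinear f" and D: "clinear D" and k: "clinear k"
  shows "rslice f (tmap D k w) = D (rslice (\<lambda>x. f (k x)) w)"
proof -
  note lin = clinear_compose[OF f k] f D k clin[OF clinear_tmap[OF D k]] tmap_pure[OF D k]
    clin[OF D] rslice_simps
  show ?thesis by (induction w rule: tensor_induct) (simp_all add: lin)
qed

lemma tmap_compose_left:
  assumes f: "clinear f" and D: "clinear D"
  shows "tmap f (\<lambda>x. x) (tmap D (\<lambda>x. x) w) = tmap (\<lambda>x. f (D x)) (\<lambda>x. x) w"
proof -
  note lin = clinear_compose[OF f D] f D clinear_ident tmap_pure clin[OF clinear_tmap]
  show ?thesis by (induction w rule: tensor_induct) (simp_all add: lin)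
qed

locale hopf =
  fixes \<Delta> :: "'h::star_algebra \<Rightarrow> ('h, 'h) tensor" and \<epsilon> :: "'h \<Rightarrow> complex" and S :: "'h \<Rightarrow> 'h"
  assumes hopf: "hopf_star_algebra \<Delta> \<epsilon> S"
begin

lemma clinear_comult: "clinear \<Delta>" and clinear_counit: "clinear \<epsilon>" and clinear_antipode: "clinear S"
  and comult_one: "\<Delta> 1 = 1" and comult_mult: "\<Delta> (x * y) = \<Delta> x * \<Delta> y"
  and counit_one: "\<epsilon> 1 = 1" and counit_mult: "\<epsilon> (x * y) = \<epsilon> x * \<epsilon> y"
  and comult_star: "\<Delta> (star x) = star (\<Delta> x)" and counit_star: "\<epsilon> (star x) = cnj (\<epsilon> x)"
  and coassoc: "tassoc (tmap \<Delta> (\<lambda>x. x) (\<Delta> x)) = tmap (\<lambda>x. x) \<Delta> (\<Delta> x)"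
  and counit_left: "lslice \<epsilon> (\<Delta> x) = x"
  and counit_right: "rslice \<epsilon> (\<Delta> x) = x"
  and antipode_left: "tlift (\<lambda>x\<^sub>1 x\<^sub>2. S x\<^sub>1 * x\<^sub>2) (\<Delta> x) = \<epsilon> x *\<^sub>C 1"
  and antipode_right: "tlift (\<lambda>x\<^sub>1 x\<^sub>2. x\<^sub>1 * S x\<^sub>2) (\<Delta> x) = \<epsilon> x *\<^sub>C 1"
  using hopf unfolding hopf_star_algebra_def coalgebra_def lslice_def rslice_def id_def by auto

text \<open>In Sweedler notation, \<open>rs g x = g(x\<^sub>2) x\<^sub>1\<close> and \<open>ls f x = f(x\<^sub>1) x\<^sub>2\<close>.\<close>

definition rs :: "('h \<Rightarrow> complex) \<Rightarrow> 'h \<Rightarrow> 'h" where "rs g x = rslice g (\<Delta> x)"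
definition ls :: "('h \<Rightarrow> complex) \<Rightarrow> 'h \<Rightarrow> 'h" where "ls f x = lslice f (\<Delta> x)"

lemma clinear_rs: "clinear g \<Longrightarrow> clinear (rs g)" and clinear_ls: "clinear f \<Longrightarrow> clinear (ls f)"
  unfolding rs_def ls_def
  by (rule clinear_compose[OF clinear_rslice clinear_comult], assumption,
      rule clinear_compose[OF clinear_lslice clinear_comult], assumption)

lemma rs_ls: "clinear f \<Longrightarrow> clinear g \<Longrightarrow> f (rs g x) = g (ls f x)"
  unfolding rs_def ls_def by (rule slice_commute)

lemma rs_counit: "rs \<epsilon> x = x" and ls_counit: "ls \<epsilon> x = x"
  by (simp_all add: rs_def ls_def counit_left counit_right)

lemma comult_ls:
  assumes f: "clinear f"
  shows "\<Delta> (ls f x) = tmap (ls f) (\<lambda>x. x) (\<Delta> x)"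
proof -
  note lin = clinear_comult clinear_ident f clinear_lslice[OF f]
  have "\<Delta> (ls f x) = lslice f (tmap (\<lambda>x. x) \<Delta> (\<Delta> x))"
    by (simp only: lslice_tmap[OF f clinear_ident clinear_comult] ls_def)
  also have "\<dots> = lslice f (tassoc (tmap \<Delta> (\<lambda>x. x) (\<Delta> x)))"
    by (simp only: coassoc)
  also have "\<dots> = tmap (lslice f) (\<lambda>x. x) (tmap \<Delta> (\<lambda>x. x) (\<Delta> x))"
    by (rule lslice_tassoc[OF f])
  also have "\<dots> = tmap (ls f) (\<lambda>x. x) (\<Delta> x)"
    unfolding tmap_compose_left[OF clinear_lslice[OF f] clinear_comult] ls_def[abs_def] ..
  finally show ?thesis .
qed

lemma rs_ls_commute:
  assumes "clinear f" "clinear g"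
  shows "rs g (ls f x) = ls f (rs g x)"
  unfolding rs_def comult_ls[OF assms(1)] rslice_tmap[OF assms(2) clinear_ls[OF assms(1)] clinear_ident] ..

lemma ls_ls:
  assumes "clinear f" "clinear k"
  shows "ls k (ls f x) = ls (\<lambda>y. k (ls f y)) x"
  unfolding ls_def[of k] comult_ls[OF assms(1)]
    lslice_tmap[OF assms(2) clinear_ls[OF assms(1)] clinear_ident] ls_def[of "\<lambda>y. k (ls f y)"] ..

lemma rs_rs:
  assumes "clinear g" "clinear k"
  shows "rs g (rs k x) = rs (\<lambda>y. g (rs k y)) x"
proof (rule functional_ext)
  fix f :: "'h \<Rightarrow> complex"
  assume f: "clinear f"
  have "f (rs g (rs k x)) = g (rs k (ls f x))"
    by (simp add: rs_ls[OF f assms(1)] flip: rs_ls_commute[OF f assms(2)])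
  also have "\<dots> = f (rs (\<lambda>y. g (rs k y)) x)"
    by (simp add: rs_ls[OF f clinear_compose[OF assms(1) clinear_rs[OF assms(2)]]])
  finally show "f (rs g (rs k x)) = f (rs (\<lambda>y. g (rs k y)) x)" .
qed

text \<open>Stability under all slices encodes \<Delta>(D) \<subseteq> D \<otimes> H, so
  \<open>D\<close> is a subcomodule of \<open>H\<close>.\<close>

definition rcoideal :: "'h set \<Rightarrow> bool"
  where "rcoideal D \<longleftrightarrow> cvec.subspace D \<and> (\<forall>g. clinear g \<longrightarrow> (\<forall>x\<in>D. rs g x \<in> D))"

definition corep :: "nat \<Rightarrow> (nat \<Rightarrow> nat \<Rightarrow> 'h) \<Rightarrow> bool"
  where "corep n u \<longleftrightarrow> (\<forall>i<n. \<forall>j<n. \<Delta> (u i j) = (\<Sum>k<n. u i k \<otimes> u k j) \<and>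
    \<epsilon> (u i j) = (if i = j then 1 else 0))"

lemma corep_comult: "corep n u \<Longrightarrow> i < n \<Longrightarrow> j < n \<Longrightarrow> \<Delta> (u i j) = (\<Sum>k<n. u i k \<otimes> u k j)"
  and corep_counit: "corep n u \<Longrightarrow> i < n \<Longrightarrow> j < n \<Longrightarrow> \<epsilon> (u i j) = (if i = j then 1 else 0)"
  by (simp_all add: corep_def)

lemma corep_rs: "corep n u \<Longrightarrow> i < n \<Longrightarrow> j < n \<Longrightarrow> clinear g \<Longrightarrow> rs g (u i j) = (\<Sum>k<n. g (u k j) *\<^sub>C u i k)"
  and corep_ls: "corep n u \<Longrightarrow> i < n \<Longrightarrow> j < n \<Longrightarrow> clinear g \<Longrightarrow> ls g (u i j) = (\<Sum>k<n. g (u i k) *\<^sub>C u k j)"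
  by (simp_all add: rs_def ls_def corep_comult rslice_simps lslice_simps)

lemma cbilinear_antipode: "cbilinear (\<lambda>x y. S x * y)" "cbilinear (\<lambda>x y. x * S y)"
  by (simp_all add: cbilinear_def clinear_iff clin[OF clinear_antipode] distrib_left distrib_right
      scaleC_mult_left scaleC_mult_right)

lemma corep_antipode:
  assumes "corep n u" "i < n" "j < n"
  shows "(\<Sum>k<n. S (u i k) * u k j) = (if i = j then 1 else 0)"
    and "(\<Sum>k<n. u i k * S (u k j)) = (if i = j then 1 else 0)"
proof -
  note b = cbilinear_antipode
  show "(\<Sum>k<n. S (u i k) * u k j) = (if i = j then 1 else 0)"
    using antipode_left[of "u i j"] assms
    by (simp add: corep_comult corep_counit clinear_sum[OF tlift_linear[OF b(1)]] tlift_pure[OF b(1)])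
  show "(\<Sum>k<n. u i k * S (u k j)) = (if i = j then 1 else 0)"
    using antipode_right[of "u i j"] assms
    by (simp add: corep_comult corep_counit clinear_sum[OF tlift_linear[OF b(2)]] tlift_pure[OF b(2)])
qed

text \<open>\<open>u\<close> is the coefficient matrix of the comodule spanned by \<open>d\<close>.
  The last claim, from the counit in the first leg, puts the comodule inside the span of its own
  coefficients.\<close>

lemma coideal_corep:
  assumes dg: "dual_system n d g" and D: "rcoideal (cvec.span (d ` {..<n}))"
  defines "u \<equiv> \<lambda>i j. ls (g i) (d j)"
  shows "corep n u"
    and "j < n \<Longrightarrow> clinear f \<Longrightarrow> rs f (d j) = (\<Sum>i<n. f (u i j) *\<^sub>C d i)"
    and "j < n \<Longrightarrow> d j = (\<Sum>i<n. \<epsilon> (d i) *\<^sub>C u i j)"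
proof -
  have lin: "clinear (g i)" if "i < n" for i
    using dg that by (simp add: dual_system_def)
  show rs_d: "rs f (d j) = (\<Sum>i<n. f (u i j) *\<^sub>C d i)" if "j < n" "clinear f" for j f
  proof -
    have "rs f (d j) \<in> cvec.span (d ` {..<n})"
      using D that by (auto simp: rcoideal_def cvec.span_base)
    then have "rs f (d j) = (\<Sum>i<n. g i (rs f (d j)) *\<^sub>C d i)"
      by (rule dual_system_expand[OF dg, symmetric])
    also have "\<dots> = (\<Sum>i<n. f (u i j) *\<^sub>C d i)"
      unfolding u_def using rs_ls[OF lin that(2)] by (intro sum.cong) simp_all
    finally show ?thesis .
  qed
  show "corep n u"
    unfolding corep_def
  proof (intro allI impI conjI)
    fix i j assume ij: "i < n" "j < n"
    show "\<Delta> (u i j) = (\<Sum>k<n. u i k \<otimes> u k j)"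
    proof (rule tensor_ext)
      fix f :: "'h \<Rightarrow> complex" assume f: "clinear f"
      have "rslice f (\<Delta> (u i j)) = ls (g i) (rs f (d j))"
        by (simp add: u_def flip: rs_def rs_ls_commute[OF lin[OF ij(1)] f])
      also have "\<dots> = (\<Sum>k<n. f (u k j) *\<^sub>C u i k)"
        using lin[OF ij(1)] by (simp add: rs_d ij f clin[OF clinear_ls] u_def)
      finally show "rslice f (\<Delta> (u i j)) = rslice f (\<Sum>k<n. u i k \<otimes> u k j)"
        by (simp add: rslice_simps f)
    qed
    have "\<epsilon> (u i j) = g i (rs \<epsilon> (d j))"
      by (simp add: u_def rs_ls[OF lin[OF ij(1)] clinear_counit])
    then show "\<epsilon> (u i j) = (if i = j then 1 else 0)"
      using dg ij by (simp add: rs_counit dual_system_def)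
  qed
  show "d j = (\<Sum>i<n. \<epsilon> (d i) *\<^sub>C u i j)" if "j < n"
  proof (rule functional_ext)
    fix f :: "'h \<Rightarrow> complex" assume f: "clinear f"
    have "f (d j) = \<epsilon> (rs f (d j))"
      by (simp add: rs_ls[OF clinear_counit f] ls_counit)
    then show "f (d j) = f (\<Sum>i<n. \<epsilon> (d i) *\<^sub>C u i j)"
      by (simp add: rs_d that f clin[OF f] clin[OF clinear_counit] mult.commute)
  qed
qed

text \<open>The fundamental theorem of comodules: the first legs of \<Delta> x, taken against the
  Hamel basis, span a space that is stable by coassociativity in the form \<open>rs_rs\<close> and
  contains \<open>x\<close> by the counit.\<close>

lemma finite_coideal:
  assumes "finite X"
  shows "\<exists>B. finite B \<and> X \<subseteq> cvec.span B \<and> rcoideal (cvec.span B)"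
proof -
  have "\<exists>F. finite F \<and> (\<Sum>b\<in>F. rs (coord b) x \<otimes> b) = \<Delta> x" for x
    unfolding rs_def by (rule tensor_expand)
  then obtain F where F: "\<And>x. finite (F x)" "\<And>x. (\<Sum>b\<in>F x. rs (coord b) x \<otimes> b) = \<Delta> x"
    by metis
  define B where "B = (\<Union>x\<in>X. (\<lambda>b. rs (coord b) x) ` F x)"
  have rsB: "rs g x \<in> cvec.span B" if "x \<in> X" "clinear g" for x g
  proof -
    have "rs g x = (\<Sum>b\<in>F x. g b *\<^sub>C rs (coord b) x)"
      unfolding rs_def[of g] F(2)[of x, symmetric] by (simp add: rslice_simps that)
    also have "\<dots> \<in> cvec.span B"
      using that by (intro cvec.span_sum cvec.span_scale cvec.span_base) (auto simp: B_def)
    finally show ?thesis .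
  qed
  have "rs g y \<in> cvec.span B" if "y \<in> cvec.span B" "clinear g" for y g
    using that(1)
  proof (induction rule: cvec.span_induct_alt)
    case base
    show ?case by (simp add: clinear_zero[OF clinear_rs[OF that(2)]] cvec.span_zero)
  next
    case (step c y z)
    then obtain x b where "x \<in> X" "y = rs (coord b) x" by (auto simp: B_def)
    then have "rs g y \<in> cvec.span B"
      using rsB[OF _ clinear_compose[OF \<open>clinear g\<close> clinear_rs[OF clinear_coord]]]
      by (simp add: rs_rs[OF \<open>clinear g\<close> clinear_coord])
    then show ?case
      using step(2) unfolding clin[OF clinear_rs[OF \<open>clinear g\<close>]]
      by (intro cvec.span_add cvec.span_scale)
  qed
  moreover have "X \<subseteq> cvec.span B"
    using rsB[OF _ clinear_counit] by (auto simp: rs_counit)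
  moreover have "finite B" using F assms by (auto simp: B_def)
  ultimately show ?thesis by (auto simp: rcoideal_def)
qed

definition coefs :: "nat \<Rightarrow> (nat \<Rightarrow> nat \<Rightarrow> 'h) \<Rightarrow> 'h set"
  where "coefs n u = (\<lambda>(i, j). u i j) ` ({..<n} \<times> {..<n})"

lemma finite_coefs: "finite (coefs n u)"
  by (simp add: coefs_def)

lemma exists_corep:
  assumes "finite X"
  shows "\<exists>n u. corep n u \<and> X \<subseteq> cvec.span (coefs n u)"
proof -
  obtain B where B: "finite B" "X \<subseteq> cvec.span B" "rcoideal (cvec.span B)"
    using finite_coideal[OF assms] by blast
  obtain n d g where dg: "dual_system n d g" "cvec.span (d ` {..<n}) = cvec.span B"
    using exists_dual_system[OF B(1)] by blast
  define u where "u = (\<lambda>i j. ls (g i) (d j))"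
  have D: "rcoideal (cvec.span (d ` {..<n}))" using dg B by simp
  note u = coideal_corep[OF dg(1) D, folded u_def]
  have "d j \<in> cvec.span (coefs n u)" if "j < n" for j
    by (subst u(3)[OF that], intro cvec.span_sum cvec.span_scale cvec.span_base)
      (use that in \<open>force simp: coefs_def u_def\<close>)
  then have "cvec.span (d ` {..<n}) \<subseteq> cvec.span (coefs n u)"
    by (intro cvec.span_minimal) auto
  then show ?thesis using u(1) B dg by blast
qed

lemma corep_induct [case_names coef add scale]:
  assumes "\<And>n u i j. corep n u \<Longrightarrow> i < n \<Longrightarrow> j < n \<Longrightarrow> P (u i j)"
    and "\<And>x y. P x \<Longrightarrow> P y \<Longrightarrow> P (x + y)" and "\<And>c x. P x \<Longrightarrow> P (c *\<^sub>C x)"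
  shows "P x"
proof -
  obtain n u where u: "corep n u" "x \<in> cvec.span (coefs n u)"
    using exists_corep[of "{x}"] by auto
  \<comment> \<open>Scaling by zero gives \<open>P 0\<close> once some coefficient is available; the
    nonzero element \<open>1\<close> guarantees a nonempty set of coefficients.\<close>
  obtain m v where "corep m v" "(1::'h) \<in> cvec.span (coefs m v)"
    using exists_corep[of "{1}"] by auto
  then have "coefs m v \<noteq> {}" by auto
  then obtain y where "P y" using assms(1)[OF \<open>corep m v\<close>] by (auto simp: coefs_def)
  then have 0: "P 0" using assms(3)[of y 0] by simp
  show ?thesis using u(2)
  proof (induction rule: cvec.span_induct_alt)
    case (step c y z)
    have "P y" using step(1) assms(1)[OF u(1)] by (auto simp: coefs_def)
    from assms(2)[OF assms(3)[OF this] step(2)] show ?case .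
  qed (rule 0)
qed

section \<open>The antipode\<close>

lemma rs_one: "clinear g \<Longrightarrow> rs g 1 = g 1 *\<^sub>C 1" and ls_one: "clinear g \<Longrightarrow> ls g 1 = g 1 *\<^sub>C 1"
  by (simp_all add: rs_def ls_def comult_one one_tensor_def rslice_pure lslice_pure)

lemma antipode_one: "S 1 = 1"
proof -
  note b = cbilinear_antipode(1)
  show ?thesis
    using antipode_left[of 1]
    by (simp add: comult_one one_tensor_def tlift_pure[OF b] counit_one scaleC_one)
qed

lemma counit_antipode: "\<epsilon> (S x) = \<epsilon> x"
proof (induction x rule: corep_induct)
  case (coef n u i j)
  have "\<epsilon> (\<Sum>k<n. S (u i k) * u k j) = (\<Sum>k<n. \<epsilon> (S (u i k)) * (if k = j then 1 else 0))"
    unfolding clin[OF clinear_counit] counit_mult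
    using coef by (intro sum.cong) (simp_all add: corep_counit)
  also have "\<dots> = \<epsilon> (S (u i j))"
    using coef by (simp add: if_distrib[of "(*) _"] cong: if_cong)
  finally show ?case
    using coef by (simp add: corep_antipode corep_counit counit_one clin[OF clinear_counit] split: if_splits)
qed (simp_all add: clin[OF clinear_antipode] clin[OF clinear_counit])

lemma comult_mult_coef:
  assumes "corep n u" "i < n" "j < n" "corep m v" "k < m" "l < m"
  shows "\<Delta> (u i j * v k l) = (\<Sum>p<n. \<Sum>q<m. (u i p * v k q) \<otimes> (u p j * v q l))"
  by (simp only: comult_mult corep_comult[OF assms(1-3)] corep_comult[OF assms(4-6)] tensor_mult_sum)

text \<open>For the matrix with entries \<open>u i j * v k l\<close>, indexed by pairs, the antipode
  axiom gives the left inverse, while the product of \<open>S v\<close> and \<open>S u\<close>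
  cancels from the inside out and gives a right inverse.\<close>

lemma antipode_mult_coef:
  assumes "corep n u" "i < n" "j < n" "corep m v" "k < m" "l < m"
  shows "S (u i j * v k l) = S (v k l) * S (u i j)"
proof -
  let ?I = "{..<n} \<times> {..<m}"
  note b = cbilinear_antipode(1)
  have "(\<lambda>(i, k) (j, l). S (u i j * v k l)) (i, k) (j, l) = (\<lambda>(i, k) (j, l). S (v k l) * S (u i j)) (i, k) (j, l)"
  proof (rule left_inverse_eq_right_inverse[of ?I _ "\<lambda>(i, k) (j, l). u i j * v k l"])
    fix x y assume xy: "x \<in> ?I" "y \<in> ?I"
    obtain i k j l where [simp]: "x = (i, k)" "y = (j, l)" by fastforce
    have lt: "i < n" "k < m" "j < n" "l < m" using xy by auto
    have "\<epsilon> (u i j * v k l) *\<^sub>C 1 = (if x = y then 1 else 0 :: 'h)"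
      unfolding counit_mult corep_counit[OF assms(1) lt(1,3)] corep_counit[OF assms(4) lt(2,4)]
      by (simp add: scaleC_one)
    moreover have "\<epsilon> (u i j * v k l) *\<^sub>C 1 = (\<Sum>p<n. \<Sum>q<m. S (u i p * v k q) * (u p j * v q l))"
      using antipode_left[of "u i j * v k l"] comult_mult_coef[OF assms(1) lt(1,3) assms(4) lt(2,4)]
      by (simp add: clin[OF tlift_linear[OF b]] tlift_pure[OF b])
    ultimately show "(\<Sum>z\<in>?I. (case x of (i, k) \<Rightarrow> \<lambda>(j, l). S (u i j * v k l)) z *
        (case z of (i, k) \<Rightarrow> \<lambda>(j, l). u i j * v k l) y) = (if x = y then 1 else 0)"
      by (simp add: sum.cartesian_product')
    have "(\<Sum>p<n. \<Sum>q<m. u i p * v k q * (S (v q l) * S (u p j))) =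
        (\<Sum>p<n. u i p * (\<Sum>q<m. v k q * S (v q l)) * S (u p j))"
      by (simp add: sum_distrib_left sum_distrib_right mult.assoc)
    also have "\<dots> = (if k = l then (\<Sum>p<n. u i p * S (u p j)) else 0)"
      using lt assms by (simp add: corep_antipode)
    also have "\<dots> = (if x = y then 1 else 0)"
      using lt assms by (simp add: corep_antipode)
    finally show "(\<Sum>z\<in>?I. (case x of (i, k) \<Rightarrow> \<lambda>(j, l). u i j * v k l) z *
        (case z of (i, k) \<Rightarrow> \<lambda>(j, l). S (v k l) * S (u i j)) y) = (if x = y then 1 else 0)"
      by (simp add: sum.cartesian_product')
  qed (use assms in auto)
  then show ?thesis by simp
qed

lemma antipode_mult: "S (x * y) = S y * S x"
proof (induction x rule: corep_induct)
  case c: (coef n u i j)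
  show ?case
  proof (induction y rule: corep_induct)
    case (coef m v k l)
    show ?case by (rule antipode_mult_coef[OF c coef])
  qed (simp_all add: clin[OF clinear_antipode] distrib_left distrib_right
        scaleC_mult_left scaleC_mult_right)
qed (simp_all add: clin[OF clinear_antipode] distrib_left distrib_right
    scaleC_mult_left scaleC_mult_right)

text \<open>Uniqueness of the inverse of the matrix \<Delta>(u) over \<open>H \<otimes> H\<close>:
  \<Delta>(S u) inverts it because \<Delta> is multiplicative, the flipped formula does so by two
  antipode cancellations.\<close>

lemma comult_antipode_coef:
  assumes "corep n u" "i < n" "j < n"
  shows "\<Delta> (S (u i j)) = (\<Sum>k<n. S (u k j) \<otimes> S (u i k))"
proof (rule left_inverse_eq_right_inverse[of "{..<n}" "\<lambda>i j. \<Delta> (S (u i j))" "\<lambda>i j. \<Delta> (u i j)"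
      "\<lambda>i j. \<Sum>k<n. S (u k j) \<otimes> S (u i k)"])
  fix i j assume "i \<in> {..<n}" "j \<in> {..<n}"
  then have ij: "i < n" "j < n" by auto
  have "(\<Sum>k<n. \<Delta> (S (u i k)) * \<Delta> (u k j)) = \<Delta> (\<Sum>k<n. S (u i k) * u k j)"
    by (simp add: clin[OF clinear_comult] comult_mult)
  also have "\<dots> = (if i = j then 1 else 0)"
    using ij assms by (simp add: corep_antipode comult_one clin[OF clinear_comult])
  finally show "(\<Sum>k<n. \<Delta> (S (u i k)) * \<Delta> (u k j)) = (if i = j then 1 else 0)" .
  have "(\<Sum>k<n. \<Delta> (u i k) * (\<Sum>l<n. S (u l j) \<otimes> S (u k l))) =
      (\<Sum>k<n. \<Sum>a<n. \<Sum>l<n. (u i a * S (u l j)) \<otimes> (u a k * S (u k l)))"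
    using ij assms by (simp add: corep_comult tensor_mult_sum)
  also have "\<dots> = (\<Sum>a<n. \<Sum>l<n. \<Sum>k<n. (u i a * S (u l j)) \<otimes> (u a k * S (u k l)))"
    by (rule trans[OF sum.swap], rule sum.cong[OF refl], rule sum.swap)
  also have "\<dots> = (\<Sum>a<n. \<Sum>l<n. (u i a * S (u l j)) \<otimes> (\<Sum>k<n. u a k * S (u k l)))"
    by (simp add: tensor_sum_right)
  also have "\<dots> = (\<Sum>a<n. \<Sum>l<n. if a = l then (u i a * S (u l j)) \<otimes> 1 else 0)"
    using assms by (intro sum.cong refl)
      (simp add: corep_antipode clinear_zero[OF clinear_tensor_right])
  also have "\<dots> = (\<Sum>a<n. (u i a * S (u a j)) \<otimes> 1)"
    by simp
  also have "\<dots> = (if i = j then 1 else 0)"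
    using ij assms by (simp add: corep_antipode one_tensor_def clinear_zero[OF clinear_tensor_left]
        flip: tensor_sum_left)
  finally show "(\<Sum>k<n. \<Delta> (u i k) * (\<Sum>l<n. S (u l j) \<otimes> S (u k l))) = (if i = j then 1 else 0)" .
qed (use assms in auto)

lemma ls_antipode:
  assumes f: "clinear f"
  shows "ls f (S x) = S (rs (\<lambda>y. f (S y)) x)"
proof (induction x rule: corep_induct)
  case (coef n u i j)
  note f' = clinear_compose[OF f clinear_antipode]
  show ?case
    unfolding corep_rs[OF coef f'] clin[OF clinear_antipode]
    using coef f by (simp add: ls_def comult_antipode_coef lslice_simps)
qed (simp_all only: clin[OF clinear_antipode] clin[OF clinear_ls[OF f]]
    clin[OF clinear_rs[OF clinear_compose[OF f clinear_antipode]]])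

lemma rs_antipode:
  assumes f: "clinear f"
  shows "rs f (S x) = S (ls (\<lambda>y. f (S y)) x)"
proof (induction x rule: corep_induct)
  case (coef n u i j)
  note f' = clinear_compose[OF f clinear_antipode]
  show ?case
    unfolding corep_ls[OF coef f'] clin[OF clinear_antipode]
    using coef f by (simp add: rs_def comult_antipode_coef rslice_simps)
qed (simp_all only: clin[OF clinear_antipode] clin[OF clinear_rs[OF f]]
    clin[OF clinear_ls[OF clinear_compose[OF f clinear_antipode]]])

lemma corep_star: "corep n u \<Longrightarrow> corep n (\<lambda>i j. star (u i j))"
  unfolding corep_def by (auto simp: comult_star counit_star star_sum star_pure)

text \<open>The matrix \<open>S u\<close> is inverted from the right by \<open>u\<close>, and from
  the left by the matrix of \<open>S (star (S (star u)))\<close>: apply \<open>star\<close> and then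
  \<open>S\<close> to the antipode relation of the conjugate corepresentation.\<close>

lemma antipode_star_antipode: "S (star (S (star x))) = x"
proof (induction x rule: corep_induct)
  case (coef n u i j)
  let ?t = "\<lambda>i j. star (S (star (u i j)))"
  show ?case
  proof (rule left_inverse_eq_right_inverse[of "{..<n}" "\<lambda>i j. S (?t i j)" "\<lambda>i j. S (u i j)" u])
    fix i j assume "i \<in> {..<n}" "j \<in> {..<n}"
    then have ij: "i < n" "j < n" by auto
    have "(\<Sum>k<n. S (?t i k) * S (u k j)) = S (star (\<Sum>k<n. S (star (u i k)) * star (u k j)))"
      by (simp add: star_sum star_mult star_star antipode_mult clin[OF clinear_antipode])
    also have "\<dots> = (if i = j then 1 else 0)"
      unfolding corep_antipode(1)[OF corep_star[OF coef(1)] ij]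
      by (simp add: star_one antipode_one star_zero clin[OF clinear_antipode])
    finally show "(\<Sum>k<n. S (?t i k) * S (u k j)) = (if i = j then 1 else 0)" .
    show "(\<Sum>k<n. S (u i k) * u k j) = (if i = j then 1 else 0)"
      by (rule corep_antipode[OF coef(1) ij])
  qed (use coef in auto)
qed (simp_all add: clin[OF clinear_antipode] star_add star_scaleC)

lemma star_antipode_star: "star (S (star (S x))) = x"
  using antipode_star_antipode[of "star x"] by (metis star_star)

lemma inj_antipode: "S x = S y \<Longrightarrow> x = y"
  by (metis star_antipode_star)

text \<open>The involution of the dual \<open>*\<close>-algebra of \<open>H\<close>.\<close>

definition dagger :: "('h \<Rightarrow> complex) \<Rightarrow> 'h \<Rightarrow> complex"
  where "dagger g z = cnj (g (star (S z)))"

lemma clinear_dagger: "clinear g \<Longrightarrow> clinear (dagger g)"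
  unfolding dagger_def by (rule clinear_compose[OF clinear_cnj_star clinear_antipode])

lemma dagger_dagger: "dagger (dagger g) = g"
  by (simp add: dagger_def fun_eq_iff star_antipode_star)

end

section \<open>Hermitian forms\<close>

definition hform :: "('a::complex_vector \<Rightarrow> 'a \<Rightarrow> complex) \<Rightarrow> bool"
  where "hform F \<longleftrightarrow> (\<forall>x. clinear (F x)) \<and> (\<forall>x y. F y x = cnj (F x y))"

lemma hform_lin: "hform F \<Longrightarrow> clinear (F x)"
  and hform_sym: "hform F \<Longrightarrow> F y x = cnj (F x y)"
  unfolding hform_def by blast+

lemma hform_add_left: "hform F \<Longrightarrow> F (x + y) z = F x z + F y z"
  and hform_scale_left: "hform F \<Longrightarrow> F (c *\<^sub>C x) z = cnj c * F x z"
proof -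
  assume F: "hform F"
  show "F (x + y) z = F x z + F y z" "F (c *\<^sub>C x) z = cnj c * F x z"
    using hform_sym[OF F, of "x + y" z] hform_sym[OF F, of x z] hform_sym[OF F, of y z]
      hform_sym[OF F, of "c *\<^sub>C x" z]
    by (simp_all add: clin[OF hform_lin[OF F]])
qed

lemma hform_zero_left: "hform F \<Longrightarrow> F 0 z = 0"
  using hform_scale_left[of F 0 0 z] by simp

lemma hform_sum_left: "hform F \<Longrightarrow> F (\<Sum>i\<in>I. f i) z = (\<Sum>i\<in>I. F (f i) z)"
  by (induction I rule: infinite_finite_induct) (simp_all add: hform_zero_left hform_add_left)

lemma hform_diff_left: "hform F \<Longrightarrow> F (x - y) z = F x z - F y z"
  using hform_add_left[of F "x - y" y z] by simp

lemma hform_add_right: "hform F \<Longrightarrow> F z (x + y) = F z x + F z y"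
  and hform_scale_right: "hform F \<Longrightarrow> F z (c *\<^sub>C x) = c * F z x"
  and hform_zero_right: "hform F \<Longrightarrow> F z 0 = 0"
  and hform_diff_right: "hform F \<Longrightarrow> F z (x - y) = F z x - F z y"
  and hform_sum_right: "hform F \<Longrightarrow> F z (\<Sum>i\<in>I. f i) = (\<Sum>i\<in>I. F z (f i))"
proof -
  assume F: "hform F"
  note l = clin[OF hform_lin[OF F, of z]]
  show "F z (x + y) = F z x + F z y" "F z (c *\<^sub>C x) = c * F z x" "F z 0 = 0"
      "F z (x - y) = F z x - F z y" "F z (\<Sum>i\<in>I. f i) = (\<Sum>i\<in>I. F z (f i))"
    by (simp_all add: l)
qed

lemmas hform_simps = hform_add_left hform_scale_left hform_zero_left hform_sum_left hform_diff_left
  hform_add_right hform_scale_right hform_zero_right hform_diff_right hform_sum_right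

lemma hform_real: "hform F \<Longrightarrow> F x x = complex_of_real (Re (F x x))"
  by (metis Reals_cnj_iff hform_sym of_real_Re)

definition psd :: "('a::complex_vector \<Rightarrow> 'a \<Rightarrow> complex) \<Rightarrow> bool"
  where "psd F \<longleftrightarrow> hform F \<and> (\<forall>x. 0 \<le> Re (F x x))"

lemma psd_hform: "psd F \<Longrightarrow> hform F" and psd_nonneg: "psd F \<Longrightarrow> 0 \<le> Re (F x x)"
  by (auto simp: psd_def)

lemma hform_quadratic:
  assumes "hform F"
  shows "Re (F (x + t *\<^sub>C y) (x + t *\<^sub>C y)) =
    Re (F x x) + 2 * Re (t * F x y) + (cmod t)\<^sup>2 * Re (F y y)"
proof -
  have "F (x + t *\<^sub>C y) (x + t *\<^sub>C y) = F x x + (t * F x y + cnj (t * F x y)) + cnj t * t * F y y"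
    using hform_sym[OF assms, of x y] by (simp add: hform_simps[OF assms] algebra_simps)
  moreover have "cnj t * t = complex_of_real ((cmod t)\<^sup>2)"
    using complex_norm_square[of t] by (simp add: mult.commute)
  moreover have "t * F x y + cnj (t * F x y) = complex_of_real (2 * Re (t * F x y))"
    by (rule complex_add_cnj)
  ultimately show ?thesis by simp
qed

text \<open>The quadratic in \<open>t\<close> is evaluated at its minimiser, or far out when its
  leading term vanishes. The subspace \<open>D\<close> appears because one form in the study of the
  Haar functional is known to be nonnegative only on a finite-dimensional coideal.\<close>

lemma Cauchy_Schwarz_on:
  assumes F: "hform F" and D: "cvec.subspace D" and pos: "\<And>z. z \<in> D \<Longrightarrow> 0 \<le> Re (F z z)"
    and x: "x \<in> D" and y: "y \<in> D"
  shows "(cmod (F x y))\<^sup>2 \<le> Re (F x x) * Re (F y y)"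
proof -
  have q: "0 \<le> Re (F x x) + 2 * Re (t * F x y) + (cmod t)\<^sup>2 * Re (F y y)" for t
    unfolding hform_quadratic[OF F, symmetric]
    by (intro pos cvec.subspace_add[OF D] cvec.subspace_scale[OF D] x y)
  have e: "F x y * cnj (F x y) = complex_of_real ((cmod (F x y))\<^sup>2)"
    by (rule complex_norm_square[symmetric])
  show ?thesis
  proof (cases "Re (F y y) = 0")
    case True
    have "(cmod (F x y))\<^sup>2 \<le> 0"
    proof (rule ccontr)
      assume "\<not> (cmod (F x y))\<^sup>2 \<le> 0"
      then have p: "(cmod (F x y))\<^sup>2 > 0" by simp
      \<comment> \<open>Chosen so that the quadratic takes the value
        \<open>- Re (F x x) - 2\<close>, which is negative.\<close>
      define s where "s = (Re (F x x) + 1) / (cmod (F x y))\<^sup>2"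
      have re: "Re ((- (complex_of_real s) * cnj (F x y)) * F x y) = - s * (cmod (F x y))\<^sup>2"
        using e by (metis (no_types, lifting) Re_complex_of_real mult.assoc mult.commute of_real_minus of_real_mult)
      have "0 \<le> Re (F x x) + 2 * (- s * (cmod (F x y))\<^sup>2)"
        using q[of "- (complex_of_real s) * cnj (F x y)"] unfolding re True by simp
      moreover have "s * (cmod (F x y))\<^sup>2 = Re (F x x) + 1"
        using p by (simp add: s_def)
      ultimately show False using pos[OF x] by simp
    qed
    then show ?thesis using True by simp
  next
    case False
    then have c: "Re (F y y) > 0" using pos[OF y] by simp
    let ?b = "(cmod (F x y))\<^sup>2" and ?c = "Re (F y y)"
    define t where "t = - (complex_of_real (1 / ?c)) * cnj (F x y)"
    have "t * F x y = complex_of_real (- (1 / ?c) * ?b)"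
      using e unfolding t_def by (simp add: mult.assoc mult.commute)
    then have "Re (t * F x y) = - (1 / ?c) * ?b" by simp
    moreover have "(cmod t)\<^sup>2 = (1 / ?c)\<^sup>2 * ?b"
      using c by (simp add: t_def norm_mult norm_divide power_mult_distrib power_divide)
    ultimately have "0 \<le> Re (F x x) + 2 * (- (1 / ?c) * ?b) + (1 / ?c)\<^sup>2 * ?b * ?c"
      using q[of t] by simp
    also have "\<dots> = Re (F x x) - ?b / ?c"
      using c by (simp add: power2_eq_square field_simps)
    finally show ?thesis using c by (simp add: field_simps)
  qed
qed

lemma Cauchy_Schwarz: "psd F \<Longrightarrow> (cmod (F x y))\<^sup>2 \<le> Re (F x x) * Re (F y y)"
  using Cauchy_Schwarz_on[of F UNIV x y] by (simp add: psd_def cvec.subspace_UNIV)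

definition posdef_on :: "'a::complex_vector set \<Rightarrow> ('a \<Rightarrow> 'a \<Rightarrow> complex) \<Rightarrow> bool"
  where "posdef_on D F \<longleftrightarrow> hform F \<and> (\<forall>x\<in>D. x \<noteq> 0 \<longrightarrow> 0 < Re (F x x))"

lemma posdef_hform: "posdef_on D F \<Longrightarrow> hform F"
  by (simp add: posdef_on_def)

definition orthonormal :: "('a::complex_vector \<Rightarrow> 'a \<Rightarrow> complex) \<Rightarrow> nat \<Rightarrow> (nat \<Rightarrow> 'a) \<Rightarrow> bool"
  where "orthonormal F n e \<longleftrightarrow> (\<forall>i<n. \<forall>j<n. F (e i) (e j) = (if i = j then 1 else 0))"

lemma orthonormal_dual_system: "hform F \<Longrightarrow> orthonormal F n e \<Longrightarrow> dual_system n e (\<lambda>i. F (e i))"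
  by (simp add: dual_system_def orthonormal_def hform_lin)

lemma orthonormal_project:
  assumes F: "hform F" and e: "orthonormal F n e" and y: "y \<in> cvec.span (e ` {..<n})"
  shows "F y (x - (\<Sum>i<n. F (e i) x *\<^sub>C e i)) = 0"
  using y
proof (induction rule: cvec.span_induct_alt)
  case (step c z w)
  then obtain j where j: "j < n" "z = e j" by auto
  have "(\<Sum>i<n. F (e i) x * F (e j) (e i)) = (\<Sum>i<n. F (e i) x * (if j = i then 1 else 0))"
    using e j by (intro sum.cong) (simp_all add: orthonormal_def)
  also have "\<dots> = F (e j) x"
    using j by (simp add: if_distrib[of "(*) _"] cong: if_cong)
  finally have "F z (x - (\<Sum>i<n. F (e i) x *\<^sub>C e i)) = 0"
    by (simp add: j hform_simps[OF F])
  then show ?case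
    using step(2) by (simp add: hform_add_left[OF F] hform_scale_left[OF F])
qed (simp add: hform_zero_left[OF F])

lemma exists_orthonormal:
  assumes "finite B" "posdef_on (cvec.span B) F"
  shows "\<exists>n e. orthonormal F n e \<and> cvec.span (e ` {..<n}) = cvec.span B"
  using assms
proof (induction B rule: finite_induct)
  case empty
  then show ?case by (intro exI[of _ 0]) (auto simp: orthonormal_def)
next
  case (insert b B)
  have F: "hform F" using insert.prems by (simp add: posdef_on_def)
  have "posdef_on (cvec.span B) F"
    using insert.prems cvec.span_mono[of B "insert b B"] by (auto simp: posdef_on_def)
  then obtain n e where e: "orthonormal F n e" and span: "cvec.span (e ` {..<n}) = cvec.span B"
    using insert.IH by auto
  define p where "p = (\<Sum>i<n. F (e i) b *\<^sub>C e i)"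
  have p: "p \<in> cvec.span B"
    unfolding span[symmetric] p_def by (intro cvec.span_sum cvec.span_scale cvec.span_base) auto
  show ?case
  proof (cases "b = p")
    case True
    then have "cvec.span (insert b B) = cvec.span B"
      using p by (simp add: cvec.span_redundant)
    then show ?thesis using e span by auto
  next
    case False
    define r where "r = sqrt (Re (F (b - p) (b - p)))"
    have bp: "b - p \<in> cvec.span (insert b B)"
      using p cvec.span_mono[of B "insert b B"]
      by (auto intro!: cvec.span_diff simp: cvec.span_base)
    have pos: "Re (F (b - p) (b - p)) > 0"
      using insert.prems bp False by (simp add: posdef_on_def)
    then have r: "r > 0" "r * r = Re (F (b - p) (b - p))" by (simp_all add: r_def)
    define v where "v = complex_of_real (1 / r) *\<^sub>C (b - p)"
    define e' where "e' = e(n := v)"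
    have "F v v = 1"
    proof -
      have "F v v = complex_of_real (1 / r) * complex_of_real (1 / r) * F (b - p) (b - p)"
        unfolding v_def hform_scale_left[OF F] hform_scale_right[OF F] by simp
      also have "F (b - p) (b - p) = complex_of_real (r * r)"
        using hform_real[OF F, of "b - p"] r by simp
      also have "complex_of_real (1 / r) * complex_of_real (1 / r) * complex_of_real (r * r) = 1"
        using r(1) by simp
      finally show ?thesis .
    qed
    moreover have ev: "F (e i) v = 0" if "i < n" for i
    proof -
      have "F (e i) (b - p) = 0"
        unfolding p_def using that by (intro orthonormal_project[OF F e] cvec.span_base) auto
      then show ?thesis unfolding v_def hform_scale_right[OF F] by simp
    qed
    moreover have "F v (e i) = 0" if "i < n" for i
      using ev[OF that] hform_sym[OF F, of v "e i"] by simp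
    ultimately have "orthonormal F (Suc n) e'"
      using e by (auto simp: orthonormal_def e'_def less_Suc_eq)
    moreover have "cvec.span (e' ` {..<Suc n}) = cvec.span (insert b B)"
    proof -
      have *: "e' ` {..<Suc n} = insert v (e ` {..<n})"
        by (auto simp: e'_def less_Suc_eq image_iff)
      have "cvec.span (insert v (e ` {..<n})) \<subseteq> cvec.span (insert b B)"
      proof (rule cvec.span_minimal)
        have "v \<in> cvec.span (insert b B)" unfolding v_def by (rule cvec.span_scale[OF bp])
        moreover have "e ` {..<n} \<subseteq> cvec.span (insert b B)"
          using span cvec.span_superset[of "e ` {..<n}"] cvec.span_mono[of B "insert b B"] by auto
        ultimately show "insert v (e ` {..<n}) \<subseteq> cvec.span (insert b B)" by simp
      qed simp
      moreover have "cvec.span (insert b B) \<subseteq> cvec.span (insert v (e ` {..<n}))"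
      proof (rule cvec.span_minimal)
        have sB: "cvec.span B \<subseteq> cvec.span (insert v (e ` {..<n}))"
          unfolding span[symmetric] by (rule cvec.span_mono) auto
        have "b = complex_of_real r *\<^sub>C v + p"
          using r(1) by (simp add: v_def scaleC_scaleC scaleC_one)
        moreover have "complex_of_real r *\<^sub>C v + p \<in> cvec.span (insert v (e ` {..<n}))"
          using sB p by (intro cvec.span_add cvec.span_scale) (auto simp: cvec.span_base)
        ultimately have "b \<in> cvec.span (insert v (e ` {..<n}))" by simp
        then show "insert b B \<subseteq> cvec.span (insert v (e ` {..<n}))"
          using sB cvec.span_superset[of B] by auto
      qed simp
      ultimately show ?thesis by (simp add: * subset_antisym)
    qed
    ultimately show ?thesis by blast
  qed
qed

section \<open>Invariant inner products\<close>

lemma sum_fun_apply: "(\<Sum>i\<in>I. f i) x = (\<Sum>i\<in>I. f i x)"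
  for f :: "'i \<Rightarrow> 'a \<Rightarrow> 'b::comm_monoid_add"
  by (induction I rule: infinite_finite_induct) simp_all

lemma Conj_unConj_sum: "unConj (\<Sum>i\<in>I. f i) = (\<Sum>i\<in>I. unConj (f i))"
  by (induction I rule: infinite_finite_induct) (simp_all add: zero_cconj_def plus_cconj_def)

locale cqg = hopf \<Delta> \<epsilon> S
  for \<Delta> :: "'h::star_algebra \<Rightarrow> ('h, 'h) tensor" and \<epsilon> :: "'h \<Rightarrow> complex" and S :: "'h \<Rightarrow> 'h" +
  assumes cqg: "CQG_algebra \<Delta> \<epsilon> S"
begin

text \<open>The comodule of \<open>u\<close> is realised on sequences supported below
  \<open>n\<close>, the kind of comodule that \<open>CQG_algebra\<close> quantifies over.
  Compatibility, read off on basis vectors, says that the Gram matrix intertwines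
  \<open>star u\<close> with \<open>S u\<close>.\<close>

lemma corep_inner_product:
  assumes u: "corep n u"
  defines "M \<equiv> {f :: nat \<Rightarrow> complex. \<forall>i\<ge>n. f i = 0}"
    and "e \<equiv> (\<lambda>i k. if k = i then 1 else 0) :: nat \<Rightarrow> nat \<Rightarrow> complex"
  shows "\<exists>ip. inner_product_on M ip \<and> (\<forall>a<n. \<forall>b<n.
    (\<Sum>i<n. ip (e i) (e b) *\<^sub>C star (u i a)) = (\<Sum>k<n. ip (e a) (e k) *\<^sub>C S (u k b)))"
proof -
  define \<delta> where "\<delta> f = (\<Sum>j<n. f j *\<^sub>C (\<Sum>i<n. e i \<otimes> u i j))" for f :: "nat \<Rightarrow> complex"
  have lin: "clinear \<delta>"
    by (rule clinearI) (simp_all add: \<delta>_def scaleC_fun_def scaleC_add_left sum.distrib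
        cvec.scale_sum_right scaleC_scaleC)
  have \<delta>_e: "\<delta> (e a) = (\<Sum>i<n. e i \<otimes> u i a)" if "a < n" for a
  proof -
    have "\<delta> (e a) = (\<Sum>j<n. if j = a then (\<Sum>i<n. e i \<otimes> u i j) else 0)"
      unfolding \<delta>_def e_def by (intro sum.cong) (simp_all add: scaleC_one)
    then show ?thesis using that by simp
  qed
  have eM: "e i \<in> M" if "i < n" for i using that by (simp add: M_def e_def)
  have expand: "m = (\<Sum>j<n. m j *\<^sub>C e j)" if "m \<in> M" for m
  proof
    fix k
    have "(\<Sum>j<n. m j *\<^sub>C e j) k = (\<Sum>j<n. if k = j then m j else 0)"
      by (simp add: sum_fun_apply scaleC_fun_def e_def if_distrib[of "(*) _"] cong: if_cong)
    then show "m k = (\<Sum>j<n. m j *\<^sub>C e j) k" using that by (simp add: M_def)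
  qed
  have sub: "cvec.subspace M"
    by (auto simp: cvec.subspace_def M_def scaleC_fun_def)
  have M: "M = cvec.span (e ` {..<n})"
  proof
    have "m \<in> cvec.span (e ` {..<n})" if "m \<in> M" for m
      by (subst expand[OF that], intro cvec.span_sum cvec.span_scale cvec.span_base) auto
    then show "M \<subseteq> cvec.span (e ` {..<n})" by blast
    show "cvec.span (e ` {..<n}) \<subseteq> M"
      by (rule cvec.span_minimal[OF _ sub]) (auto intro: eM)
  qed
  have fin: "finite_dim M" unfolding finite_dim_def M by blast
  have "comodule \<Delta> \<epsilon> M \<delta>"
    unfolding comodule_def
  proof (intro conjI ballI)
    fix m assume m: "m \<in> M"
    show "\<delta> m \<in> tensor_sub M UNIV"
      unfolding tensor_sub_def \<delta>_def
      by (intro cvec.span_sum cvec.span_scale cvec.span_base) (auto intro: eM)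
    note l1 = clin[OF clinear_tmap[OF lin clinear_ident]] clin[OF clinear_tassoc]
      clin[OF clinear_tmap[OF clinear_ident clinear_comult]]
      tmap_pure[OF lin clinear_ident] tmap_pure[OF clinear_ident clinear_comult]
    have "tassoc (tmap \<delta> (\<lambda>x. x) (\<delta> m)) =
        (\<Sum>j<n. m j *\<^sub>C (\<Sum>i<n. \<Sum>k<n. e k \<otimes> (u k i \<otimes> u i j)))"
      unfolding \<delta>_def[of m] l1 by (simp add: \<delta>_e tensor_sum_left l1 tassoc_pure)
    also have "\<dots> = (\<Sum>j<n. m j *\<^sub>C (\<Sum>k<n. \<Sum>i<n. e k \<otimes> (u k i \<otimes> u i j)))"
      by (subst sum.swap) simp
    also have "\<dots> = tmap (\<lambda>x. x) \<Delta> (\<delta> m)"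
      unfolding \<delta>_def[of m] l1 by (simp add: corep_comult[OF u] tensor_sum_right)
    finally show "tassoc (tmap \<delta> id (\<delta> m)) = tmap id \<Delta> (\<delta> m)"
      by (simp add: id_def)
    have "rslice \<epsilon> (\<delta> m) = (\<Sum>j<n. m j *\<^sub>C (\<Sum>i<n. if i = j then e i else 0))"
      unfolding \<delta>_def clin[OF clinear_rslice[OF clinear_counit]] rslice_pure[OF clinear_counit]
      by (intro sum.cong arg_cong[of _ _ "scaleC _"]) (simp_all add: corep_counit[OF u] scaleC_one)
    also have "\<dots> = m" by (simp flip: expand[OF m])
    finally show "tlift (\<lambda>m\<^sub>0 m\<^sub>1. \<epsilon> m\<^sub>1 *\<^sub>C m\<^sub>0) (\<delta> m) = m"
      by (simp add: rslice_def)
  qed (use sub lin in auto)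
  then obtain ip where ip: "inner_product_on M ip" and comp: "compatible S M \<delta> ip"
    using cqg fin unfolding CQG_algebra_def by blast
  then obtain \<delta>' where dual: "dual_coaction S M \<delta> \<delta>'"
    and map: "comodule_map (Conj ` M) (conj_coaction \<delta>) (dual_space M) \<delta>'
      (\<lambda>m. restrict_to M (ip (unConj m)))"
    unfolding compatible_def by blast
  define \<phi> where "\<phi> = (\<lambda>m. restrict_to M (ip (unConj m)))"
  have \<phi>: "clinear \<phi>" using map by (simp add: comodule_map_def \<phi>_def)
  have lin_ip: "clinear (ip m)" for m using ip by (simp add: inner_product_on_def)
  have "(\<Sum>i<n. ip (e i) (e b) *\<^sub>C star (u i a)) = (\<Sum>k<n. ip (e a) (e k) *\<^sub>C S (u k b))"
    if ab: "a < n" "b < n" for a b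
  proof -
    have b1: "cbilinear (\<lambda>(m\<^sub>0 :: nat \<Rightarrow> complex) (m\<^sub>1 :: 'h). Conj (Conj m\<^sub>0 \<otimes> star m\<^sub>1))"
    proof -
      have "Conj (c *\<^sub>C x) = cnj c *\<^sub>C Conj x" "Conj (x + y) = Conj x + Conj y"
        for c and x y :: "nat \<Rightarrow> complex"
        by (simp_all add: scaleC_cconj_def plus_cconj_def)
      then show ?thesis
        by (simp add: cbilinear_def clinear_iff star_add star_scaleC tensor_of_add_left
            tensor_of_add_right tensor_of_scale_left tensor_of_scale_right)
          (simp add: scaleC_cconj_def plus_cconj_def)
    qed
    have "conj_coaction \<delta> (Conj (e a)) = (\<Sum>i<n. Conj (e i) \<otimes> star (u i a))"
      by (simp add: conj_coaction_def \<delta>_e ab clin[OF tlift_linear[OF b1]] tlift_pure[OF b1]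
          Conj_unConj_sum)
    moreover have "\<delta>' (\<phi> (Conj (e a))) = tmap \<phi> (\<lambda>x. x) (conj_coaction \<delta> (Conj (e a)))"
      using map eM[OF ab(1)] by (simp add: comodule_map_def \<phi>_def id_def)
    ultimately have 1: "\<delta>' (restrict_to M (ip (e a))) = (\<Sum>i<n. restrict_to M (ip (e i)) \<otimes> star (u i a))"
      by (simp add: clin[OF clinear_tmap[OF \<phi> clinear_ident]] tmap_pure[OF \<phi> clinear_ident])
        (simp add: \<phi>_def)
    have ev: "clinear (\<lambda>f :: (nat \<Rightarrow> complex) \<Rightarrow> complex. f (e b))"
      by (rule clinearI) (simp_all add: scaleC_fun_def)
    have b2: "cbilinear (\<lambda>m\<^sub>0 m\<^sub>1. ip (e a) m\<^sub>0 *\<^sub>C S m\<^sub>1)"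
      by (rule cbilinear_scale_left[OF lin_ip clinear_antipode])
    have eq: "lslice (\<lambda>f. f (e b)) (\<delta>' (restrict_to M (ip (e a)))) =
        tlift (\<lambda>m\<^sub>0 m\<^sub>1. ip (e a) m\<^sub>0 *\<^sub>C S m\<^sub>1) (\<delta> (e b))"
      using dual lin_ip eM[OF ab(2)] unfolding dual_coaction_def lslice_def by blast
    show ?thesis
      using eq unfolding 1 \<delta>_e[OF ab(2)]
      by (simp add: lslice_simps ev clin[OF tlift_linear[OF b2]] tlift_pure[OF b2]
          restrict_to_def eM ab)
  qed
  then show ?thesis using ip by blast
qed

text \<open>Via \<open>rs\<close> the dual algebra of \<open>H\<close> acts on \<open>H\<close>;
  invariance says that this action is a \<open>*\<close>-representation for the involution
  \<open>dagger\<close>.\<close>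

definition invariant_on :: "'h set \<Rightarrow> ('h \<Rightarrow> 'h \<Rightarrow> complex) \<Rightarrow> bool"
  where "invariant_on D F \<longleftrightarrow>
    (\<forall>x\<in>D. \<forall>y\<in>D. \<forall>g. clinear g \<longrightarrow> F (rs g x) y = F x (rs (dagger g) y))"

lemma exists_invariant_form:
  assumes "finite B" "rcoideal (cvec.span B)"
  shows "\<exists>F. posdef_on (cvec.span B) F \<and> invariant_on (cvec.span B) F"
proof -
  obtain n d g where dg: "dual_system n d g" "cvec.span (d ` {..<n}) = cvec.span B"
    using exists_dual_system[OF assms(1)] by blast
  define u where "u = (\<lambda>i j. ls (g i) (d j))"
  have "rcoideal (cvec.span (d ` {..<n}))" using dg assms by simp
  note u = coideal_corep[OF dg(1) this, folded u_def]
  have u2: "rs f (d j) = (\<Sum>i<n. f (u i j) *\<^sub>C d i)" if "j < n" "clinear f" for j f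
    unfolding u_def using u(2)[OF that] by simp
  define M where "M = {f :: nat \<Rightarrow> complex. \<forall>i\<ge>n. f i = 0}"
  define e where "e = ((\<lambda>i k. if k = i then 1 else 0) :: nat \<Rightarrow> nat \<Rightarrow> complex)"
  obtain ip where ip: "inner_product_on M ip"
    and inv: "\<And>a b. a < n \<Longrightarrow> b < n \<Longrightarrow>
      (\<Sum>i<n. ip (e i) (e b) *\<^sub>C star (u i a)) = (\<Sum>k<n. ip (e a) (e k) *\<^sub>C S (u k b))"
    using corep_inner_product[OF u(1)] unfolding M_def e_def by blast
  have ip_sym: "ip k m = cnj (ip m k)" if "m \<in> M" "k \<in> M" for m k
    using ip that unfolding inner_product_on_def by blast
  have ip_pos: "0 < Re (ip m m)" if "m \<in> M" "m \<noteq> 0" for m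
    using ip that unfolding inner_product_on_def by blast
  \<comment> \<open>Coordinates with respect to \<open>d\<close>, extended linearly to all of
    \<open>H\<close>; definiteness of the form pulled back along them is claimed only on the
    span.\<close>
  define \<iota> where "\<iota> x = (\<lambda>i. if i < n then g i x else 0)" for x
  have glin: "clinear (g i)" if "i < n" for i using dg that by (simp add: dual_system_def)
  have \<iota>lin: "clinear \<iota>"
    by (rule clinearI) (auto simp: \<iota>_def fun_eq_iff scaleC_fun_def clinear_add[OF glin] clinear_scale[OF glin])
  have \<iota>M: "\<iota> x \<in> M" for x by (simp add: \<iota>_def M_def)
  have \<iota>d: "\<iota> (d a) = e a" if "a < n" for a
    using dg that by (auto simp: \<iota>_def e_def dual_system_def fun_eq_iff)
  define F where "F x y = ip (\<iota> x) (\<iota> y)" for x y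
  have F: "hform F"
    unfolding hform_def F_def
  proof (intro conjI allI)
    show "clinear (\<lambda>y. ip (\<iota> x) (\<iota> y))" for x
      using ip by (intro clinear_compose[OF _ \<iota>lin]) (simp add: inner_product_on_def)
    show "ip (\<iota> y) (\<iota> x) = cnj (ip (\<iota> x) (\<iota> y))" for x y
      using ip_sym[OF \<iota>M \<iota>M] .
  qed
  have "posdef_on (cvec.span B) F"
    unfolding posdef_on_def
  proof (intro conjI ballI impI F)
    fix x assume x: "x \<in> cvec.span B" "x \<noteq> 0"
    have "\<iota> x \<noteq> 0"
    proof
      assume "\<iota> x = 0"
      then have "g i x = 0" if "i < n" for i
        using that by (auto simp: \<iota>_def fun_eq_iff split: if_splits)
      then show False
        using dual_system_expand[OF dg(1), of x] x dg(2) by simp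
    qed
    then show "0 < Re (F x x)"
      unfolding F_def by (rule ip_pos[OF \<iota>M])
  qed
  moreover have "F (rs f x) y = F x (rs (dagger f) y)"
    if x: "x \<in> cvec.span B" and y: "y \<in> cvec.span B" and f: "clinear f" for x y f
  proof -
    note f' = clinear_dagger[OF f]
    have base: "F (rs f (d a)) (d b) = F (d a) (rs (dagger f) (d b))" if ab: "a < n" "b < n" for a b
    proof -
      \<comment> \<open>Applied to \<open>inv\<close>, this functional turns
        \<open>star (u i a)\<close> into the conjugate of \<open>f (u i a)\<close> and
        \<open>S (u k b)\<close> into \<open>dagger f (u k b)\<close>.\<close>
      define k where "k z = cnj (f (star z))" for z
      have k: "clinear k" unfolding k_def by (rule clinear_cnj_star[OF f])
      have "k (\<Sum>i<n. ip (e i) (e b) *\<^sub>C star (u i a)) = k (\<Sum>i<n. ip (e a) (e i) *\<^sub>C S (u i b))"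
        by (simp add: inv ab)
      then have "(\<Sum>i<n. ip (e i) (e b) * cnj (f (u i a))) = (\<Sum>i<n. ip (e a) (e i) * dagger f (u i b))"
        by (simp add: clin[OF k] dagger_def) (simp add: k_def star_star)
      moreover have "F (d i) (d l) = ip (e i) (e l)" if "i < n" "l < n" for i l
        using that by (simp add: F_def \<iota>d)
      ultimately show ?thesis
        unfolding u2[OF ab(1) f] u2[OF ab(2) f']
        by (simp add: hform_simps[OF F] ab mult.commute)
    qed
    note lins = clin[OF clinear_rs[OF f]] clin[OF clinear_rs[OF f']]
    have "F (rs f (d a)) y = F (d a) (rs (dagger f) y)" if a: "a < n" for a
      using y unfolding dg(2)[symmetric]
    proof (induction rule: cvec.span_induct_alt)
      case (step c z w)
      then obtain b where "b < n" "z = d b" by auto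
      with step base[OF a] show ?case by (simp add: lins hform_simps[OF F])
    qed (simp add: lins hform_simps[OF F])
    note base' = this
    show ?thesis
      using x unfolding dg(2)[symmetric]
    proof (induction rule: cvec.span_induct_alt)
      case (step c z w)
      then obtain b where "b < n" "z = d b" by auto
      with step base' show ?case by (simp add: lins hform_simps[OF F])
    qed (simp add: lins hform_simps[OF F])
  qed
  ultimately show ?thesis by (auto simp: invariant_on_def)
qed

text \<open>In an orthonormal basis for an invariant inner product the matrix of coefficients is unitary.\<close>

lemma orthonormal_sum_star:
  assumes F: "hform F" and inv: "invariant_on D F" and D: "rcoideal D"
    and e: "orthonormal F n e" and span: "cvec.span (e ` {..<n}) = D" and nz: "D \<noteq> {0}"
  shows "\<exists>c>0. (\<Sum>i<n. e i * star (e i)) = complex_of_real c *\<^sub>C 1"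
proof -
  have dg: "dual_system n e (\<lambda>i. F (e i))" by (rule orthonormal_dual_system[OF F e])
  define w where "w = (\<lambda>i j. ls (F (e i)) (e j))"
  have "rcoideal (cvec.span (e ` {..<n}))" using D span by simp
  note w = coideal_corep[OF dg this, folded w_def]
  have w2: "rs f (e j) = (\<Sum>i<n. f (w i j) *\<^sub>C e i)" if "j < n" "clinear f" for j f
    unfolding w_def using w(2)[OF that] by simp
  have eD: "e i \<in> D" if "i < n" for i
    unfolding span[symmetric] by (rule cvec.span_base) (use that in auto)
  have pick: "(\<Sum>i<n. c i * (if i = b then 1 else 0)) = c b" if "b < n" for b and c :: "nat \<Rightarrow> complex"
    using that by (simp add: if_distrib[of "(*) _"] cong: if_cong)
  have unitary: "star (w b a) = S (w a b)" if ab: "a < n" "b < n" for a b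
  proof -
    have "w b a = star (S (w a b))"
    proof (rule functional_ext)
      fix f :: "'h \<Rightarrow> complex" assume f: "clinear f"
      have "F (rs f (e a)) (e b) = (\<Sum>i<n. cnj (f (w i a)) * (if i = b then 1 else 0))"
        unfolding w2[OF ab(1) f] hform_simps[OF F] using e ab
        by (intro sum.cong) (simp_all add: orthonormal_def)
      moreover have "F (e a) (rs (dagger f) (e b)) = (\<Sum>i<n. dagger f (w i b) * (if i = a then 1 else 0))"
        unfolding w2[OF ab(2) clinear_dagger[OF f]] hform_simps[OF F] using e ab
        by (intro sum.cong) (auto simp: orthonormal_def)
      ultimately have "cnj (f (w b a)) = dagger f (w a b)"
        using inv[unfolded invariant_on_def, rule_format, OF eD[OF ab(1)] eD[OF ab(2)] f]
        unfolding pick[OF ab(1)] pick[OF ab(2)] by simp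
      then show "f (w b a) = f (star (S (w a b)))" by (simp add: dagger_def)
    qed
    then show ?thesis by (simp add: star_star)
  qed
  have e_eq: "e j = (\<Sum>i<n. \<epsilon> (e i) *\<^sub>C w i j)" if "j < n" for j
    unfolding w_def using w(3)[OF that] by (simp add: w_def)
  \<comment> \<open>Expanding each \<open>e j\<close> by \<open>e_eq\<close> and replacing
    \<open>star w\<close> by \<open>S w\<close> collapses the sum to the squared length of the
    vector of counit values \<epsilon>(e i).\<close>
  define c where "c = (\<Sum>i<n. (cmod (\<epsilon> (e i)))\<^sup>2)"
  have "e j * star (e j) = (\<Sum>i<n. \<Sum>k<n. (\<epsilon> (e i) * cnj (\<epsilon> (e k))) *\<^sub>C (w i j * S (w j k)))"
    if j: "j < n" for j
  proof -
    have "e j * star (e j) = (\<Sum>i<n. \<epsilon> (e i) *\<^sub>C w i j) * star (\<Sum>k<n. \<epsilon> (e k) *\<^sub>C w k j)"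
      using e_eq[OF j] by simp
    also have "\<dots> = (\<Sum>i<n. \<epsilon> (e i) *\<^sub>C w i j) * (\<Sum>k<n. cnj (\<epsilon> (e k)) *\<^sub>C S (w j k))"
      using unitary[OF j] by (simp add: star_sum star_scaleC)
    finally show ?thesis
      by (simp add: sum_product scaleC_mult_left scaleC_mult_right scaleC_scaleC mult.commute)
  qed
  then have "(\<Sum>j<n. e j * star (e j)) =
      (\<Sum>j<n. \<Sum>i<n. \<Sum>k<n. (\<epsilon> (e i) * cnj (\<epsilon> (e k))) *\<^sub>C (w i j * S (w j k)))"
    by simp
  also have "\<dots> = (\<Sum>i<n. \<Sum>k<n. \<Sum>j<n. (\<epsilon> (e i) * cnj (\<epsilon> (e k))) *\<^sub>C (w i j * S (w j k)))"
    by (rule trans[OF sum.swap], rule sum.cong[OF refl], rule sum.swap)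
  also have "\<dots> = (\<Sum>i<n. \<Sum>k<n. (\<epsilon> (e i) * cnj (\<epsilon> (e k))) *\<^sub>C (if i = k then 1 else 0))"
    by (intro sum.cong refl) (simp add: corep_antipode(2)[OF w(1)] flip: cvec.scale_sum_right)
  also have "\<dots> = (\<Sum>i<n. \<Sum>k<n. if i = k then (\<epsilon> (e i) * cnj (\<epsilon> (e k))) *\<^sub>C 1 else 0)"
    by (intro sum.cong refl) simp
  also have "\<dots> = complex_of_real c *\<^sub>C 1"
    by (simp add: c_def cvec.scale_sum_left of_real_sum complex_norm_square del: of_real_power)
  finally have sum: "(\<Sum>j<n. e j * star (e j)) = complex_of_real c *\<^sub>C 1" .
  have "c > 0"
  proof -
    have "\<exists>i<n. \<epsilon> (e i) \<noteq> 0"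
    proof (rule ccontr)
      assume "\<not> (\<exists>i<n. \<epsilon> (e i) \<noteq> 0)"
      then have "(\<Sum>i<n. \<epsilon> (e i) *\<^sub>C w i j) = 0" for j by simp
      then have "e j = 0" if "j < n" for j using e_eq[OF that] by simp
      then have "e ` {..<n} \<subseteq> {0}" by auto
      then have "cvec.span (e ` {..<n}) \<subseteq> {0}"
        by (intro cvec.span_minimal) (auto simp: cvec.subspace_def)
      then show False using nz cvec.span_zero[of "e ` {..<n}"] unfolding span by blast
    qed
    then obtain i where i: "i < n" "\<epsilon> (e i) \<noteq> 0" by blast
    have "0 < (cmod (\<epsilon> (e i)))\<^sup>2" using i by simp
    also have "\<dots> \<le> c" unfolding c_def using i by (intro member_le_sum) auto
    finally show ?thesis .
  qed
  with sum show ?thesis by blast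
qed

end

section \<open>The Haar functional\<close>

lemma rslice_star:
  fixes t :: "('a::star_algebra, 'b::star_algebra) tensor"
  assumes g: "clinear g"
  shows "rslice (\<lambda>z. cnj (g (star z))) (star t) = star (rslice g t)"
proof -
  note l = rslice_simps clinear_cnj_star[OF g] g star_add star_pure star_star star_scaleC
  show ?thesis by (induction t rule: tensor_induct) (simp_all add: l)
qed

lemma lslice_star:
  fixes t :: "('a::star_algebra, 'b::star_algebra) tensor"
  assumes g: "clinear g"
  shows "lslice (\<lambda>z. cnj (g (star z))) (star t) = star (lslice g t)"
proof -
  note l = lslice_simps clinear_cnj_star[OF g] g star_add star_pure star_star star_scaleC
  show ?thesis by (induction t rule: tensor_induct) (simp_all add: l)
qed

section \<open>Functionals invariant at a single element\<close>

context hopf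
begin

lemma star_rs: "clinear g \<Longrightarrow> star (rs g x) = rs (\<lambda>z. cnj (g (star z))) (star x)"
  by (simp add: rs_def comult_star rslice_star)

lemma star_ls: "clinear g \<Longrightarrow> star (ls g x) = ls (\<lambda>z. cnj (g (star z))) (star x)"
  by (simp add: ls_def comult_star lslice_star)

lemma ls_add_fun: "ls (\<lambda>a. f a + g a) x = ls f x + ls g x"
  and ls_scale_fun: "ls (\<lambda>a. c * f a) x = c *\<^sub>C ls f x"
  and rs_add_fun: "rs (\<lambda>a. f a + g a) x = rs f x + rs g x"
  and rs_scale_fun: "rs (\<lambda>a. c * f a) x = c *\<^sub>C rs f x"
  unfolding ls_def rs_def lslice_def rslice_def tlift_add_fun[symmetric] tlift_scale_fun[symmetric]
  by (auto intro!: arg_cong[where f = "\<lambda>F. tlift F (\<Delta> x)"] simp: fun_eq_iff scaleC_add_left scaleC_scaleC)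

text \<open>Invariance is asked at one element because an inner product on a finite-dimensional
  coideal yields a functional whose invariance is known only on that coideal.\<close>

definition left_inv :: "('h \<Rightarrow> complex) \<Rightarrow> 'h \<Rightarrow> bool"
  where "left_inv f x \<longleftrightarrow> clinear f \<and> f 1 = 1 \<and> (\<forall>g. clinear g \<longrightarrow> f (rs g x) = f x * g 1)"

definition right_inv :: "('h \<Rightarrow> complex) \<Rightarrow> 'h \<Rightarrow> bool"
  where "right_inv f x \<longleftrightarrow> clinear f \<and> f 1 = 1 \<and> (\<forall>g. clinear g \<longrightarrow> f (ls g x) = f x * g 1)"

text \<open>Apply \<open>f\<close> to the first and \<open>k\<close> to the second leg of \<Delta> x
  and simplify with either invariance. Thus functionals coming from different coideals
  agree.\<close>

lemma left_inv_eq_right_inv: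
  assumes "left_inv f x" "right_inv k x"
  shows "f x = k x"
proof -
  have "f (rs k x) = k (ls f x)"
    using assms by (intro rs_ls) (auto simp: left_inv_def right_inv_def)
  then show ?thesis using assms by (simp add: left_inv_def right_inv_def)
qed

definition antipode_inv :: "'h \<Rightarrow> 'h" where "antipode_inv x = star (S (star x))"

lemma antipode_inv_antipode: "antipode_inv (S x) = x"
  and antipode_antipode_inv: "S (antipode_inv x) = x"
  by (simp_all add: antipode_inv_def star_antipode_star antipode_star_antipode)

lemma clinear_antipode_inv: "clinear antipode_inv"
  unfolding antipode_inv_def
  by (rule clinearI) (simp_all add: star_add star_scaleC clin[OF clinear_antipode])

lemma antipode_inv_one: "antipode_inv 1 = 1"
  by (simp add: antipode_inv_def star_one antipode_one)

lemma antipode_ls: "clinear g \<Longrightarrow> S (ls g x) = rs (\<lambda>z. g (antipode_inv z)) (S x)"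
  by (simp add: rs_antipode clinear_compose[OF _ clinear_antipode_inv] antipode_inv_antipode)

lemma right_inv_antipode:
  assumes "left_inv f (S x)"
  shows "right_inv (\<lambda>y. f (S y)) x"
  using assms unfolding left_inv_def right_inv_def
  by (auto simp: clinear_compose[OF _ clinear_antipode] antipode_one antipode_ls
      clinear_compose[OF _ clinear_antipode_inv] antipode_inv_one)

end

section \<open>Existence, uniqueness and invariance of the Haar functional\<close>

context cqg
begin

text \<open>Pairing with the vector \<open>1\<close> is invariant because \<Delta> 1 = 1 \<otimes>
  1: the action moves across the form \<open>F\<close> by \<open>dagger\<close> and is scalar on
  \<open>1\<close>. Hence \<open>1\<close> is adjoined to \<open>X\<close>.\<close>

lemma exists_left_inv:
  assumes "finite X"
  shows "\<exists>D f. rcoideal D \<and> X \<subseteq> D \<and> (\<forall>x\<in>D. left_inv f x)"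
proof -
  obtain B where B: "finite B" "insert 1 X \<subseteq> cvec.span B" "rcoideal (cvec.span B)"
    using finite_coideal[of "insert 1 X"] assms by auto
  define D where "D = cvec.span B"
  obtain F where F: "posdef_on D F" "invariant_on D F"
    using exists_invariant_form[OF B(1,3)] unfolding D_def by blast
  have h: "hform F" by (rule posdef_hform[OF F(1)])
  have 1: "1 \<in> D" using B by (simp add: D_def)
  then have "F 1 1 \<noteq> 0" using F(1) by (auto simp: posdef_on_def)
  define f where "f y = F 1 y / F 1 1" for y
  have "left_inv f x" if x: "x \<in> D" for x
    unfolding left_inv_def
  proof (intro conjI allI impI)
    show "clinear f"
      unfolding f_def by (rule clinearI) (simp_all add: hform_simps[OF h] add_divide_distrib)
    show "f 1 = 1" using \<open>F 1 1 \<noteq> 0\<close> by (simp add: f_def)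
    fix g :: "'h \<Rightarrow> complex" assume g: "clinear g"
    have "F 1 (rs g x) = F 1 (rs (dagger (dagger g)) x)"
      by (simp add: dagger_dagger)
    also have "\<dots> = F (rs (dagger g) 1) x"
      using F(2) 1 x clinear_dagger[OF g] unfolding invariant_on_def by simp
    also have "\<dots> = g 1 * F 1 x"
      by (simp add: rs_one clinear_dagger[OF g] hform_simps[OF h])
        (simp add: dagger_def antipode_one star_one)
    finally show "f (rs g x) = f x * g 1" by (simp add: f_def)
  qed
  then show ?thesis using B by (auto simp: D_def)
qed

text \<open>The choice is made separately for each \<open>x\<close>; comparing left and right
  invariant functionals shows that the value does not depend on it.\<close>

definition haar :: "'h \<Rightarrow> complex" where "haar x = (SOME f. left_inv f x) x"

lemma haar_right: "right_inv k x \<Longrightarrow> haar x = k x"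
proof -
  assume k: "right_inv k x"
  obtain f where "left_inv f x" using exists_left_inv[of "{x}"] by auto
  then have "left_inv (SOME f. left_inv f x) x" by (rule someI[where P = "\<lambda>f. left_inv f x"])
  then show ?thesis unfolding haar_def by (rule left_inv_eq_right_inv[OF _ k])
qed

lemma haar_left: "left_inv f x \<Longrightarrow> haar x = f x"
proof -
  assume f: "left_inv f x"
  obtain k where "left_inv k (S x)" using exists_left_inv[of "{S x}"] by auto
  from right_inv_antipode[OF this] show ?thesis
    using haar_right left_inv_eq_right_inv[OF f] by simp
qed

lemma clinear_haar: "clinear haar"
proof (rule clinearI)
  fix x y :: 'h and c :: complex
  obtain D f where D: "rcoideal D" "{x, y} \<subseteq> D" "\<forall>x\<in>D. left_inv f x"
    using exists_left_inv[of "{x, y}"] by auto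
  have f: "clinear f" using D by (auto simp: left_inv_def)
  have "x + y \<in> D" "c *\<^sub>C x \<in> D" using D
    by (auto simp: rcoideal_def intro: cvec.subspace_add cvec.subspace_scale)
  then have "haar (x + y) = f (x + y)" "haar (c *\<^sub>C x) = f (c *\<^sub>C x)" "haar x = f x" "haar y = f y"
    using D by (auto intro!: haar_left)
  then show "haar (x + y) = haar x + haar y" "haar (c *\<^sub>C x) = c *\<^sub>C haar x"
    by (simp_all add: clin[OF f])
qed

lemmas haar_simps = clin[OF clinear_haar]

lemma haar_one: "haar 1 = 1"
proof -
  obtain f where f: "left_inv f 1" using exists_left_inv[of "{1}"] by auto
  then show ?thesis using haar_left[OF f] by (simp add: left_inv_def)
qed

lemma haar_rs:
  assumes g: "clinear g"
  shows "haar (rs g x) = haar x * g 1"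
proof -
  obtain D f where D: "rcoideal D" "x \<in> D" "\<forall>x\<in>D. left_inv f x"
    using exists_left_inv[of "{x}"] by auto
  then have "rs g x \<in> D" using g by (simp add: rcoideal_def)
  then have "haar (rs g x) = f (rs g x)" "haar x = f x" using D by (auto intro!: haar_left)
  then show ?thesis using D g by (simp add: left_inv_def)
qed

lemma left_inv_haar: "left_inv haar x"
  by (simp add: left_inv_def clinear_haar haar_one haar_rs)

lemma haar_ls:
  assumes g: "clinear g"
  shows "haar (ls g x) = haar x * g 1"
proof -
  obtain D f where D: "rcoideal D" "S x \<in> D" "\<forall>x\<in>D. left_inv f x"
    using exists_left_inv[of "{S x}"] by auto
  have "S (ls g x) \<in> D"
    using D g by (simp add: antipode_ls rcoideal_def clinear_compose[OF _ clinear_antipode_inv])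
  then have 1: "haar (ls g x) = f (S (ls g x))"
    using D haar_right[OF right_inv_antipode] by simp
  have r: "right_inv (\<lambda>y. f (S y)) x" using D by (intro right_inv_antipode) simp
  show ?thesis using r g haar_right[OF r] 1 by (simp add: right_inv_def)
qed

lemma ls_haar: "ls haar x = haar x *\<^sub>C 1"
proof (rule functional_ext)
  fix g :: "'h \<Rightarrow> complex" assume g: "clinear g"
  show "g (ls haar x) = g (haar x *\<^sub>C 1)"
    using rs_ls[OF clinear_haar g, of x] by (simp add: haar_rs[OF g] clin[OF g])
qed

lemma rs_haar: "rs haar x = haar x *\<^sub>C 1"
proof (rule functional_ext)
  fix g :: "'h \<Rightarrow> complex" assume g: "clinear g"
  show "g (rs haar x) = g (haar x *\<^sub>C 1)"
    using rs_ls[OF g clinear_haar, of x] by (simp add: haar_ls[OF g] clin[OF g])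
qed

lemma haar_star: "haar (star x) = cnj (haar x)"
proof -
  have "left_inv (\<lambda>y. cnj (haar (star y))) x"
    by (simp add: left_inv_def clinear_cnj_star[OF clinear_haar] star_one haar_one star_rs
        haar_rs[OF clinear_cnj_star])
  from haar_left[OF this] show ?thesis by simp
qed

lemma haar_antipode: "haar (S x) = haar x"
  using haar_right[OF right_inv_antipode[OF left_inv_haar]] by simp

section \<open>Strong invariance of the Haar functional\<close>

lemma clinear_haar_mult: "clinear (\<lambda>y. haar (y * z))" "clinear (\<lambda>y. haar (z * y))"
  by (rule clinear_compose[OF clinear_haar clinear_mult_right],
      rule clinear_compose[OF clinear_haar clinear_mult_left])

lemma haar_mult_coef:
  assumes u: "corep n u" "i < n" "j < n" and v: "corep m v" "k < m" "l < m"
  shows "haar (u i j * v k l) *\<^sub>C 1 = (\<Sum>p<n. \<Sum>q<m. haar (u i p * v k q) *\<^sub>C (u p j * v q l))"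
    and "haar (u i j * v k l) *\<^sub>C 1 = (\<Sum>p<n. \<Sum>q<m. haar (u p j * v q l) *\<^sub>C (u i p * v k q))"
proof -
  show "haar (u i j * v k l) *\<^sub>C 1 = (\<Sum>p<n. \<Sum>q<m. haar (u i p * v k q) *\<^sub>C (u p j * v q l))"
    unfolding ls_haar[symmetric] ls_def comult_mult_coef[OF u v]
    by (simp add: lslice_simps clinear_haar)
  show "haar (u i j * v k l) *\<^sub>C 1 = (\<Sum>p<n. \<Sum>q<m. haar (u p j * v q l) *\<^sub>C (u i p * v k q))"
    unfolding rs_haar[symmetric] rs_def comult_mult_coef[OF u v]
    by (simp add: rslice_simps clinear_haar)
qed

lemmas haar_fun_simps = haar_simps distrib_left distrib_right scaleC_mult_left scaleC_mult_right
  ls_add_fun ls_scale_fun rs_add_fun rs_scale_fun clin[OF clinear_antipode]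
  clin[OF clinear_ls] clin[OF clinear_rs] clinear_haar_mult scaleC_complex

text \<open>Strong invariance,
  \<open>h(x\<^sub>1 z) x\<^sub>2 = h(x z\<^sub>1) S(z\<^sub>2)\<close>: invariance replaces the
  scalar \<open>h(x z\<^sub>1)\<close> by \<open>h(x\<^sub>1 z\<^sub>1) x\<^sub>2 z\<^sub>2\<close>,
  and the last factor cancels against the antipode.\<close>

lemma ls_haar_mult: "ls (\<lambda>y. haar (y * z)) x = S (ls (\<lambda>a. haar (x * a)) z)"
proof (induction x rule: corep_induct)
  case u: (coef n u i j)
  show ?case
  proof (induction z rule: corep_induct)
    case v: (coef m v p q)
    have "S (ls (\<lambda>a. haar (u i j * a)) (v p q)) =
        (\<Sum>r<m. (haar (u i j * v p r) *\<^sub>C 1) * S (v r q))"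
      by (simp add: corep_ls[OF v] clinear_haar_mult clin[OF clinear_antipode] scaleC_mult_left)
    also have "\<dots> = (\<Sum>r<m. (\<Sum>k<n. \<Sum>s<m. haar (u i k * v p s) *\<^sub>C (u k j * v s r)) * S (v r q))"
      using haar_mult_coef(1)[OF u v(1,2)] by (intro sum.cong) simp_all
    also have "\<dots> = (\<Sum>r<m. \<Sum>k<n. \<Sum>s<m. haar (u i k * v p s) *\<^sub>C (u k j * (v s r * S (v r q))))"
      by (simp add: sum_distrib_right scaleC_mult_left mult.assoc)
    also have "\<dots> = (\<Sum>k<n. \<Sum>s<m. \<Sum>r<m. haar (u i k * v p s) *\<^sub>C (u k j * (v s r * S (v r q))))"
      by (rule trans[OF sum.swap], rule sum.cong[OF refl], rule sum.swap)
    also have "\<dots> = (\<Sum>k<n. \<Sum>s<m. haar (u i k * v p s) *\<^sub>C (u k j * (\<Sum>r<m. v s r * S (v r q))))"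
      by (simp add: sum_distrib_left cvec.scale_sum_right)
    also have "\<dots> = (\<Sum>k<n. \<Sum>s<m. if s = q then haar (u i k * v p s) *\<^sub>C u k j else 0)"
      using corep_antipode(2)[OF v(1) _ v(3)] by (intro sum.cong refl) simp
    also have "\<dots> = ls (\<lambda>y. haar (y * v p q)) (u i j)"
      using v by (simp add: corep_ls[OF u] clinear_haar_mult)
    finally show ?case ..
  qed (simp_all add: haar_fun_simps)
qed (simp_all add: haar_fun_simps)

text \<open>The mirror image, \<open>S(x\<^sub>1) h(x\<^sub>2 z) = z\<^sub>1 h(x z\<^sub>2)\<close>,
  now with the cancellation of \<open>S u\<close> against \<open>u\<close>.\<close>

lemma antipode_rs_haar_mult: "S (rs (\<lambda>y. haar (y * z)) x) = rs (\<lambda>a. haar (x * a)) z"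
proof (induction x rule: corep_induct)
  case u: (coef n u i j)
  show ?case
  proof (induction z rule: corep_induct)
    case v: (coef m v p q)
    have "S (rs (\<lambda>y. haar (y * v p q)) (u i j)) =
        (\<Sum>k<n. S (u i k) * (haar (u k j * v p q) *\<^sub>C 1))"
      by (simp add: corep_rs[OF u] clinear_haar_mult clin[OF clinear_antipode] scaleC_mult_right)
    also have "\<dots> = (\<Sum>k<n. S (u i k) * (\<Sum>a<n. \<Sum>r<m. haar (u a j * v r q) *\<^sub>C (u k a * v p r)))"
      using haar_mult_coef(2)[OF u(1) _ u(3) v] by (intro sum.cong) simp_all
    also have "\<dots> = (\<Sum>k<n. \<Sum>a<n. \<Sum>r<m. haar (u a j * v r q) *\<^sub>C ((S (u i k) * u k a) * v p r))"
      by (simp add: sum_distrib_left scaleC_mult_right mult.assoc)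
    also have "\<dots> = (\<Sum>a<n. \<Sum>r<m. \<Sum>k<n. haar (u a j * v r q) *\<^sub>C ((S (u i k) * u k a) * v p r))"
      by (rule trans[OF sum.swap], rule sum.cong[OF refl], rule sum.swap)
    also have "\<dots> = (\<Sum>a<n. \<Sum>r<m. haar (u a j * v r q) *\<^sub>C ((\<Sum>k<n. S (u i k) * u k a) * v p r))"
      by (simp add: sum_distrib_right cvec.scale_sum_right)
    also have "\<dots> = (\<Sum>a<n. if i = a then \<Sum>r<m. haar (u a j * v r q) *\<^sub>C v p r else 0)"
      using corep_antipode(1)[OF u(1,2)] by (intro sum.cong refl) simp
    also have "\<dots> = rs (\<lambda>a. haar (u i j * a)) (v p q)"
      using u by (simp add: corep_rs[OF v] clinear_haar_mult)
    finally show ?case .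
  qed (simp_all add: haar_fun_simps)
qed (simp_all add: haar_fun_simps)

lemma rs_haar_mult: "rs (\<lambda>y. haar (z * y)) x = S (rs (\<lambda>a. haar (a * x)) z)"
  by (simp add: antipode_rs_haar_mult)

end

section \<open>Positivity of the Haar functional\<close>

text \<open>\<open>l\<close> is the minimum of the Rayleigh quotient of \<open>G\<close> relative to
  \<open>F\<close>, attained on the unit sphere of coordinate vectors by compactness.\<close>

lemma minimal_ratio:
  assumes F: "hform F" and G: "hform G" and e: "orthonormal F n e" and n: "n > 0"
  defines "D \<equiv> cvec.span (e ` {..<n})"
  shows "\<exists>l. \<exists>x\<in>D. x \<noteq> 0 \<and> Re (G x x) = l * Re (F x x) \<and> (\<forall>y\<in>D. l * Re (F y y) \<le> Re (G y y))"
proof -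
  define X where "X v = (\<Sum>i<n. v i *\<^sub>C e i)" for v :: "nat \<Rightarrow> complex"
  define q where "q v = Re (\<Sum>i<n. \<Sum>k<n. cnj (v i) * v k * G (e i) (e k))" for v :: "nat \<Rightarrow> complex"
  define N where "N v = (\<Sum>i<n. (cmod (v i))\<^sup>2)" for v :: "nat \<Rightarrow> complex"
  have GX: "Re (G (X v) (X v)) = q v" for v
    unfolding X_def q_def hform_sum_left[OF G] hform_scale_left[OF G] hform_sum_right[OF G]
      hform_scale_right[OF G] by (simp only: sum_distrib_left mult.assoc, subst sum.swap, simp only: mult.left_commute)
  have FX: "F (X v) (X v) = complex_of_real (N v)" for v
  proof -
    have "F (X v) (X v) = (\<Sum>i<n. cnj (v i) * (\<Sum>k<n. v k * (if i = k then 1 else 0)))"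
      unfolding X_def hform_sum_left[OF F] hform_scale_left[OF F] hform_sum_right[OF F]
        hform_scale_right[OF F]
      using e by (simp add: orthonormal_def if_distrib[of "(*) _"] mult.commute cong: if_cong)
    also have "\<dots> = (\<Sum>i<n. cnj (v i) * v i)"
      by (simp add: if_distrib[of "(*) _"] cong: if_cong)
    also have "\<dots> = complex_of_real (N v)"
      by (simp add: N_def complex_norm_square mult.commute del: of_real_power)
    finally show ?thesis .
  qed
  \<comment> \<open>Coordinate vectors are sequences here; the entries from \<open>n\<close> on are
    pinned to \<open>0\<close>, so that the sphere sits in a compact product of discs and
    points.\<close>
  define K where "K = PiE UNIV (\<lambda>i. if i < n then cball 0 1 else {0}) \<inter> {v. N v = 1}"
  have "compactin (product_topology (\<lambda>_. euclidean) UNIV)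
      (PiE UNIV (\<lambda>i. if i < n then cball 0 1 else {0 :: complex}))"
    unfolding compactin_PiE by auto
  then have "compact (PiE UNIV (\<lambda>i. if i < n then cball 0 1 else {0 :: complex}))"
    by (simp add: euclidean_product_topology)
  moreover have "closed {v :: nat \<Rightarrow> complex. N v = 1}"
    unfolding N_def by (intro closed_Collect_eq continuous_intros) simp_all
  ultimately have K: "compact K" unfolding K_def by (rule compact_Int_closed)
  have ne: "K \<noteq> {}"
  proof -
    have "(\<lambda>i. if i = 0 then 1 else 0 :: complex) \<in> K"
      using n by (auto simp: K_def N_def if_distrib[of "\<lambda>x. (cmod x)\<^sup>2"] cong: if_cong)
    then show ?thesis by blast
  qed
  have "continuous_on K q"
    unfolding q_def by (intro continuous_intros continuous_on_subset[OF continuous_on_product_coordinates]) auto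
  then obtain v where v: "v \<in> K" "\<And>w. w \<in> K \<Longrightarrow> q v \<le> q w"
    using continuous_attains_inf[OF K ne] by blast
  have XD: "X w \<in> D" for w
    unfolding X_def D_def by (intro cvec.span_sum cvec.span_scale cvec.span_base) auto
  have Nv: "N v = 1" using v by (simp add: K_def)
  have "q v * Re (F y y) \<le> Re (G y y)" if y: "y \<in> D" for y
  proof -
    define w where "w i = (if i < n then F (e i) y else 0)" for i
    have y_eq: "y = X w"
      using dual_system_expand[OF orthonormal_dual_system[OF F e], of y] y by (simp add: X_def w_def D_def)
    show ?thesis
    proof (cases "N w = 0")
      case True
      then have "w i = 0" for i
        unfolding N_def by (cases "i < n") (auto simp: sum_nonneg_eq_0_iff w_def)
      then have "y = 0" by (simp add: y_eq X_def)
      then show ?thesis by (simp add: hform_simps[OF F] hform_simps[OF G])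
    next
      case False
      have pos: "N w > 0" using False by (metis N_def less_eq_real_def sum_nonneg zero_le_power2)
      define r where "r = sqrt (N w)"
      have r: "r > 0" "r\<^sup>2 = N w" using pos by (simp_all add: r_def)
      define w' where "w' i = complex_of_real (1 / r) * w i" for i
      have Xw': "X w' = complex_of_real (1 / r) *\<^sub>C y"
        by (simp add: X_def w'_def y_eq cvec.scale_sum_right scaleC_scaleC)
      have "N w' = (1 / r)\<^sup>2 * N w"
        by (simp add: N_def w'_def norm_mult power_mult_distrib sum_distrib_left norm_divide power_divide)
      then have Nw': "N w' = 1" using r pos by (simp add: power_divide)
      have "cmod (w' i) \<le> 1" if "i < n" for i
      proof -
        have "(cmod (w' i))\<^sup>2 \<le> N w'" unfolding N_def using that by (intro member_le_sum) auto
        then show ?thesis using Nw' by (simp add: power_le_one_iff abs_square_le_1)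
      qed
      then have "w' \<in> K" using Nw' by (auto simp: K_def w'_def w_def)
      then have "q v \<le> q w'" by (rule v)
      also have "q w' = Re (G (X w') (X w'))" by (simp add: GX)
      also have "\<dots> = (1 / r)\<^sup>2 * Re (G y y)"
        unfolding Xw' by (simp add: hform_simps[OF G] power2_eq_square)
      finally have "q v * r\<^sup>2 \<le> Re (G y y)"
        using r(1) by (simp add: field_simps power2_eq_square)
      then show ?thesis using FX[of w] r(2) by (simp add: y_eq)
    qed
  qed
  moreover have "X v \<noteq> 0"
  proof
    assume "X v = 0"
    with FX[of v] Nv show False by (simp add: hform_simps[OF F])
  qed
  ultimately show ?thesis
    using XD[of v] GX[of v] FX[of v] Nv by (intro exI[of _ "q v"] bexI[of _ "X v"]) auto
qed

lemma finite_span_subspace: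
  assumes "cvec.subspace K" "K \<subseteq> cvec.span B" "finite (B :: 'a::complex_vector set)"
  shows "\<exists>C. finite C \<and> cvec.span C = K"
proof -
  obtain C where C: "C \<subseteq> K" "cvec.independent C" "K \<subseteq> cvec.span C"
    using cvec.maximal_independent_subset[of K] by blast
  have "finite C" using cvec.independent_span_bound[OF assms(3) C(2)] C(1) assms(2) by auto
  moreover have "cvec.span C = K"
    using cvec.span_minimal[OF C(1) assms(1)] C(3) by auto
  ultimately show ?thesis by blast
qed

lemma span_star: "cvec.span (star ` B) = star ` cvec.span (B :: 'a::star_algebra set)"
proof -
  have *: "star ` cvec.span C \<subseteq> cvec.span (star ` C)" for C :: "'a set"
  proof (clarify)
    fix x assume "x \<in> cvec.span C"
    then show "star x \<in> cvec.span (star ` C)"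
    proof (induction rule: cvec.span_induct_alt)
      case (step c x y)
      then have "star x \<in> cvec.span (star ` C)" by (intro cvec.span_base imageI)
      then show ?case
        using step(2) unfolding star_add star_scaleC by (intro cvec.span_add cvec.span_scale)
    qed (simp add: star_zero cvec.span_zero)
  qed
  have ss: "star ` star ` C = C" for C :: "'a set" by (auto simp: image_image star_star)
  have "star ` cvec.span (star ` B) \<subseteq> cvec.span B" using *[of "star ` B"] by (simp add: ss)
  then have "star ` star ` cvec.span (star ` B) \<subseteq> star ` cvec.span B" by (rule image_mono)
  with *[of B] show ?thesis by (simp add: ss subset_antisym)
qed

lemma subspace_star: "cvec.subspace (star ` K)" if "cvec.subspace K" for K :: "'a::star_algebra set"
  using that span_star[of K] by (metis cvec.span_eq_iff cvec.subspace_span)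

context hopf
begin

lemma rcoideal_star:
  assumes "rcoideal K"
  shows "rcoideal (star ` K)"
  using assms unfolding rcoideal_def
proof (intro conjI allI impI ballI)
  fix g :: "'h \<Rightarrow> complex" and x assume g: "clinear g" and x: "x \<in> star ` K"
  then obtain y where y: "y \<in> K" "x = star y" by auto
  have "rs g (star y) = star (rs (\<lambda>z. cnj (g (star z))) y)"
    by (simp add: star_rs clinear_cnj_star[OF g] star_star)
  then show "rs g x \<in> star ` K"
    using y assms clinear_cnj_star[OF g] by (auto simp: rcoideal_def)
qed (auto intro: subspace_star)

end

context cqg
begin

definition hinner :: "'h \<Rightarrow> 'h \<Rightarrow> complex" where "hinner x y = haar (star x * y)"

lemma hform_hinner: "hform hinner"
  unfolding hform_def hinner_def
proof (intro conjI allI)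
  show "clinear (\<lambda>y. haar (star x * y))" for x by (rule clinear_haar_mult)
  show "haar (star y * x) = cnj (haar (star x * y))" for x y
    by (simp add: star_mult star_star flip: haar_star)
qed

lemma haar_rs_mult:
  assumes g: "clinear g"
  shows "haar (rs g x * y) = haar (x * rs (\<lambda>z. g (S z)) y)"
proof -
  have "haar (rs g x * y) = g (ls (\<lambda>t. haar (t * y)) x)"
    using rs_ls[OF clinear_haar_mult(1) g] .
  also have "\<dots> = g (S (ls (\<lambda>a. haar (x * a)) y))"
    by (simp add: ls_haar_mult)
  also have "\<dots> = haar (x * rs (\<lambda>z. g (S z)) y)"
    using rs_ls[OF clinear_haar_mult(2) clinear_compose[OF g clinear_antipode]] by simp
  finally show ?thesis .
qed

lemma invariant_hinner: "invariant_on D hinner"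
  unfolding invariant_on_def hinner_def
  by (simp add: star_rs haar_rs_mult clinear_cnj_star) (simp add: dagger_def[abs_def])

text \<open>Let \<open>l\<close> be the least ratio of \<open>hinner\<close> to an invariant inner
  product \<open>F\<close> on a finite-dimensional coideal \<open>D\<close> containing
  \<open>x\<close>; it suffices that \<open>l > 0\<close>. The radical \<open>K\<close> of
  \<open>hinner - l F\<close> on \<open>D\<close> is a nonzero coideal on which the two forms are
  proportional. On the image of \<open>K\<close> under \<open>star\<close>, an orthonormal basis
  \<open>e'\<close> for an invariant form has the sum of all \<open>e' i * star (e' i)\<close> equal
  to \<open>c\<close> times \<open>1\<close> with \<open>c > 0\<close>. Applying \<open>h\<close>
  gives \<open>c = l t\<close> with \<open>t \<ge> 0\<close>, hence \<open>l > 0\<close>.\<close>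

lemma hinner_pos:
  assumes "x \<noteq> 0"
  shows "0 < Re (hinner x x)"
proof -
  obtain B where B: "finite B" "{x} \<subseteq> cvec.span B" "rcoideal (cvec.span B)"
    using finite_coideal[of "{x}"] by auto
  define D where "D = cvec.span B"
  have subD: "cvec.subspace D" by (simp add: D_def)
  obtain F where F: "posdef_on D F" and inv: "invariant_on D F"
    using exists_invariant_form[OF B(1,3)] unfolding D_def by blast
  note hF = posdef_hform[OF F]
  obtain n e where e: "orthonormal F n e" and span: "cvec.span (e ` {..<n}) = D"
    using exists_orthonormal[OF B(1)] F unfolding D_def by blast
  have "n > 0" using span B(2) assms by (cases n) (auto simp: D_def)
  from minimal_ratio[OF hF hform_hinner e this]
  obtain l x0 where x0: "x0 \<in> D" "x0 \<noteq> 0" "Re (hinner x0 x0) = l * Re (F x0 x0)"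
    and min: "\<And>y. y \<in> D \<Longrightarrow> l * Re (F y y) \<le> Re (hinner y y)"
    unfolding span by blast
  define N where "N x y = hinner x y - complex_of_real l * F x y" for x y
  have hN: "hform N"
    unfolding hform_def N_def
  proof (intro conjI allI)
    show "clinear (\<lambda>y. hinner x y - complex_of_real l * F x y)" for x
      by (rule clinearI) (simp_all add: hform_simps[OF hF] hform_simps[OF hform_hinner] algebra_simps)
    show "hinner y x - complex_of_real l * F y x = cnj (hinner x y - complex_of_real l * F x y)" for x y
      using hform_sym[OF hF, of y x] hform_sym[OF hform_hinner, of y x] by simp
  qed
  define K where "K = {z \<in> D. \<forall>y\<in>D. N z y = 0}"
  \<comment> \<open>\<open>x0\<close> is isotropic for \<open>N\<close>, which is nonnegative on
    \<open>D\<close>, so Cauchy-Schwarz puts it into the radical.\<close>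
  have "N x0 y = 0" if "y \<in> D" for y
  proof -
    have "(cmod (N x0 y))\<^sup>2 \<le> Re (N x0 x0) * Re (N y y)"
      by (rule Cauchy_Schwarz_on[OF hN subD _ x0(1) that]) (simp add: N_def min)
    then show ?thesis using x0 by (simp add: N_def)
  qed
  then have "x0 \<in> K" using x0 by (simp add: K_def)
  have K: "rcoideal K"
    unfolding rcoideal_def
  proof (intro conjI allI impI ballI)
    show "cvec.subspace K"
      using subD by (auto simp: cvec.subspace_def K_def hform_simps[OF hN])
    fix g :: "'h \<Rightarrow> complex" and z assume g: "clinear g" and z: "z \<in> K"
    have "N (rs g z) y = 0" if y: "y \<in> D" for y
    proof -
      have zD: "z \<in> D" using z by (simp add: K_def)
      have y': "rs (dagger g) y \<in> D"
        using B(3) y clinear_dagger[OF g] by (simp add: rcoideal_def D_def)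
      have "F (rs g z) y = F z (rs (dagger g) y)"
        using inv zD y g by (simp add: invariant_on_def)
      moreover have "hinner (rs g z) y = hinner z (rs (dagger g) y)"
        using invariant_hinner[of D] zD y g by (simp add: invariant_on_def)
      ultimately have "N (rs g z) y = N z (rs (dagger g) y)" by (simp add: N_def)
      then show ?thesis using z y' by (simp add: K_def)
    qed
    moreover have "rs g z \<in> D" using B(3) z g by (simp add: rcoideal_def D_def K_def)
    ultimately show "rs g z \<in> K" by (simp add: K_def)
  qed
  obtain C where C: "finite C" "cvec.span C = K"
    using finite_span_subspace[of K B] K B(1) by (auto simp: rcoideal_def K_def D_def)
  have sC: "cvec.span (star ` C) = star ` K" using C by (simp add: span_star)
  have "finite (star ` C)" using C by simp
  moreover have rK: "rcoideal (star ` K)" by (rule rcoideal_star[OF K])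
  ultimately obtain F' where F': "posdef_on (star ` K) F'" and inv': "invariant_on (star ` K) F'"
    using exists_invariant_form[of "star ` C"] unfolding sC by blast
  obtain m e' where e': "orthonormal F' m e'" "cvec.span (e' ` {..<m}) = star ` K"
    using exists_orthonormal[OF \<open>finite (star ` C)\<close>] F' unfolding sC by blast
  have "star ` K \<noteq> {0}"
  proof
    assume "star ` K = {0}"
    then have "star x0 = 0" using \<open>x0 \<in> K\<close> by blast
    then show False using x0 by (metis star_star star_zero)
  qed
  from orthonormal_sum_star[OF posdef_hform[OF F'] inv' rK e' this]
  obtain c where c: "c > 0" "(\<Sum>i<m. e' i * star (e' i)) = complex_of_real c *\<^sub>C 1"
    by blast
  have kK: "star (e' i) \<in> K" if "i < m" for i
  proof -
    have "e' i \<in> star ` K" unfolding e'(2)[symmetric] by (rule cvec.span_base) (use that in auto)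
    then show ?thesis by (auto simp: star_star)
  qed
  have "complex_of_real c = (\<Sum>i<m. hinner (star (e' i)) (star (e' i)))"
    using arg_cong[OF c(2), of haar] by (simp add: haar_simps haar_one hinner_def star_star)
  also have "\<dots> = (\<Sum>i<m. complex_of_real l * F (star (e' i)) (star (e' i)))"
  proof (rule sum.cong[OF refl])
    fix i assume "i \<in> {..<m}"
    then have "star (e' i) \<in> K" using kK by simp
    then have "N (star (e' i)) (star (e' i)) = 0" by (simp add: K_def)
    then show "hinner (star (e' i)) (star (e' i)) = complex_of_real l * F (star (e' i)) (star (e' i))"
      by (simp add: N_def)
  qed
  also have "\<dots> = complex_of_real l * (\<Sum>i<m. F (star (e' i)) (star (e' i)))"
    by (simp add: sum_distrib_left)
  finally have "Re (complex_of_real c) = Re (complex_of_real l * (\<Sum>i<m. F (star (e' i)) (star (e' i))))"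
    by (rule arg_cong)
  then have "c = l * (\<Sum>i<m. Re (F (star (e' i)) (star (e' i))))"
    by simp
  moreover have "0 \<le> (\<Sum>i<m. Re (F (star (e' i)) (star (e' i))))"
  proof (rule sum_nonneg)
    fix i assume "i \<in> {..<m}"
    then have "star (e' i) \<in> D" using kK by (simp add: K_def)
    then show "0 \<le> Re (F (star (e' i)) (star (e' i)))"
      using F by (cases "star (e' i) = 0") (auto simp: posdef_on_def hform_simps)
  qed
  ultimately have "l > 0" using c(1) by (metis mult_nonpos_nonneg not_le)
  moreover have "x \<in> D" using B by (simp add: D_def)
  ultimately show ?thesis
    using min[of x] F assms by (auto simp: posdef_on_def intro: less_le_trans[OF mult_pos_pos])
qed

lemma haar_faithful: "haar (star x * x) = 0 \<Longrightarrow> x = 0"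
  using hinner_pos[of x] by (auto simp: hinner_def)

lemma haar_nondegenerate: "(\<And>y. haar (y * x) = 0) \<Longrightarrow> x = 0"
  by (rule haar_faithful) simp

lemma psd_hinner: "psd hinner"
proof -
  have "0 \<le> Re (hinner x x)" for x
    using hinner_pos[of x] by (cases "x = 0") (auto simp: hform_simps[OF hform_hinner])
  then show ?thesis by (simp add: psd_def hform_hinner)
qed

end

section \<open>Positive functionals and bounded elements\<close>

definition pos_fun :: "('a::star_algebra \<Rightarrow> complex) \<Rightarrow> bool"
  where "pos_fun w \<longleftrightarrow> clinear w \<and> (\<forall>x. 0 \<le> Re (w (star x * x)) \<and> Im (w (star x * x)) = 0)"

lemma pos_fun_lin: "pos_fun w \<Longrightarrow> clinear w"
  by (simp add: pos_fun_def)

text \<open>Polarisation: reality of \<open>w\<close> on the squares of \<open>x + y\<close> and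
  \<open>x + \<i> *\<^sub>C y\<close> gives the imaginary and the real part of hermitian
  symmetry.\<close>

lemma pos_fun_psd:
  assumes "pos_fun w"
  shows "psd (\<lambda>x y. w (star x * y))"
proof -
  note lin = clin[OF pos_fun_lin[OF assms]]
  have im: "Im (w (star x * x)) = 0" for x using assms by (simp add: pos_fun_def)
  have "w (star y * x) = cnj (w (star x * y))" for x y
  proof (rule complex_eqI)
    have "star (x + y) * (x + y) = star x * x + star x * y + star y * x + star y * y"
      by (simp add: star_add algebra_simps)
    then show "Im (w (star y * x)) = Im (cnj (w (star x * y)))"
      using im[of "x + y"] im[of x] im[of y] by (simp add: lin)
    have "star (x + \<i> *\<^sub>C y) * (x + \<i> *\<^sub>C y) =
        star x * x + \<i> *\<^sub>C (star x * y) - \<i> *\<^sub>C (star y * x) + star y * y"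
      by (simp add: star_add star_scaleC algebra_simps scaleC_mult_left scaleC_mult_right
          scaleC_add_right scaleC_scaleC scaleC_one)
    then show "Re (w (star y * x)) = Re (cnj (w (star x * y)))"
      using im[of "x + \<i> *\<^sub>C y"] im[of x] im[of y] by (simp add: lin)
  qed
  moreover have "clinear (\<lambda>y. w (star x * y))" for x
    by (rule clinear_compose[OF pos_fun_lin[OF assms] clinear_mult_left])
  ultimately show ?thesis using assms unfolding psd_def hform_def pos_fun_def by blast
qed

lemma pos_fun_star:
  assumes "pos_fun w"
  shows "w (star x) = cnj (w x)"
  using hform_sym[OF psd_hform[OF pos_fun_psd[OF assms]], of x 1] by (simp add: star_one)

lemma pos_fun_conj:
  assumes "pos_fun w"
  shows "pos_fun (\<lambda>x. w (star b * x * b))"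
proof -
  have "star b * (star x * x) * b = star (x * b) * (x * b)" for x
    by (simp add: star_mult mult.assoc)
  moreover have "clinear (\<lambda>x. w (star b * x * b))"
    by (rule clinear_compose[OF pos_fun_lin[OF assms] clinear_compose[OF clinear_mult_right clinear_mult_left]])
  ultimately show ?thesis using assms by (simp add: pos_fun_def)
qed

definition sum_squares :: "'a::star_algebra list \<Rightarrow> 'a"
  where "sum_squares ws = sum_list (map (\<lambda>w. star w * w) ws)"

lemma sum_squares_Cons: "sum_squares (w # ws) = star w * w + sum_squares ws"
  by (simp add: sum_squares_def)

lemma sum_squares_append: "sum_squares (vs @ ws) = sum_squares vs + sum_squares ws"
  by (simp add: sum_squares_def)

text \<open>An algebraic certificate of boundedness: it bounds \<open>x\<close> under every positive
  functional, hence in every \<open>*\<close>-representation at once.\<close>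

definition bounded_element :: "'a::star_algebra \<Rightarrow> bool"
  where "bounded_element x \<longleftrightarrow> (\<exists>(K::real) ws. star x * x + sum_squares ws = complex_of_real K *\<^sub>C 1)"

text \<open>The parallelogram law: adding the square of \<open>x - y\<close> turns the square of
  \<open>x + y\<close> into twice the sum of the two squares.\<close>

lemma bounded_element_add:
  assumes "bounded_element x" "bounded_element y"
  shows "bounded_element (x + y)"
proof -
  obtain K vs L ws where
    1: "star x * x + sum_squares vs = complex_of_real K *\<^sub>C 1" and
    2: "star y * y + sum_squares ws = complex_of_real L *\<^sub>C 1"
    using assms unfolding bounded_element_def by blast
  have "star (x + y) * (x + y) + sum_squares ((x - y) # vs @ vs @ ws @ ws) =
      (star x * x + sum_squares vs) + (star x * x + sum_squares vs) +
      (star y * y + sum_squares ws) + (star y * y + sum_squares ws)"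
    by (simp add: sum_squares_append sum_squares_Cons star_add star_diff algebra_simps)
  also have "\<dots> = complex_of_real (K + K + L + L) *\<^sub>C 1"
    unfolding 1 2 by (simp only: scaleC_add_left of_real_add add.assoc)
  finally show ?thesis unfolding bounded_element_def by blast
qed

lemma bounded_element_scale:
  assumes "bounded_element x"
  shows "bounded_element (c *\<^sub>C x)"
proof -
  obtain K ws where 1: "star x * x + sum_squares ws = complex_of_real K *\<^sub>C 1"
    using assms unfolding bounded_element_def by blast
  have sq: "star (c *\<^sub>C y) * (c *\<^sub>C y) = complex_of_real ((cmod c)\<^sup>2) *\<^sub>C (star y * y)" for y :: 'a
    unfolding complex_norm_square
    by (simp add: star_scaleC scaleC_mult_left scaleC_mult_right scaleC_scaleC mult.commute)
  have "sum_squares (map ((*\<^sub>C) c) ws) = complex_of_real ((cmod c)\<^sup>2) *\<^sub>C sum_squares ws"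
    by (induction ws) (simp_all add: sum_squares_def sq scaleC_add_right)
  then have "star (c *\<^sub>C x) * (c *\<^sub>C x) + sum_squares (map ((*\<^sub>C) c) ws) =
      complex_of_real ((cmod c)\<^sup>2 * K) *\<^sub>C 1"
    by (simp add: sq 1 scaleC_scaleC del: of_real_power flip: scaleC_add_right)
  then show ?thesis unfolding bounded_element_def by blast
qed

lemma bounded_element_pos_fun:
  assumes "bounded_element x"
  shows "\<exists>K\<ge>0. \<forall>w b. pos_fun w \<longrightarrow> Re (w (star (x * b) * (x * b))) \<le> K * Re (w (star b * b))"
proof -
  obtain K ws where 1: "star x * x + sum_squares ws = complex_of_real K *\<^sub>C 1"
    using assms unfolding bounded_element_def by blast
  have "Re (w (star (x * b) * (x * b))) \<le> \<bar>K\<bar> * Re (w (star b * b))" if w: "pos_fun w" for w b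
  proof -
    define v where "v y = w (star b * y * b)" for y
    have v: "pos_fun v" unfolding v_def by (rule pos_fun_conj[OF w])
    note lin = clin[OF pos_fun_lin[OF v]]
    have "0 \<le> Re (v (sum_squares ws))"
      using v by (induction ws) (simp_all add: sum_squares_def lin pos_fun_def)
    moreover
    have "v (star x * x) + v (sum_squares ws) = complex_of_real K * v 1"
      using arg_cong[OF 1, of v] by (simp add: lin)
    from arg_cong[OF this, of Re]
    have "Re (v (star x * x)) + Re (v (sum_squares ws)) = K * Re (v 1)" by simp
    moreover have "0 \<le> Re (v 1)" using v unfolding pos_fun_def by (metis mult_1 star_one)
    then have "K * Re (v 1) \<le> \<bar>K\<bar> * Re (v 1)" by (intro mult_right_mono) auto
    ultimately have "Re (v (star x * x)) \<le> \<bar>K\<bar> * Re (v 1)" by linarith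
    then show ?thesis by (simp add: v_def star_mult mult.assoc)
  qed
  then show ?thesis by (intro exI[of _ "\<bar>K\<bar>"]) auto
qed

context cqg
begin

text \<open>The identity of \<open>orthonormal_sum_star\<close> is a certificate for each
  \<open>star (e i)\<close>. The coideal is therefore built around \<open>star x\<close>, so that
  \<open>x\<close> is a combination of such elements.\<close>

lemma bounded_all: "bounded_element (x :: 'h)"
proof -
  obtain B where B: "finite B" "{star x} \<subseteq> cvec.span B" "rcoideal (cvec.span B)"
    using finite_coideal[of "{star x}"] by auto
  define D where "D = cvec.span B"
  obtain F where F: "posdef_on D F" and inv: "invariant_on D F"
    using exists_invariant_form[OF B(1,3)] unfolding D_def by blast
  obtain n e where e: "orthonormal F n e" and span: "cvec.span (e ` {..<n}) = D"
    using exists_orthonormal[OF B(1)] F unfolding D_def by blast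
  have zero: "bounded_element (0 :: 'h)"
    unfolding bounded_element_def by (intro exI[of _ 0] exI[of _ "[]"]) (simp add: sum_squares_def)
  show ?thesis
  proof (cases "D = {0}")
    case True
    then have "star x = 0" using B by (auto simp: D_def)
    then have "x = 0" by (metis star_star star_zero)
    then show ?thesis using zero by simp
  next
    case False
    obtain c where c: "(\<Sum>i<n. e i * star (e i)) = complex_of_real c *\<^sub>C 1"
      using orthonormal_sum_star[OF posdef_hform[OF F] inv _ e span False] B(3)
      unfolding D_def by blast
    have b: "bounded_element (star (e i))" if i: "i < n" for i
    proof -
      obtain js where js: "set js = {..<n} - {i}" "distinct js"
        using finite_distinct_list[of "{..<n} - {i}"] by auto
      have "sum_squares (map (\<lambda>j. star (e j)) js) = (\<Sum>j\<in>{..<n} - {i}. e j * star (e j))"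
        using js by (simp add: sum_squares_def star_star o_def sum_list_distinct_conv_sum_set)
      moreover have "(\<Sum>j<n. e j * star (e j)) = e i * star (e i) + (\<Sum>j\<in>{..<n} - {i}. e j * star (e j))"
        using i by (intro sum.remove) auto
      ultimately have "star (star (e i)) * star (e i) + sum_squares (map (\<lambda>j. star (e j)) js) =
          complex_of_real c *\<^sub>C 1"
        using c by (simp add: star_star)
      then show ?thesis unfolding bounded_element_def by blast
    qed
    have "star x \<in> cvec.span (e ` {..<n})" using B span by (simp add: D_def)
    then have "bounded_element (star (star x))"
    proof (induction rule: cvec.span_induct_alt)
      case (step a y z)
      then show ?case using b by (auto simp: star_add star_scaleC intro!: bounded_element_add bounded_element_scale)
    qed (simp add: star_zero zero)
    then show ?thesis by (simp add: star_star)
  qed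
qed

lemma pos_fun_haar: "pos_fun haar"
  using psd_nonneg[OF psd_hinner] hform_real[OF hform_hinner]
  by (auto simp: pos_fun_def clinear_haar hinner_def complex_eq_iff)

end

context hopf
begin

lemma clinear_rs_fun: "clinear g \<Longrightarrow> clinear (\<lambda>z. g (S z))"
  by (rule clinear_compose[OF _ clinear_antipode])

lemma counit_rs: "clinear f \<Longrightarrow> \<epsilon> (rs f x) = f x"
  by (simp add: rs_ls[OF clinear_counit] ls_counit)

lemma counit_ls: "clinear f \<Longrightarrow> \<epsilon> (ls f x) = f x"
  by (simp add: rs_ls[OF _ clinear_counit, symmetric] rs_counit)

lemma counit_antipode_inv: "\<epsilon> (antipode_inv x) = \<epsilon> x"
  by (metis antipode_antipode_inv counit_antipode)

end

section \<open>The modular property of the Haar functional\<close>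

context cqg
begin

definition rinner :: "'h \<Rightarrow> 'h \<Rightarrow> complex" where "rinner x y = haar (y * star x)"

lemma posdef_rinner: "posdef_on D rinner"
  unfolding posdef_on_def hform_def rinner_def
proof (intro conjI allI ballI impI)
  show "clinear (\<lambda>y. haar (y * star x))" for x by (rule clinear_haar_mult)
  show "haar (x * star y) = cnj (haar (y * star x))" for x y
    by (simp add: star_mult star_star flip: haar_star)
  fix x :: 'h assume "x \<noteq> 0"
  then have "star x \<noteq> 0" by (metis star_star star_zero)
  from hinner_pos[OF this] show "0 < Re (haar (x * star x))" by (simp add: hinner_def star_star)
qed

lemma hform_rinner: "hform rinner"
  using posdef_rinner by (rule posdef_hform)

text \<open>Riesz representation on a finite-dimensional space: \<open>f\<close> factors through the
  \<open>rinner\<close>-orthogonal projection onto the image of the span under \<open>star\<close>,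
  whose kernel is the annihilator occurring in \<open>vanish\<close>.\<close>

lemma haar_represent:
  assumes B: "finite B" and f: "clinear f"
    and vanish: "\<And>z. (\<And>y. y \<in> cvec.span B \<Longrightarrow> haar (z * y) = 0) \<Longrightarrow> f z = 0"
  shows "\<exists>c. \<forall>z. f z = haar (z * c)"
proof -
  obtain n e where e: "orthonormal rinner n e" and span: "cvec.span (e ` {..<n}) = star ` cvec.span B"
    using exists_orthonormal[OF _ posdef_rinner, of "star ` B"] B by (auto simp: span_star)
  define c where "c = (\<Sum>i<n. f (e i) *\<^sub>C star (e i))"
  have "f z = haar (z * c)" for z
  proof -
    define p where "p = (\<Sum>i<n. rinner (e i) z *\<^sub>C e i)"
    have "haar ((z - p) * y) = 0" if "y \<in> cvec.span B" for y
    proof -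
      have "rinner (star y) (z - p) = 0"
        unfolding p_def using that span by (intro orthonormal_project[OF hform_rinner e]) auto
      then show ?thesis by (simp add: rinner_def star_star)
    qed
    then have "f (z - p) = 0" by (rule vanish)
    then have "f z = (\<Sum>i<n. rinner (e i) z * f (e i))"
      by (simp add: clin[OF f] p_def)
    also have "\<dots> = haar (z * c)"
      by (simp add: c_def rinner_def sum_distrib_left scaleC_mult_right haar_simps mult.commute)
    finally show ?thesis .
  qed
  then show ?thesis by blast
qed

text \<open>By \<open>haar_represent\<close> it suffices that \<open>h(c n) = 0\<close> whenever
  \<open>n\<close> annihilates a finite-dimensional coideal containing all
  \<open>star (S b)\<close>, where \<open>b\<close> runs through a coideal around \<open>c\<close>.
  Put \<open>v = n\<^sub>1 h(c n\<^sub>2)\<close>. Strong invariance writes \<open>v\<close> as some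
  \<open>S b\<close>, and applied once more it gives \<open>h(v (star v)) = 0\<close>. Faithfulness
  yields \<open>v = 0\<close>, and the counit turns this into \<open>h(c n) = 0\<close>.\<close>

lemma haar_modular: "\<exists>c'. \<forall>z. haar (c * z) = haar (z * c')"
proof -
  obtain B where B: "finite B" "{c} \<subseteq> cvec.span B" "rcoideal (cvec.span B)"
    using finite_coideal[of "{c}"] by auto
  obtain B' where B': "finite B'" "(\<lambda>x. star (S x)) ` B \<subseteq> cvec.span B'" "rcoideal (cvec.span B')"
    using finite_coideal[of "(\<lambda>x. star (S x)) ` B"] B by auto
  have sub: "star (S x) \<in> cvec.span B'" if "x \<in> cvec.span B" for x
    using that
  proof (induction rule: cvec.span_induct_alt)
    case (step a x y)
    then have "star (S x) \<in> cvec.span B'" using B' by blast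
    then show ?case
      using step(2) unfolding clin[OF clinear_antipode] star_add star_scaleC
      by (intro cvec.span_add cvec.span_scale)
  qed (simp add: clin[OF clinear_antipode] star_zero cvec.span_zero)
  have "haar (c * n) = 0" if n: "\<And>w. w \<in> cvec.span B' \<Longrightarrow> haar (n * w) = 0" for n
  proof -
    note k = clinear_haar_mult(2)[of c]
    define v where "v = rs (\<lambda>y. haar (c * y)) n"
    have "rs (\<lambda>a. haar (a * n)) c \<in> cvec.span B"
      using B clinear_haar_mult(1) by (simp add: rcoideal_def)
    then have "star v \<in> cvec.span B'"
      unfolding v_def rs_haar_mult by (rule sub)
    have "ls (\<lambda>a. haar (n * a)) (star v) = 0"
    proof (rule functional_ext)
      fix g :: "'h \<Rightarrow> complex" assume g: "clinear g"
      have "g (ls (\<lambda>a. haar (n * a)) (star v)) = haar (n * rs g (star v))"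
        using rs_ls[OF clinear_haar_mult(2) g] by simp
      also have "\<dots> = 0"
        using B' g \<open>star v \<in> cvec.span B'\<close> by (intro n) (simp add: rcoideal_def)
      finally show "g (ls (\<lambda>a. haar (n * a)) (star v)) = g 0" by (simp add: clinear_zero[OF g])
    qed
    then have "ls (\<lambda>t. haar (t * star v)) n = 0"
      by (simp add: ls_haar_mult clin[OF clinear_antipode])
    moreover have "haar (rs (\<lambda>y. haar (c * y)) n * w) = haar (c * ls (\<lambda>t. haar (t * w)) n)" for w
      by (rule rs_ls[OF clinear_haar_mult(1) k])
    then have "haar (v * star v) = haar (c * ls (\<lambda>t. haar (t * star v)) n)"
      unfolding v_def .
    ultimately have "haar (star (star v) * star v) = 0" by (simp add: star_star haar_simps)
    then have "star v = 0" by (rule haar_faithful)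
    then have "v = 0" by (metis star_star star_zero)
    then show ?thesis using counit_rs[OF k, of n] by (simp add: v_def clin[OF clinear_counit])
  qed
  then show ?thesis by (intro haar_represent[OF B'(1) clinear_haar_mult(2)]) blast
qed

lemma haar_modular': "\<exists>c'. \<forall>z. haar (z * c) = haar (c' * z)"
proof -
  obtain d where d: "\<And>z. haar (star c * z) = haar (z * d)"
    using haar_modular by blast
  have "haar (z * c) = haar (star d * z)" for z
  proof -
    have "haar (z * c) = cnj (haar (star c * star z))"
      by (simp add: star_mult flip: haar_star) (simp add: star_star)
    also have "\<dots> = haar (star d * z)"
      unfolding d by (simp add: star_mult star_star flip: haar_star)
    finally show ?thesis .
  qed
  then show ?thesis by blast
qed

end

section \<open>The orthogonal projection onto a coideal subalgebra\<close>

locale coideal = cqg \<Delta> \<epsilon> S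
  for \<Delta> :: "'h::star_algebra \<Rightarrow> ('h, 'h) tensor" and \<epsilon> :: "'h \<Rightarrow> complex" and S :: "'h \<Rightarrow> 'h" +
  fixes A :: "'h set"
  assumes coideal: "right_coideal_star_subalgebra \<Delta> A"
begin

lemma A_subspace: "cvec.subspace A" and A_one: "1 \<in> A"
  and A_mult: "a \<in> A \<Longrightarrow> b \<in> A \<Longrightarrow> a * b \<in> A" and A_star: "a \<in> A \<Longrightarrow> star a \<in> A"
  using coideal by (auto simp: right_coideal_star_subalgebra_def)

lemma A_rs: "a \<in> A \<Longrightarrow> clinear g \<Longrightarrow> rs g a \<in> A"
  using coideal unfolding right_coideal_star_subalgebra_def rs_def
  by (blast intro: rslice_tensor_sub)

lemmas A_intros = A_one A_mult A_star cvec.subspace_add[OF A_subspace] cvec.subspace_scale[OF A_subspace]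
  cvec.subspace_diff[OF A_subspace] cvec.subspace_0[OF A_subspace] cvec.subspace_sum[OF A_subspace]

text \<open>The projection onto a finite-dimensional subcoalgebra \<open>D\<close> commutes with all \<open>ls f\<close>, hence is of
  the form \<open>rs k\<close> and preserves \<open>A\<close>. This reduces the projection of an element of \<open>D\<close> onto
  \<open>A\<close> to the projection onto the finite-dimensional space \<open>A \<inter> D\<close>.\<close>

lemma exists_projection: "\<exists>q\<in>A. \<forall>a\<in>A. haar ((x - q) * a) = 0"
proof -
  obtain n u where u: "corep n u" and x: "{x} \<subseteq> cvec.span (coefs n u)"
    using exists_corep[of "{x}"] by auto
  define D where "D = cvec.span (coefs n u)"
  have subD: "cvec.subspace D" by (simp add: D_def)
  have ls_D: "ls f y \<in> D" if y: "y \<in> D" and f: "clinear f" for f y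
    using y unfolding D_def
  proof (induction rule: cvec.span_induct_alt)
    case (step c y z)
    then obtain i j where ij: "i < n" "j < n" "y = u i j" by (auto simp: coefs_def)
    have "ls f y \<in> cvec.span (coefs n u)"
      unfolding ij(3) corep_ls[OF u ij(1,2) f]
      using ij by (intro cvec.span_sum cvec.span_scale cvec.span_base) (auto simp: coefs_def)
    then show ?case
      using step(2) unfolding clin[OF clinear_ls[OF f]] by (intro cvec.span_add cvec.span_scale)
  qed (simp add: clinear_zero[OF clinear_ls[OF f]] cvec.span_zero)
  obtain m d where d: "orthonormal rinner m d" and span_d: "cvec.span (d ` {..<m}) = D"
    using exists_orthonormal[OF finite_coefs posdef_rinner] unfolding D_def by blast
  define pD where "pD y = (\<Sum>i<m. rinner (d i) y *\<^sub>C d i)" for y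
  have pD_lin: "clinear pD"
    unfolding pD_def
    by (rule clinearI) (simp_all add: hform_simps[OF hform_rinner] scaleC_add_left sum.distrib
        cvec.scale_sum_right scaleC_scaleC)
  have pD_in: "pD y \<in> D" for y
    unfolding pD_def span_d[symmetric] by (intro cvec.span_sum cvec.span_scale cvec.span_base) auto
  have pD_orth: "rinner z (y - pD y) = 0" if "z \<in> D" for y z
    unfolding pD_def by (rule orthonormal_project[OF hform_rinner d]) (simp add: span_d that)
  have pD_unique: "pD y = z" if z: "z \<in> D" and orth: "\<And>w. w \<in> D \<Longrightarrow> rinner w (y - z) = 0" for y z
  proof -
    have w: "pD y - z \<in> D" by (intro cvec.subspace_diff[OF subD] pD_in z)
    have "rinner (pD y - z) (pD y - z) = rinner (pD y - z) (y - z) - rinner (pD y - z) (y - pD y)"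
      by (simp add: hform_diff_right[OF hform_rinner])
    also have "\<dots> = 0" by (simp add: orth[OF w] pD_orth[OF w])
    finally have "rinner (pD y - z) (pD y - z) = 0" .
    then show ?thesis using posdef_rinner[of UNIV] unfolding posdef_on_def
      by (metis UNIV_I eq_iff_diff_eq_0 less_irrefl zero_complex.sel(1))
  qed
  \<comment> \<open>Strong invariance converts orthogonality of \<open>r\<close> to \<open>D\<close>
    into \<open>h(r\<^sub>2 (star w)) r\<^sub>1 = 0\<close> for \<open>w\<close> in
    \<open>D\<close>, and pairing this with \<open>f\<close> gives orthogonality of
    \<open>ls f r\<close> to \<open>D\<close>.\<close>
  have pD_ls: "pD (ls f y) = ls f (pD y)" if f: "clinear f" for f y
  proof (rule pD_unique)
    show "ls f (pD y) \<in> D" by (rule ls_D[OF pD_in f])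
    fix w assume w: "w \<in> D"
    define r where "r = y - pD y"
    have "rs (\<lambda>a. haar (r * a)) (star w) = 0"
    proof (rule functional_ext)
      fix g :: "'h \<Rightarrow> complex" assume g: "clinear g"
      define g' where "g' z = cnj (g (star z))" for z
      have g': "clinear g'" unfolding g'_def by (rule clinear_cnj_star[OF g])
      have "g (rs (\<lambda>a. haar (r * a)) (star w)) = haar (r * ls g (star w))"
        by (rule rs_ls[OF g clinear_haar_mult(2)])
      also have "ls g (star w) = star (ls g' w)"
        by (simp add: star_ls g') (simp add: g'_def star_star)
      also have "haar (r * star (ls g' w)) = rinner (ls g' w) r" by (simp add: rinner_def)
      also have "\<dots> = 0" unfolding r_def by (rule pD_orth[OF ls_D[OF w g']])
      finally show "g (rs (\<lambda>a. haar (r * a)) (star w)) = g 0" by (simp add: clinear_zero[OF g])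
    qed
    then have "S (rs (\<lambda>t. haar (t * star w)) r) = S 0"
      by (simp add: antipode_rs_haar_mult clin[OF clinear_antipode])
    then have 0: "rs (\<lambda>t. haar (t * star w)) r = 0" by (rule inj_antipode)
    have "rinner w (ls f y - ls f (pD y)) = haar (ls f r * star w)"
      by (simp add: rinner_def r_def clin[OF clinear_ls[OF f]])
    also have "\<dots> = f (rs (\<lambda>t. haar (t * star w)) r)"
      by (rule rs_ls[OF f clinear_haar_mult(1), symmetric])
    finally show "rinner w (ls f y - ls f (pD y)) = 0" by (simp add: 0 clinear_zero[OF f])
  qed
  \<comment> \<open>A linear map commuting with all \<open>ls f\<close> is the slice
    \<open>rs\<close> by its composition with the counit, and such slices preserve
    \<open>A\<close>.\<close>
  have pD_A: "pD a \<in> A" if a: "a \<in> A" for a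
  proof -
    note k = clinear_compose[OF clinear_counit pD_lin]
    have "pD a = rs (\<lambda>y. \<epsilon> (pD y)) a"
    proof (rule functional_ext)
      fix f :: "'h \<Rightarrow> complex" assume f: "clinear f"
      show "f (pD a) = f (rs (\<lambda>y. \<epsilon> (pD y)) a)"
        by (simp add: rs_ls[OF f k] pD_ls f counit_ls)
    qed
    then show ?thesis using A_rs[OF a k] by simp
  qed
  have "cvec.subspace (A \<inter> D)" by (intro cvec.subspace_inter A_subspace subD)
  then obtain C where C: "finite C" "cvec.span C = A \<inter> D"
    using finite_span_subspace[OF _ _ finite_coefs, of "A \<inter> D" n u] by (auto simp: D_def)
  obtain k e where e: "orthonormal rinner k e" and span_e: "cvec.span (e ` {..<k}) = A \<inter> D"
    using exists_orthonormal[OF C(1) posdef_rinner] unfolding C(2) by blast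
  define q where "q = (\<Sum>i<k. rinner (e i) x *\<^sub>C e i)"
  have q: "q \<in> A \<inter> D"
    unfolding q_def span_e[symmetric] by (intro cvec.span_sum cvec.span_scale cvec.span_base) auto
  have xq: "x - q \<in> D" using q x by (intro cvec.subspace_diff[OF subD]) (auto simp: D_def)
  have "haar ((x - q) * a) = 0" if a: "a \<in> A" for a
  proof -
    have sa: "star a \<in> A" by (rule A_star[OF a])
    have 1: "rinner (pD (star a)) (x - q) = 0"
      unfolding q_def
      by (rule orthonormal_project[OF hform_rinner e]) (simp add: span_e pD_A[OF sa] pD_in)
    \<comment> \<open>\<open>star a\<close> splits into \<open>pD (star a)\<close>, which lies in
      \<open>A \<inter> D\<close>, and a part orthogonal to \<open>D\<close>; both are orthogonal to
      \<open>x - q\<close>, the second because \<open>x - q\<close> lies in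
      \<open>D\<close>.\<close>
    have "rinner (star a - pD (star a)) (x - q) = cnj (rinner (x - q) (star a - pD (star a)))"
      by (rule hform_sym[OF hform_rinner])
    then have "rinner (star a) (x - q) = 0"
      using 1 pD_orth[OF xq, of "star a"] by (simp add: hform_diff_left[OF hform_rinner])
    then show ?thesis by (simp add: rinner_def star_star)
  qed
  then show ?thesis using q by blast
qed

definition proj :: "'h \<Rightarrow> 'h"
  where "proj x = (SOME q. q \<in> A \<and> (\<forall>a\<in>A. haar ((x - q) * a) = 0))"

lemma proj_in: "proj x \<in> A" and haar_proj_mult: "a \<in> A \<Longrightarrow> haar (proj x * a) = haar (x * a)"
proof -
  have "\<exists>q. q \<in> A \<and> (\<forall>a\<in>A. haar ((x - q) * a) = 0)" using exists_projection[of x] by blast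
  from someI_ex[OF this] have p: "proj x \<in> A" "\<forall>a\<in>A. haar ((x - proj x) * a) = 0"
    unfolding proj_def by blast+
  then show "proj x \<in> A" by simp
  show "haar (proj x * a) = haar (x * a)" if "a \<in> A"
    using p(2) that by (simp add: left_diff_distrib haar_simps)
qed

text \<open>Two candidates differ by an element of \<open>A\<close> that is orthogonal to
  \<open>A\<close>, in particular to itself; \<open>h\<close> is faithful.\<close>

lemma proj_eqI:
  assumes "q \<in> A" "\<And>a. a \<in> A \<Longrightarrow> haar (q * a) = haar (x * a)"
  shows "proj x = q"
proof -
  let ?r = "proj x - q"
  have r: "?r \<in> A" by (intro A_intros proj_in assms)
  have "haar (?r * star ?r) = 0"
    using assms(2)[OF A_star[OF r]] haar_proj_mult[OF A_star[OF r], of x]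
    by (simp add: left_diff_distrib haar_simps)
  then have "haar (star (star ?r) * star ?r) = 0" by (simp add: star_star)
  then have "star ?r = 0" by (rule haar_faithful)
  then have "?r = 0" by (metis star_star star_zero)
  then show ?thesis by simp
qed

lemma clinear_proj: "clinear proj"
proof (rule clinearI)
  show "proj (x + y) = proj x + proj y" for x y
    by (rule proj_eqI) (simp_all add: A_intros proj_in distrib_right haar_simps haar_proj_mult)
  show "proj (c *\<^sub>C x) = c *\<^sub>C proj x" for c x
    by (rule proj_eqI) (simp_all add: A_intros proj_in scaleC_mult_left haar_simps haar_proj_mult)
qed

lemma proj_ident: "a \<in> A \<Longrightarrow> proj a = a"
  by (rule proj_eqI, assumption, rule refl)

lemma proj_mult: "a \<in> A \<Longrightarrow> proj (x * a) = proj x * a"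
  by (rule proj_eqI) (simp_all add: A_intros proj_in mult.assoc haar_proj_mult)

lemma proj_rs:
  assumes g: "clinear g"
  shows "proj (rs g x) = rs g (proj x)"
  by (rule proj_eqI)
    (simp_all add: A_rs proj_in g haar_rs_mult haar_proj_mult clinear_rs_fun)

definition psi :: "'h \<Rightarrow> complex" where "psi x = \<epsilon> (proj x)"

lemma clinear_psi: "clinear psi"
  unfolding psi_def by (rule clinear_compose[OF clinear_counit clinear_proj])

lemma proj_eq_ls: "proj x = ls psi x"
proof (rule functional_ext)
  fix f :: "'h \<Rightarrow> complex" assume f: "clinear f"
  have "f (proj x) = \<epsilon> (proj (rs f x))" by (simp add: proj_rs f counit_rs)
  also have "\<dots> = psi (rs f x)" by (simp add: psi_def)
  also have "\<dots> = f (ls psi x)" by (rule rs_ls[OF clinear_psi f])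
  finally show "f (proj x) = f (ls psi x)" .
qed

lemma psi_ident: "a \<in> A \<Longrightarrow> psi a = \<epsilon> a"
  by (simp add: psi_def proj_ident)

lemma psi_mult: "a \<in> A \<Longrightarrow> psi (x * a) = psi x * \<epsilon> a"
  by (simp add: psi_def proj_mult counit_mult)

text \<open>Self-adjointness of \<open>proj\<close> for \<open>rinner\<close>: both sides equal the
  pairing of the two projected elements.\<close>

lemma haar_proj_star: "haar (proj x * z) = haar (x * star (proj (star z)))"
proof -
  let ?w = "star z"
  have "haar (proj ?w * star (proj x)) = haar (?w * star (proj x))"
    by (intro haar_proj_mult A_intros proj_in)
  then have "cnj (haar (star (proj ?w * star (proj x)))) = cnj (haar (star (?w * star (proj x))))"
    by (simp add: haar_star)
  then have "haar (proj x * star (proj ?w)) = haar (proj x * z)"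
    by (simp add: star_mult star_star)
  moreover have "haar (proj x * star (proj ?w)) = haar (x * star (proj ?w))"
    by (intro haar_proj_mult A_intros proj_in)
  ultimately show ?thesis by simp
qed

text \<open>The adjoint of \<open>proj = ls psi\<close> for the bilinear pairing
  \<open>h (x z)\<close> is computed twice: strong invariance gives slicing with
  \<open>psi \<circ> antipode_inv\<close>, self-adjointness gives
  \<open>star \<circ> proj \<circ> star\<close>. The counit compares the two.\<close>

lemma psi_antipode_inv: "psi (antipode_inv z) = cnj (psi (star z))"
proof -
  note f = clinear_compose[OF clinear_psi clinear_antipode_inv]
  have "ls (\<lambda>y. psi (antipode_inv y)) z - star (proj (star z)) = 0"
  proof (rule haar_nondegenerate)
    fix x
    have "haar (x * ls (\<lambda>y. psi (antipode_inv y)) z) = psi (antipode_inv (rs (\<lambda>a. haar (x * a)) z))"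
      by (rule rs_ls[OF f clinear_haar_mult(2), symmetric])
    also have "\<dots> = psi (rs (\<lambda>t. haar (t * z)) x)"
      by (simp add: antipode_inv_antipode flip: antipode_rs_haar_mult)
    also have "\<dots> = haar (proj x * z)"
      unfolding proj_eq_ls by (rule rs_ls[OF clinear_psi clinear_haar_mult(1)])
    also have "\<dots> = haar (x * star (proj (star z)))" by (rule haar_proj_star)
    finally show "haar (x * (ls (\<lambda>y. psi (antipode_inv y)) z - star (proj (star z)))) = 0"
      by (simp add: right_diff_distrib haar_simps)
  qed
  then have "\<epsilon> (ls (\<lambda>y. psi (antipode_inv y)) z) = \<epsilon> (star (proj (star z)))" by simp
  then have "psi (antipode_inv z) = \<epsilon> (star (proj (star z)))" by (simp only: counit_ls[OF f])
  then show ?thesis by (simp add: counit_star psi_def[of "star z"])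
qed

lemma antipode_image_subset:
  assumes "\<And>a. a \<in> A \<Longrightarrow> S (S a) \<in> A"
  shows "(S \<circ> S) ` A = A"
proof
  show "(S \<circ> S) ` A \<subseteq> A" using assms by auto
  \<comment> \<open>The inverse of \<open>S \<circ> S\<close> is its conjugate by
    \<open>star\<close>, so it maps \<open>A\<close> into \<open>A\<close> as well.\<close>
  show "A \<subseteq> (S \<circ> S) ` A"
  proof
    fix x assume x: "x \<in> A"
    have "antipode_inv (antipode_inv x) = star (S (S (star x)))"
      by (simp add: antipode_inv_def star_star)
    then have "antipode_inv (antipode_inv x) \<in> A" using assms A_star x by simp
    moreover have "x = (S \<circ> S) (antipode_inv (antipode_inv x))"
      by (simp add: antipode_antipode_inv)
    ultimately show "x \<in> (S \<circ> S) ` A" by blast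
  qed
qed

lemma antipode_invariant_if_pos:
  assumes "pos_fun psi"
  shows "(S \<circ> S) ` A = A"
proof (rule antipode_image_subset)
  fix a assume a: "a \<in> A"
  have inv: "psi (S z) = psi z" for z
  proof -
    have "psi (antipode_inv (S z)) = psi (S z)"
      unfolding psi_antipode_inv pos_fun_star[OF assms] by simp
    then show ?thesis by (simp add: antipode_inv_antipode)
  qed
  have "proj (S (S a)) = S (S (proj a))"
    unfolding proj_eq_ls ls_antipode[OF clinear_psi] inv
    by (simp add: rs_antipode[OF clinear_psi] inv)
  then have "S (S a) = proj (S (S a))" using a by (simp add: proj_ident)
  then show "S (S a) \<in> A" using proj_in by metis
qed

section \<open>Consequences of invariance under the square of the antipode\<close>

context
  assumes inv: "(S \<circ> S) ` A = A"
begin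

text \<open>The automorphism \<open>S \<circ> S\<close> preserves both \<open>A\<close> and
  \<open>h\<close>, so conjugating \<open>proj\<close> by it gives an orthogonal projection onto
  \<open>A\<close> again.\<close>

lemma psi_antipode_antipode: "psi (S (S x)) = psi x"
proof -
  define q where "q = antipode_inv (antipode_inv (proj (S (S x))))"
  have SSq: "S (S q) = proj (S (S x))" by (simp add: q_def antipode_antipode_inv)
  have "S (S q) \<in> (S \<circ> S) ` A" unfolding SSq inv by (rule proj_in)
  then obtain a where "a \<in> A" "S (S q) = S (S a)" by auto
  then have qA: "q \<in> A" using inj_antipode by metis
  have "haar (q * a) = haar (x * a)" if a: "a \<in> A" for a
  proof -
    have SSa: "S (S a) \<in> A" using inv a by auto
    have "haar (q * a) = haar (S (S (q * a)))" by (simp add: haar_antipode)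
    also have "\<dots> = haar (proj (S (S x)) * S (S a))" by (simp add: antipode_mult SSq)
    also have "\<dots> = haar (S (S x) * S (S a))" by (rule haar_proj_mult[OF SSa])
    also have "\<dots> = haar (S (S (x * a)))" by (simp add: antipode_mult)
    also have "\<dots> = haar (x * a)" by (simp add: haar_antipode)
    finally show ?thesis .
  qed
  then have "proj x = q" by (rule proj_eqI[OF qA])
  then have "psi x = \<epsilon> q" by (simp add: psi_def)
  also have "\<dots> = psi (S (S x))" by (simp add: q_def counit_antipode_inv psi_def)
  finally show ?thesis ..
qed

text \<open>Here \<open>k\<close> equals both \<open>psi \<circ> antipode_inv\<close> and
  \<open>psi \<circ> S\<close>, and the convolution of \<open>psi\<close> with \<open>k\<close> is
  \<open>psi\<close> since \<open>k\<close> agrees with \<epsilon> on \<open>A\<close>. Composing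
  with \<open>S\<close> reverses convolutions and exchanges \<open>psi\<close> with
  \<open>k\<close>, so it fixes this convolution while turning \<open>psi\<close> into
  \<open>k\<close>.\<close>

lemma psi_star: "psi (star x) = cnj (psi x)"
proof -
  define k where "k z = cnj (psi (star z))" for z
  have k: "clinear k" unfolding k_def by (rule clinear_cnj_star[OF clinear_psi])
  have k_inv: "k z = psi (antipode_inv z)" for z by (simp add: k_def psi_antipode_inv)
  have psi_S: "psi (S z) = k z" for z
    using psi_antipode_antipode[of "antipode_inv z"] by (simp add: antipode_antipode_inv k_inv)
  have k_S: "k (S z) = psi z" for z by (simp add: k_inv antipode_inv_antipode)
  have k_proj: "k (ls psi z) = psi z" for z
  proof -
    have "k (proj z) = cnj (\<epsilon> (star (proj z)))" by (simp add: k_def psi_ident A_star proj_in)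
    then show ?thesis by (simp add: counit_star psi_def flip: proj_eq_ls)
  qed
  have "k x = psi (S x)" by (simp add: psi_S)
  also have "\<dots> = k (ls psi (S x))" by (simp add: k_proj)
  also have "\<dots> = k (S (rs k x))" by (simp add: ls_antipode[OF clinear_psi] psi_S)
  also have "\<dots> = psi (rs k x)" by (simp add: k_S)
  also have "\<dots> = k (ls psi x)" by (rule rs_ls[OF clinear_psi k])
  also have "\<dots> = psi x" by (rule k_proj)
  finally have "cnj (psi (star x)) = psi x" by (simp add: k_def)
  then show ?thesis by (metis complex_cnj_cnj)
qed

lemma proj_star: "proj (star x) = star (proj x)"
  unfolding proj_eq_ls by (simp add: star_ls clinear_psi psi_star star_star)

lemma proj_mult_left: "a \<in> A \<Longrightarrow> proj (a * x) = a * proj x"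
  using proj_mult[of "star a" "star x"] proj_star[of "star x * star a"] proj_star[of "star x"]
  by (simp add: star_mult star_star A_star)

end

text \<open>\<open>psi\<close> kills the left ideal, so \<open>ideal\<close> gives
  \<open>psi (ls phi y) = phi y\<close>; as \<open>proj\<close> is \<open>ls psi\<close>, it fixes
  \<open>ls phi x\<close>, which therefore lies in \<open>A\<close>. By \<open>mult\<close> the map
  \<open>ls phi\<close> is right \<open>A\<close>-linear, and invariance of \<open>h\<close> under
  \<open>ls phi\<close> then yields the orthogonality that characterises
  \<open>proj\<close>.\<close>

lemma ls_eq_proj:
  assumes phi: "clinear phi" and one: "phi 1 = 1"
    and mult: "\<And>x a. a \<in> A \<Longrightarrow> phi (x * a) = phi x * \<epsilon> a"
    and ideal: "\<And>x. ls phi x - phi x *\<^sub>C 1 \<in> ideal_plus \<epsilon> A"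
  shows "ls phi x = proj x"
proof -
  have kill: "psi y = 0" if "y \<in> ideal_plus \<epsilon> A" for y
    using that unfolding ideal_plus_def
    by (induction rule: cvec.span_induct_alt) (auto simp: clin[OF clinear_psi] psi_mult)
  have psi_ls: "psi (ls phi y) = phi y" for y
    using kill[OF ideal[of y]] psi_ident[OF A_one] by (simp add: clin[OF clinear_psi] counit_one)
  have "proj (ls phi x) = ls phi x"
    unfolding proj_eq_ls ls_ls[OF phi clinear_psi] psi_ls ..
  then have in_A: "ls phi x \<in> A" using proj_in by metis
  have pure: "lslice phi (t * (a \<otimes> b)) = \<epsilon> a *\<^sub>C (lslice phi t * b)" if "a \<in> A" for a b t
    by (induction t rule: tensor_induct)
      (simp_all add: tensor_mult_pure lslice_simps phi mult[OF that] distrib_right scaleC_add_right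
        scaleC_mult_left scaleC_scaleC mult.commute)
  have "haar (ls phi x * a) = haar (x * a)" if a: "a \<in> A" for a
  proof -
    obtain F where F: "(\<Sum>b\<in>F. rs (coord b) a \<otimes> b) = \<Delta> a"
      using tensor_expand[of "\<Delta> a"] unfolding rs_def by blast
    have "ls phi (x * a) = lslice phi (\<Delta> x * (\<Sum>b\<in>F. rs (coord b) a \<otimes> b))"
      by (simp add: F ls_def comult_mult)
    also have "\<dots> = (\<Sum>b\<in>F. \<epsilon> (rs (coord b) a) *\<^sub>C (ls phi x * b))"
      by (simp add: sum_distrib_left lslice_simps phi pure A_rs a clinear_coord ls_def)
    also have "\<dots> = ls phi x * (\<Sum>b\<in>F. \<epsilon> (rs (coord b) a) *\<^sub>C b)"
      by (simp add: sum_distrib_left scaleC_mult_right)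
    also have "(\<Sum>b\<in>F. \<epsilon> (rs (coord b) a) *\<^sub>C b) = lslice \<epsilon> (\<Sum>b\<in>F. rs (coord b) a \<otimes> b)"
      by (simp add: lslice_simps clinear_counit)
    also have "\<dots> = a" by (simp add: F counit_left)
    finally show ?thesis using haar_ls[OF phi, of "x * a"] by (simp add: one)
  qed
  then show ?thesis by (rule proj_eqI[OF in_A, symmetric])
qed

end

section \<open>Symmetric contractions\<close>

text \<open>By Cauchy-Schwarz the moments \<open>N b (R\<^sup>M b)\<close> grow geometrically along \<open>M = 2\<^sup>m\<close> if the first one
  exceeds \<open>N b b\<close>, so boundedness of the moments suffices.\<close>

lemma moment_bound:
  assumes N: "psd N" and sym: "\<And>v w. N (R v) w = N v (R w)"
    and C: "\<And>M. cmod (N b ((R ^^ M) b)) \<le> C"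
  shows "Re (N b (R b)) \<le> Re (N b b)"
proof -
  have sym_pow: "N ((R ^^ k) v) w = N v ((R ^^ k) w)" for k v w
    by (induction k arbitrary: v w) (simp_all add: sym funpow_swap1)
  define n where "n = Re (N b b)"
  define r where "r m = cmod (N b ((R ^^ (2 ^ m)) b))" for m :: nat
  have n: "n \<ge> 0" unfolding n_def by (rule psd_nonneg[OF N])
  have step: "(r m)\<^sup>2 \<le> n * r (Suc m)" for m
  proof -
    let ?T = "R ^^ (2 ^ m)"
    have "(r m)\<^sup>2 \<le> n * Re (N (?T b) (?T b))"
      unfolding r_def n_def by (rule Cauchy_Schwarz[OF N])
    also have "N (?T b) (?T b) = N b ((R ^^ (2 ^ Suc m)) b)"
      by (simp add: sym_pow mult_2 funpow_add)
    also have "n * Re \<dots> \<le> n * r (Suc m)"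
      unfolding r_def using n by (intro mult_left_mono complex_Re_le_cmod)
    finally show ?thesis .
  qed
  have "r 0 \<le> n"
  proof (rule ccontr)
    assume *: "\<not> r 0 \<le> n"
    have "n > 0"
    proof (rule ccontr)
      assume "\<not> n > 0"
      then have "n = 0" using n by simp
      then show False using step[of 0] * by simp
    qed
    define t where "t = r 0 / n"
    have t: "t > 1" using * \<open>n > 0\<close> by (simp add: t_def)
    \<comment> \<open>By \<open>step\<close> the ratio \<open>r m / n\<close> is at least squared
      when \<open>m\<close> increases by one.\<close>
    have grow: "n * t ^ (2 ^ m) \<le> r m" for m
    proof (induction m)
      case 0
      show ?case using \<open>n > 0\<close> by (simp add: t_def)
    next
      case (Suc m)
      have "n * (n * t ^ (2 ^ Suc m)) = (n * t ^ (2 ^ m))\<^sup>2"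
        by (simp add: power_mult_distrib power2_eq_square mult_2 power_add)
      also have "\<dots> \<le> (r m)\<^sup>2"
        using Suc \<open>n > 0\<close> t by (intro power_mono) auto
      also have "\<dots> \<le> n * r (Suc m)" by (rule step)
      finally show ?case using \<open>n > 0\<close> by (rule mult_left_le_imp_le)
    qed
    obtain m where m: "C / n < t ^ m" using real_arch_pow[OF t] by blast
    have "t ^ m \<le> t ^ (2 ^ m)" using t by (intro power_increasing) (auto intro: less_imp_le less_exp)
    then have "n * t ^ m \<le> n * t ^ (2 ^ m)" using \<open>n > 0\<close> by simp
    also have "\<dots> \<le> C" using grow[of m] C[of "2 ^ m"] unfolding r_def by linarith
    finally show False using m \<open>n > 0\<close> by (simp add: field_simps)
  qed
  then show ?thesis using complex_Re_le_cmod[of "N b (R b)"] by (simp add: r_def n_def)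
qed

lemma square_le_mult_imp_le:
  fixes x n :: real
  assumes "x\<^sup>2 \<le> n * x" "0 \<le> x" "0 \<le> n"
  shows "x \<le> n"
proof (cases "x = 0")
  case False
  then show ?thesis using assms by (intro mult_right_le_imp_le[of x x n]) (auto simp: power2_eq_square)
qed (use assms in simp)

text \<open>Cauchy-Schwarz for the form \<open>N v (R w)\<close> bounds the square of
  \<open>N (R v) (R v)\<close> by \<open>N v (R v) * N (R v) (R (R v))\<close>, hence on
  \<open>V\<close> by \<open>N v v * N (R v) (R v)\<close>.\<close>

lemma contraction_on:
  assumes N: "psd N" and R: "clinear R" and sym: "\<And>v w. N (R v) w = N v (R w)"
    and pos: "\<And>v. 0 \<le> Re (N v (R v))"
    and V: "\<And>v. v \<in> V \<Longrightarrow> R v \<in> V" "\<And>v. v \<in> V \<Longrightarrow> Re (N v (R v)) \<le> Re (N v v)"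
    and v: "v \<in> V"
  shows "Re (N ((R ^^ M) v) ((R ^^ M) v)) \<le> Re (N v v)"
proof -
  note hN = psd_hform[OF N]
  have psdR: "psd (\<lambda>v w. N v (R w))"
    unfolding psd_def hform_def
  proof (intro conjI allI pos)
    show "clinear (\<lambda>w. N v (R w))" for v by (rule clinear_compose[OF hform_lin[OF hN] R])
    show "N w (R v) = cnj (N v (R w))" for v w
      using hform_sym[OF hN, of w "R v"] by (simp add: sym)
  qed
  have one: "Re (N (R v) (R v)) \<le> Re (N v v)" if v: "v \<in> V" for v
  proof -
    let ?x = "Re (N (R v) (R v))"
    have x: "?x \<ge> 0" by (rule psd_nonneg[OF N])
    have "?x\<^sup>2 \<le> (cmod (N (R v) (R v)))\<^sup>2"
      using x complex_Re_le_cmod by (intro power_mono)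
    also have "(cmod (N (R v) (R v)))\<^sup>2 = (cmod (N v (R (R v))))\<^sup>2" by (simp only: sym)
    also have "(cmod (N v (R (R v))))\<^sup>2 \<le> Re (N v (R v)) * Re (N (R v) (R (R v)))"
      by (rule Cauchy_Schwarz[OF psdR])
    also have "\<dots> \<le> Re (N v v) * ?x"
      by (intro mult_mono V v pos psd_nonneg[OF N])
    finally show ?thesis using x psd_nonneg[OF N, of v] by (rule square_le_mult_imp_le)
  qed
  have "(R ^^ M) v \<in> V \<and> Re (N ((R ^^ M) v) ((R ^^ M) v)) \<le> Re (N v v)"
    by (induction M) (auto simp: v intro: V order_trans[OF one])
  then show ?thesis by simp
qed

text \<open>Elimination of one index \<open>j\<close>: subtracting from each \<open>p k\<close> its
  component along \<open>p j\<close> clears row and column \<open>j\<close> of the Gram matrix of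
  \<open>G\<close>; what is removed has rank one and contributes \<open>g * H Y Y\<close>.\<close>

lemma Schur_product_nonneg:
  fixes G :: "'a::complex_vector \<Rightarrow> 'a \<Rightarrow> complex" and H :: "'b::complex_vector \<Rightarrow> 'b \<Rightarrow> complex"
  assumes G: "psd G" and H: "psd H" and "finite I"
  shows "0 \<le> Re (\<Sum>i\<in>I. \<Sum>k\<in>I. G (p i) (p k) * H (q i) (q k))"
  using \<open>finite I\<close>
proof (induction I arbitrary: p rule: finite_induct)
  case (insert j I)
  note hG = psd_hform[OF G] and hH = psd_hform[OF H]
  define g where "g = G (p j) (p j)"
  have g: "g = complex_of_real (Re g)" unfolding g_def by (rule hform_real[OF hG])
  \<comment> \<open>If \<open>g = 0\<close> the division gives \<open>t k = 0\<close>, which fits: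
    row \<open>j\<close> then vanishes by Cauchy-Schwarz.\<close>
  define t where "t k = G (p j) (p k) / g" for k
  define p' where "p' k = p k - t k *\<^sub>C p j" for k
  have zero: "G (p j) x = 0" "G x (p j) = 0" if "g = 0" for x
  proof -
    have "(cmod (G (p j) x))\<^sup>2 \<le> Re (G (p j) (p j)) * Re (G x x)"
      by (rule Cauchy_Schwarz[OF G])
    then show "G (p j) x = 0" using that by (simp add: g_def)
    then show "G x (p j) = 0" using hform_sym[OF hG, of x "p j"] by simp
  qed
  have split: "G (p i) (p k) = G (p' i) (p' k) + g * (cnj (t i) * t k)" for i k
  proof (cases "g = 0")
    case True
    then show ?thesis by (simp add: p'_def t_def)
  next
    case False
    have "G (p i) (p j) = cnj (t i) * g"
      using False g hform_sym[OF hG, of "p i" "p j"] unfolding t_def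
      by (metis complex_cnj_complex_of_real complex_cnj_divide nonzero_eq_divide_eq)
    moreover have "G (p j) (p k) = t k * g" using False by (simp add: t_def)
    moreover have "G (p j) (p j) = g" by (simp add: g_def)
    ultimately show ?thesis by (simp add: p'_def hform_simps[OF hG] algebra_simps)
  qed
  have p'j: "G (p' j) x = 0" "G x (p' j) = 0" for x
  proof -
    show "G (p' j) x = 0"
    proof (cases "g = 0")
      case True
      then show ?thesis using zero[OF True] by (simp add: p'_def t_def)
    next
      case False
      then have "t j = 1" by (simp add: t_def g_def)
      then show ?thesis by (simp add: p'_def scaleC_one hform_simps[OF hG])
    qed
    then show "G x (p' j) = 0" using hform_sym[OF hG, of x "p' j"] by simp
  qed
  define Y where "Y = (\<Sum>k\<in>insert j I. t k *\<^sub>C q k)"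
  have "(\<Sum>i\<in>insert j I. \<Sum>k\<in>insert j I. G (p i) (p k) * H (q i) (q k)) =
      (\<Sum>i\<in>insert j I. \<Sum>k\<in>insert j I. G (p' i) (p' k) * H (q i) (q k)) +
      (\<Sum>i\<in>insert j I. \<Sum>k\<in>insert j I. g * (cnj (t i) * t k) * H (q i) (q k))"
    unfolding split by (simp only: distrib_right sum.distrib)
  also have "(\<Sum>i\<in>insert j I. \<Sum>k\<in>insert j I. G (p' i) (p' k) * H (q i) (q k)) =
      (\<Sum>i\<in>I. \<Sum>k\<in>I. G (p' i) (p' k) * H (q i) (q k))"
    using insert.hyps by (simp add: p'j)
  also have "(\<Sum>i\<in>insert j I. \<Sum>k\<in>insert j I. g * (cnj (t i) * t k) * H (q i) (q k)) = g * H Y Y"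
    unfolding Y_def hform_sum_left[OF hH] hform_sum_right[OF hH] hform_scale_left[OF hH]
      hform_scale_right[OF hH] sum_distrib_left by (subst sum.swap) (simp only: ac_simps)
  finally have eq: "Re (\<Sum>i\<in>insert j I. \<Sum>k\<in>insert j I. G (p i) (p k) * H (q i) (q k)) =
      Re (\<Sum>i\<in>I. \<Sum>k\<in>I. G (p' i) (p' k) * H (q i) (q k)) + Re (g * H Y Y)" by simp
  have "Re (g * H Y Y) = Re g * Re (H Y Y)" using arg_cong[OF g, of Im] by simp
  moreover have "0 \<le> Re g" unfolding g_def by (rule psd_nonneg[OF G])
  ultimately have "0 \<le> Re (g * H Y Y)" using psd_nonneg[OF H, of Y] by (simp only: mult_nonneg_nonneg)
  then show ?case unfolding eq using insert.IH[of p'] by simp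
qed simp

section \<open>Complete positivity of the projection\<close>

context coideal
begin

lemma haar_proj: "haar (proj x) = haar x"
  using haar_proj_mult[OF A_one, of x] by simp

context
  assumes inv: "(S \<circ> S) ` A = A"
begin

text \<open>With \<open>R = 1 - s X\<close> the claim becomes \<open>N b (R b) \<le> N b b\<close>.
  On vectors with entries in \<open>A\<close>, two-sided linearity of \<open>proj\<close> and
  \<open>haar_proj\<close> turn \<open>Q v v\<close> into \<open>hinner y y\<close>, so the powers
  of \<open>R\<close> are contractive there. A general \<open>b\<close> is reached by expressing the
  powers of \<open>R\<close> at \<open>b\<close> through their columns at \<open>e k\<close>, whose
  entries lie in \<open>A\<close>, and bounding the moments independently of the exponent.\<close>

lemma matrix_positive:
  fixes p b :: "'i \<Rightarrow> 'h"
  assumes I: "finite I"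
  shows "0 \<le> Re (\<Sum>i\<in>I. \<Sum>k\<in>I. haar (star (b i) * proj (star (p i) * p k) * b k))"
proof -
  define X where "X i k = proj (star (p i) * p k)" for i k
  have X_A: "X i k \<in> A" for i k unfolding X_def by (rule proj_in)
  have X_star: "star (X i k) = X k i" for i k
    unfolding X_def by (simp add: star_mult star_star flip: proj_star[OF inv])
  define N where "N v w = (\<Sum>i\<in>I. hinner (v i) (w i))" for v w :: "'i \<Rightarrow> 'h"
  define Q where "Q v w = (\<Sum>i\<in>I. \<Sum>k\<in>I. haar (star (v i) * X i k * w k))" for v w :: "'i \<Rightarrow> 'h"
  have N: "psd N"
    unfolding psd_def hform_def
  proof (intro conjI allI)
    show "clinear (N v)" for v
      by (rule clinearI) (simp_all add: N_def scaleC_fun_def hform_simps[OF hform_hinner] sum.distrib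
          sum_distrib_left)
    show "N w v = cnj (N v w)" for v w
      unfolding N_def cnj_sum by (intro sum.cong refl hform_sym[OF hform_hinner])
    show "0 \<le> Re (N v v)" for v
      unfolding N_def Re_sum by (intro sum_nonneg psd_nonneg[OF psd_hinner])
  qed
  note hN = psd_hform[OF N]
  have Q: "hform Q"
    unfolding hform_def
  proof (intro conjI allI)
    show "clinear (Q v)" for v
      by (rule clinearI) (simp_all add: Q_def scaleC_fun_def distrib_left haar_simps sum.distrib
          scaleC_mult_right sum_distrib_left)
    show "Q w v = cnj (Q v w)" for v w
    proof -
      have "cnj (haar (star (v i) * X i k * w k)) = haar (star (w k) * X k i * v i)" for i k
        by (simp add: star_mult star_star X_star mult.assoc flip: haar_star)
      then show ?thesis unfolding Q_def cnj_sum by (subst sum.swap) simp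
    qed
  qed
  have "\<exists>K\<ge>0. \<forall>y. Re (hinner (X i k * y) (X i k * y)) \<le> K * Re (hinner y y)" for i k
    using bounded_element_pos_fun[OF bounded_all[of "X i k"]] pos_fun_haar unfolding hinner_def
    by blast
  then obtain \<kappa> where \<kappa>: "\<And>i k. \<kappa> i k \<ge> 0"
      "\<And>i k y. Re (hinner (X i k * y) (X i k * y)) \<le> \<kappa> i k * Re (hinner y y)"
    by metis
  have le_N: "Re (hinner (v i) (v i)) \<le> Re (N v v)" if "i \<in> I" for v i
    unfolding N_def Re_sum using that I psd_nonneg[OF psd_hinner] by (intro member_le_sum) auto
  define c where "c = (\<Sum>i\<in>I. \<Sum>k\<in>I. sqrt (\<kappa> i k))"
  have c: "c \<ge> 0" unfolding c_def using \<kappa>(1) by (intro sum_nonneg) simp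
  have Q_le: "Re (Q v v) \<le> c * Re (N v v)" for v
  proof -
    have "Re (haar (star (v i) * X i k * v k)) \<le> sqrt (\<kappa> i k) * Re (N v v)" if "i \<in> I" "k \<in> I" for i k
    proof -
      have "(cmod (hinner (v i) (X i k * v k)))\<^sup>2 \<le>
          Re (hinner (v i) (v i)) * Re (hinner (X i k * v k) (X i k * v k))"
        by (rule Cauchy_Schwarz[OF psd_hinner])
      also have "\<dots> \<le> Re (N v v) * (\<kappa> i k * Re (N v v))"
        using that \<kappa>(1)
        by (intro mult_mono le_N order_trans[OF \<kappa>(2)] psd_nonneg[OF psd_hinner] psd_nonneg[OF N] order_refl)
      also have "\<dots> = (sqrt (\<kappa> i k) * Re (N v v))\<^sup>2"
        using \<kappa>(1) by (simp add: power_mult_distrib power2_eq_square)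
      finally have "cmod (hinner (v i) (X i k * v k)) \<le> sqrt (\<kappa> i k) * Re (N v v)"
        by (rule power2_le_imp_le) (simp add: \<kappa>(1) psd_nonneg[OF N])
      then show ?thesis
        using complex_Re_le_cmod[of "hinner (v i) (X i k * v k)"] by (simp add: hinner_def mult.assoc)
    qed
    then show ?thesis
      unfolding Q_def c_def Re_sum sum_distrib_right by (intro sum_mono) simp
  qed
  \<comment> \<open>Small enough that \<open>s Q \<le> N\<close>, which makes \<open>R\<close>
    nonnegative; \<open>c + 1\<close> keeps the divisor positive.\<close>
  define s where "s = 1 / (c + 1)"
  have s: "s > 0" "s * c \<le> 1" using c by (simp_all add: s_def field_simps)
  define R where "R v = (\<lambda>i. if i \<in> I then v i - complex_of_real s *\<^sub>C (\<Sum>k\<in>I. X i k * v k) else 0)"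
    for v :: "'i \<Rightarrow> 'h"
  have R: "clinear R"
    by (rule clinearI) (auto simp: R_def fun_eq_iff scaleC_fun_def distrib_left sum.distrib
        scaleC_add_right scaleC_mult_right scaleC_scaleC cvec.scale_sum_right
        cvec.scale_right_diff_distrib mult.commute)
  have NR: "N v (R w) = N v w - complex_of_real s * Q v w" for v w
    unfolding N_def Q_def sum_distrib_left sum_subtractf[symmetric]
    by (intro sum.cong refl)
      (simp add: R_def hform_simps[OF hform_hinner] sum_distrib_left, simp add: hinner_def mult.assoc)
  have sym: "N (R v) w = N v (R w)" for v w
  proof -
    have "N (R v) w = cnj (N w (R v))" by (rule hform_sym[OF hN])
    also have "\<dots> = cnj (N w v) - complex_of_real s * cnj (Q w v)" by (simp add: NR)
    also have "\<dots> = N v w - complex_of_real s * Q v w"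
      using hform_sym[OF hN, of v w] hform_sym[OF Q, of v w] by simp
    finally show ?thesis by (simp add: NR)
  qed
  have ReNR: "Re (N v (R v)) = Re (N v v) - s * Re (Q v v)" for v by (simp add: NR)
  have pos: "0 \<le> Re (N v (R v))" for v
  proof -
    have "s * Re (Q v v) \<le> s * (c * Re (N v v))" using s Q_le by (intro mult_left_mono) auto
    also have "\<dots> \<le> Re (N v v)"
      using mult_right_mono[OF s(2) psd_nonneg[OF N, of v]] by (simp add: mult.assoc)
    finally show ?thesis by (simp add: ReNR)
  qed
  define V where "V = {v. \<forall>i. (v :: 'i \<Rightarrow> 'h) i \<in> A}"
  have V_R: "R v \<in> V" if "v \<in> V" for v
    using that X_A by (auto simp: V_def R_def intro!: A_intros)
  have V_le: "Re (N v (R v)) \<le> Re (N v v)" if "v \<in> V" for v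
  proof -
    define y where "y = (\<Sum>k\<in>I. p k * v k)"
    have "haar (star (v i) * X i k * v k) = haar (star (p i * v i) * (p k * v k))" for i k
    proof -
      have v: "v i \<in> A" "v k \<in> A" "star (v i) \<in> A" using that A_star by (auto simp: V_def)
      have "star (v i) * X i k * v k = proj (star (v i) * (star (p i) * p k) * v k)"
        unfolding X_def by (simp add: proj_mult[OF v(2)] proj_mult_left[OF inv v(3)])
      then show ?thesis by (simp add: haar_proj star_mult mult.assoc)
    qed
    then have "Q v v = hinner y y"
      by (simp add: Q_def hinner_def y_def star_sum sum_product haar_simps)
    then show ?thesis using s psd_nonneg[OF psd_hinner, of y] by (simp add: ReNR)
  qed
  define e where "e k = (\<lambda>i. if i = k then 1 else 0 :: 'h)" for k :: 'i
  have e: "e k \<in> V" for k by (auto simp: e_def V_def intro: A_intros)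
  have Ne: "Re (N (e k) (e k)) = 1" if "k \<in> I" for k
  proof -
    have "N (e k) (e k) = (\<Sum>i\<in>I. if i = k then 1 else 0)"
      unfolding N_def by (intro sum.cong refl) (simp add: e_def hinner_def star_one haar_one haar_simps)
    then show ?thesis using that I by simp
  qed
  have pow_V: "(R ^^ M) (e k) \<in> V" for M k by (induction M) (auto simp: e V_R)
  \<comment> \<open>A matrix over \<open>H\<close> acts by left multiplication, which commutes with
    multiplying by \<open>b k\<close> from the right.\<close>
  have pow: "((R ^^ M) b) i = (\<Sum>k\<in>I. ((R ^^ M) (e k)) i * b k)" if "i \<in> I" for M i
    using that
  proof (induction M arbitrary: i)
    case 0
    then have "(\<Sum>k\<in>I. e k i * b k) = (\<Sum>k\<in>I. if i = k then b k else 0)"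
      by (intro sum.cong) (simp_all add: e_def)
    then show ?case using 0 I by simp
  next
    case (Suc M)
    have "((R ^^ Suc M) b) i = ((R ^^ M) b) i - complex_of_real s *\<^sub>C (\<Sum>l\<in>I. X i l * ((R ^^ M) b) l)"
      using Suc.prems by (simp add: R_def)
    also have "\<dots> = (\<Sum>k\<in>I. ((R ^^ M) (e k)) i * b k) -
        complex_of_real s *\<^sub>C (\<Sum>l\<in>I. X i l * (\<Sum>k\<in>I. ((R ^^ M) (e k)) l * b k))"
      using Suc by simp
    also have "(\<Sum>l\<in>I. X i l * (\<Sum>k\<in>I. ((R ^^ M) (e k)) l * b k)) =
        (\<Sum>k\<in>I. (\<Sum>l\<in>I. X i l * ((R ^^ M) (e k)) l) * b k)"
      by (simp add: sum_distrib_left sum_distrib_right mult.assoc) (rule sum.swap)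
    also have "(\<Sum>k\<in>I. ((R ^^ M) (e k)) i * b k) -
        complex_of_real s *\<^sub>C (\<Sum>k\<in>I. (\<Sum>l\<in>I. X i l * ((R ^^ M) (e k)) l) * b k) =
        (\<Sum>k\<in>I. ((R ^^ Suc M) (e k)) i * b k)"
      unfolding cvec.scale_sum_right[of _ "\<lambda>k. (\<Sum>l\<in>I. X i l * ((R ^^ M) (e k)) l) * b k"]
        sum_subtractf[symmetric]
      using Suc.prems by (intro sum.cong refl) (simp add: R_def left_diff_distrib scaleC_mult_left)
    finally show ?case .
  qed
  \<comment> \<open>The modular relation brings \<open>b k\<close> to the left of \<open>t\<close>,
    so \<open>t\<close> is paired with a vector that depends on \<open>i\<close> and
    \<open>k\<close> but not on the exponent \<open>M\<close>.\<close>
  have "\<exists>w. \<forall>t. haar (star (b i) * t * b k) = hinner w t" for i k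
  proof -
    obtain c' where c': "\<And>z. haar (z * b k) = haar (c' * z)" using haar_modular' by blast
    show ?thesis
      by (intro exI[of _ "star (c' * star (b i))"]) (simp add: c' hinner_def star_star, simp add: mult.assoc)
  qed
  then obtain w where w: "\<And>i k t. haar (star (b i) * t * b k) = hinner (w i k) t" by metis
  define C where "C = (\<Sum>i\<in>I. \<Sum>k\<in>I. sqrt (Re (hinner (w i k) (w i k))))"
  have "cmod (N b ((R ^^ M) b)) \<le> C" for M
  proof -
    have "N b ((R ^^ M) b) = (\<Sum>i\<in>I. \<Sum>k\<in>I. hinner (w i k) (((R ^^ M) (e k)) i))"
      unfolding N_def w[symmetric]
      by (intro sum.cong refl) (simp add: pow hform_simps[OF hform_hinner], simp add: hinner_def mult.assoc)
    also have "cmod \<dots> \<le> C"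
      unfolding C_def
    proof (intro sum_norm_le)
      fix i k assume ik: "i \<in> I" "k \<in> I"
      let ?t = "((R ^^ M) (e k)) i"
      have "Re (hinner ?t ?t) \<le> Re (N ((R ^^ M) (e k)) ((R ^^ M) (e k)))" by (rule le_N[OF ik(1)])
      also have "\<dots> \<le> Re (N (e k) (e k))"
        by (rule contraction_on[where R = R and V = V, OF N R sym pos V_R V_le e])
      finally have t: "Re (hinner ?t ?t) \<le> 1" using Ne ik by simp
      have "(cmod (hinner (w i k) ?t))\<^sup>2 \<le> Re (hinner (w i k) (w i k)) * Re (hinner ?t ?t)"
        by (rule Cauchy_Schwarz[OF psd_hinner])
      also have "\<dots> \<le> Re (hinner (w i k) (w i k)) * 1"
        by (intro mult_left_mono t psd_nonneg[OF psd_hinner])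
      finally show "cmod (hinner (w i k) ?t) \<le> sqrt (Re (hinner (w i k) (w i k)))"
        by (simp add: real_le_rsqrt)
    qed
    finally show ?thesis .
  qed
  from moment_bound[where R = R, OF N sym this] have "0 \<le> s * Re (Q b b)" by (simp add: ReNR)
  then have "0 \<le> Re (Q b b)" using s by (simp add: zero_le_mult_iff)
  then show ?thesis by (simp add: Q_def X_def)
qed

text \<open>Since \<open>proj = ls psi\<close>, the projected entries are the scalars
  \<open>psi (star (u i c) * u k d)\<close> sandwiched between \<open>star u\<close> and
  \<open>u\<close>; multiplying by \<open>star (S u)\<close> and \<open>S u\<close> inverts the
  outer matrices and isolates one scalar.\<close>

lemma psi_coef:
  assumes u: "corep n u" and ij: "i < n" "j < n" and kl: "k < n" "l < n"
  shows "(\<Sum>a<n. \<Sum>b<n. star (S (u a j)) * proj (star (u i a) * u k b) * S (u b l)) =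
    psi (star (u i j) * u k l) *\<^sub>C 1"
proof -
  note us = corep_star[OF u]
  have proj_eq: "proj (star (u i a) * u k b) =
      (\<Sum>c<n. \<Sum>d<n. psi (star (u i c) * u k d) *\<^sub>C (star (u c a) * u d b))"
    if "a < n" "b < n" for a b
    unfolding proj_eq_ls ls_def comult_mult_coef[OF us ij(1) that(1) u kl(1) that(2)]
    by (simp add: lslice_simps clinear_psi)
  have star_sum1: "(\<Sum>a<n. star (S (u a j)) * star (u c a)) = (if c = j then 1 else 0)" if "c < n" for c
    using arg_cong[OF corep_antipode(2)[OF u that ij(2)], of star]
    by (simp add: star_sum star_mult star_one star_zero split: if_splits)
  have "(\<Sum>a<n. \<Sum>b<n. star (S (u a j)) * proj (star (u i a) * u k b) * S (u b l)) =
      (\<Sum>a<n. \<Sum>b<n. \<Sum>c<n. \<Sum>d<n. psi (star (u i c) * u k d) *\<^sub>C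
        (star (S (u a j)) * star (u c a) * (u d b * S (u b l))))"
    by (intro sum.cong refl)
      (simp add: proj_eq sum_distrib_left sum_distrib_right scaleC_mult_left scaleC_mult_right mult.assoc)
  also have "\<dots> = (\<Sum>a<n. \<Sum>c<n. \<Sum>d<n. \<Sum>b<n. psi (star (u i c) * u k d) *\<^sub>C
        (star (S (u a j)) * star (u c a) * (u d b * S (u b l))))"
    by (rule sum.cong[OF refl], rule trans[OF sum.swap], rule sum.cong[OF refl], rule sum.swap)
  also have "\<dots> = (\<Sum>a<n. \<Sum>c<n. \<Sum>d<n. psi (star (u i c) * u k d) *\<^sub>C
        (star (S (u a j)) * star (u c a) * (\<Sum>b<n. u d b * S (u b l))))"
    by (simp add: sum_distrib_left cvec.scale_sum_right)
  also have "\<dots> = (\<Sum>a<n. \<Sum>c<n. \<Sum>d<n. if d = l then psi (star (u i c) * u k d) *\<^sub>C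
        (star (S (u a j)) * star (u c a)) else 0)"
    by (intro sum.cong refl) (simp add: corep_antipode(2)[OF u _ kl(2)])
  also have "\<dots> = (\<Sum>c<n. psi (star (u i c) * u k l) *\<^sub>C (\<Sum>a<n. star (S (u a j)) * star (u c a)))"
    using kl by (subst sum.swap) (simp add: cvec.scale_sum_right)
  also have "\<dots> = (\<Sum>c<n. if c = j then psi (star (u i c) * u k l) *\<^sub>C 1 else 0)"
    by (intro sum.cong refl) (simp add: star_sum1)
  also have "\<dots> = psi (star (u i j) * u k l) *\<^sub>C 1" using ij by simp
  finally show ?thesis .
qed

lemma span_coefs_expand:
  assumes "x \<in> cvec.span (coefs n u)"
  shows "\<exists>c. x = (\<Sum>i<n. \<Sum>j<n. c i j *\<^sub>C u i j)"
  using assms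
proof (induction rule: cvec.span_induct_alt)
  case base
  show ?case by (intro exI[of _ "\<lambda>_ _. 0"]) simp
next
  case (step a y z)
  then obtain i j c where ij: "i < n" "j < n" "y = u i j" and c: "z = (\<Sum>i<n. \<Sum>j<n. c i j *\<^sub>C u i j)"
    by (auto simp: coefs_def)
  have inner: "(\<Sum>l<n. (if k = i then if l = j then a else 0 else 0) *\<^sub>C u k l) =
      (if k = i then a *\<^sub>C u k j else 0)" for k
  proof -
    have "(\<Sum>l<n. (if k = i then if l = j then a else 0 else 0) *\<^sub>C u k l) =
        (\<Sum>l<n. if l = j then (if k = i then a *\<^sub>C u k l else 0) else 0)"
      by (intro sum.cong) auto
    then show ?thesis using ij by simp
  qed
  have "(\<Sum>k<n. \<Sum>l<n. (if k = i then if l = j then a else 0 else 0) *\<^sub>C u k l) = a *\<^sub>C y"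
    unfolding inner using ij by simp
  then show ?case
    by (intro exI[of _ "\<lambda>k l. (if k = i then if l = j then a else 0 else 0) + c k l"])
      (simp add: c scaleC_add_left sum.distrib)
qed

lemma pos_fun_psi: "pos_fun psi"
  unfolding pos_fun_def
proof (intro conjI allI clinear_psi)
  fix x
  show "Im (psi (star x * x)) = 0"
    using psi_star[OF inv, of "star x * x"] by (simp add: star_mult star_star complex_eq_iff)
  obtain n u where u: "corep n u" and "x \<in> cvec.span (coefs n u)"
    using exists_corep[of "{x}"] by auto
  then obtain c where c: "x = (\<Sum>i<n. \<Sum>j<n. c i j *\<^sub>C u i j)" using span_coefs_expand by blast
  let ?J = "{..<n} \<times> {..<n}"
  define p where "p = (\<lambda>(i, a). u i a)"
  \<comment> \<open>Chosen so that \<open>psi_coef\<close> collapses the double sum over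
    \<open>?J\<close> to \<open>psi (star x * x)\<close> times \<open>1\<close>. The entries involve
    \<open>S\<close> and are not confined to \<open>A\<close>, which is why
    \<open>matrix_positive\<close> is stated for vectors over \<open>H\<close>.\<close>
  define b where "b = (\<lambda>(i, a). \<Sum>j<n. c i j *\<^sub>C S (u a j))"
  define T where "T i j k l a b = star (S (u a j)) * proj (star (u i a) * u k b) * S (u b l)"
    for i j k l a b
  have swap4: "(\<Sum>i<n. \<Sum>a<n. \<Sum>k<n. \<Sum>b<n. \<Sum>l<n. \<Sum>j<n. f i j k l a b) =
      (\<Sum>i<n. \<Sum>j<n. \<Sum>k<n. \<Sum>l<n. \<Sum>a<n. \<Sum>b<n. f i j k l a b)"
    for f :: "nat \<Rightarrow> nat \<Rightarrow> nat \<Rightarrow> nat \<Rightarrow> nat \<Rightarrow> nat \<Rightarrow> 'h"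
  proof (rule sum.cong[OF refl])
    fix i
    let ?N = "{..<n}"
    have "(\<Sum>(a, k, b, l, j)\<in>?N \<times> ?N \<times> ?N \<times> ?N \<times> ?N. f i j k l a b) =
        (\<Sum>(j, k, l, a, b)\<in>?N \<times> ?N \<times> ?N \<times> ?N \<times> ?N. f i j k l a b)"
      by (rule sum.reindex_bij_witness[of _ "\<lambda>(j, k, l, a, b). (a, k, b, l, j)"
            "\<lambda>(a, k, b, l, j). (j, k, l, a, b)"]) auto
    then show "(\<Sum>a<n. \<Sum>k<n. \<Sum>b<n. \<Sum>l<n. \<Sum>j<n. f i j k l a b) =
        (\<Sum>j<n. \<Sum>k<n. \<Sum>l<n. \<Sum>a<n. \<Sum>b<n. f i j k l a b)"
      by (simp add: sum.cartesian_product')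
  qed
  have "(\<Sum>y\<in>?J. \<Sum>z\<in>?J. star (b y) * proj (star (p y) * p z) * b z) =
      (\<Sum>i<n. \<Sum>a<n. \<Sum>k<n. \<Sum>b<n. \<Sum>l<n. \<Sum>j<n. (cnj (c i j) * c k l) *\<^sub>C T i j k l a b)"
    by (simp add: sum.cartesian_product' b_def p_def T_def star_sum star_scaleC sum_distrib_left
        sum_distrib_right scaleC_mult_left scaleC_mult_right scaleC_scaleC mult.commute
        cvec.scale_sum_right)
  also have "\<dots> = (\<Sum>i<n. \<Sum>j<n. \<Sum>k<n. \<Sum>l<n. (cnj (c i j) * c k l) *\<^sub>C (\<Sum>a<n. \<Sum>b<n. T i j k l a b))"
    unfolding cvec.scale_sum_right by (rule swap4)
  also have "\<dots> = (\<Sum>i<n. \<Sum>j<n. \<Sum>k<n. \<Sum>l<n. (cnj (c i j) * c k l * psi (star (u i j) * u k l)) *\<^sub>C 1)"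
    unfolding T_def by (intro sum.cong refl) (simp add: psi_coef[OF u] scaleC_scaleC)
  also have "\<dots> = psi (star x * x) *\<^sub>C 1"
  proof -
    have sx: "star x = (\<Sum>i<n. \<Sum>j<n. cnj (c i j) *\<^sub>C star (u i j))"
      unfolding c by (simp add: star_sum star_scaleC)
    have "psi (star x * x) = (\<Sum>i<n. \<Sum>j<n. cnj (c i j) * psi (star (u i j) * x))"
      by (simp only: sx sum_distrib_right scaleC_mult_left clin[OF clinear_psi] scaleC_complex)
    moreover have "psi (y * x) = (\<Sum>k<n. \<Sum>l<n. c k l * psi (y * u k l))" for y
      unfolding c by (simp only: sum_distrib_left scaleC_mult_right clin[OF clinear_psi] scaleC_complex)
    ultimately have "psi (star x * x) =
        (\<Sum>i<n. \<Sum>j<n. \<Sum>k<n. \<Sum>l<n. cnj (c i j) * c k l * psi (star (u i j) * u k l))"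
      by (simp only: sum_distrib_left mult.assoc)
    then show ?thesis by (simp add: cvec.scale_sum_left)
  qed
  finally have "haar (\<Sum>y\<in>?J. \<Sum>z\<in>?J. star (b y) * proj (star (p y) * p z) * b z) = psi (star x * x)"
    by (simp add: haar_simps haar_one)
  then show "0 \<le> Re (psi (star x * x))"
    using matrix_positive[of ?J b p] by (simp add: haar_simps)
qed

text \<open>With \<Delta> y written as a finite sum, the value is the sum of the entries of the
  Schur product of two positive matrices, one from \<open>psi\<close> and one from
  \<open>w\<close>.\<close>

lemma pos_fun_proj:
  assumes w: "pos_fun w"
  shows "0 \<le> Re (w (star c * proj (star y * y) * c))"
proof -
  obtain F where F: "finite F" "(\<Sum>b\<in>F. rs (coord b) y \<otimes> b) = \<Delta> y"
    using tensor_expand[of "\<Delta> y"] unfolding rs_def by blast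
  define p where "p b = rs (coord b) y" for b
  have "\<Delta> (star y * y) = (\<Sum>b\<in>F. \<Sum>d\<in>F. (star (p b) * p d) \<otimes> (star b * d))"
    unfolding comult_mult comult_star F(2)[symmetric] p_def[symmetric] star_sum star_pure tensor_mult_sum ..
  then have "proj (star y * y) = (\<Sum>b\<in>F. \<Sum>d\<in>F. psi (star (p b) * p d) *\<^sub>C (star b * d))"
    unfolding proj_eq_ls ls_def by (simp add: lslice_simps clinear_psi)
  then have "w (star c * proj (star y * y) * c) =
      (\<Sum>b\<in>F. \<Sum>d\<in>F. psi (star (p b) * p d) * w (star (b * c) * (d * c)))"
    by (simp add: sum_distrib_left sum_distrib_right scaleC_mult_left scaleC_mult_right
        clin[OF pos_fun_lin[OF w]] star_mult mult.assoc)
  then show ?thesis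
    using Schur_product_nonneg[OF pos_fun_psd[OF pos_fun_psi] pos_fun_psd[OF w] F(1), of p "\<lambda>b. b * c"]
    by simp
qed

text \<open>Under each positive \<open>w\<close> the element \<open>z y\<close> lies between
  \<open>0\<close> and \<open>K\<close>, so the form \<open>G\<close> of
  \<open>r = 1 - z y / K\<close> lies between \<open>0\<close> and that of \<open>1\<close>.
  Cauchy-Schwarz for \<open>G\<close> then bounds \<open>w (star r * r)\<close> by
  \<open>w 1\<close>. One \<open>K\<close> serves all \<open>w\<close>.\<close>

lemma proj_contraction:
  defines "z \<equiv> \<lambda>y. proj (star y * y)"
  shows "\<exists>K>0. \<forall>w. pos_fun w \<longrightarrow>
    Re (w (star (1 - complex_of_real (1 / K) *\<^sub>C z y) * (1 - complex_of_real (1 / K) *\<^sub>C z y))) \<le> Re (w 1)"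
proof -
  have z_star: "star (z y) = z y"
    unfolding z_def by (simp add: star_mult star_star flip: proj_star[OF inv])
  obtain K0 where K0: "K0 \<ge> 0"
    "\<And>w b. pos_fun w \<Longrightarrow> Re (w (star (z y * b) * (z y * b))) \<le> K0 * Re (w (star b * b))"
    using bounded_element_pos_fun[OF bounded_all[of "z y"]] by blast
  \<comment> \<open>\<open>sqrt K0\<close> bounds \<open>z y\<close> under every positive
    functional; adding \<open>1\<close> keeps the divisor positive.\<close>
  define K where "K = sqrt K0 + 1"
  have K: "K > 0" unfolding K_def using K0 by (simp add: add_nonneg_pos)
  define r where "r = 1 - complex_of_real (1 / K) *\<^sub>C z y"
  have r_star: "star r = r"
    unfolding r_def by (simp add: star_diff star_one star_scaleC z_star)
  have "Re (w (star r * r)) \<le> Re (w 1)" if w: "pos_fun w" for w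
  proof -
    note lin = clin[OF pos_fun_lin[OF w]]
    note psdw = pos_fun_psd[OF w]
    define G where "G x x' = w (star x * r * x')" for x x'
    have bound: "0 \<le> Re (w (star x * z y * x))" "Re (w (star x * z y * x)) \<le> K * Re (w (star x * x))" for x
    proof -
      show "0 \<le> Re (w (star x * z y * x))" unfolding z_def by (rule pos_fun_proj[OF w])
      have p: "0 \<le> Re (w (star x * x))" by (rule psd_nonneg[OF psdw])
      have "(cmod (w (star x * (z y * x))))\<^sup>2 \<le> Re (w (star x * x)) * Re (w (star (z y * x) * (z y * x)))"
        by (rule Cauchy_Schwarz[OF psdw])
      also have "\<dots> \<le> Re (w (star x * x)) * (K0 * Re (w (star x * x)))"
        by (intro mult_left_mono K0(2)[OF w] p)
      also have "\<dots> = (sqrt K0 * Re (w (star x * x)))\<^sup>2"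
        using K0(1) by (simp add: power_mult_distrib power2_eq_square)
      finally have "cmod (w (star x * (z y * x))) \<le> sqrt K0 * Re (w (star x * x))"
        by (rule power2_le_imp_le) (simp add: K0(1) p)
      moreover have "sqrt K0 * Re (w (star x * x)) \<le> K * Re (w (star x * x))"
        using p by (intro mult_right_mono) (simp_all add: K_def)
      ultimately show "Re (w (star x * z y * x)) \<le> K * Re (w (star x * x))"
        using complex_Re_le_cmod[of "w (star x * (z y * x))"] by (simp add: mult.assoc)
    qed
    have ReG: "Re (G x x) = Re (w (star x * x)) - Re (w (star x * z y * x)) / K" for x
      by (simp add: G_def r_def left_diff_distrib right_diff_distrib scaleC_mult_left scaleC_mult_right lin)
    have G: "psd G"
      unfolding psd_def hform_def
    proof (intro conjI allI)
      show "clinear (G x)" for x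
        unfolding G_def by (rule clinear_compose[OF pos_fun_lin[OF w] clinear_mult_left])
      show "G x' x = cnj (G x x')" for x x'
        unfolding G_def by (simp add: star_mult star_star r_star mult.assoc flip: pos_fun_star[OF w])
      show "0 \<le> Re (G x x)" for x
        unfolding ReG using bound(2)[of x] K by (simp add: field_simps)
    qed
    have G_le: "Re (G x x) \<le> Re (w (star x * x))" for x
      unfolding ReG using bound(1)[of x] K by simp
    let ?x = "Re (w (star r * r))"
    have x: "?x \<ge> 0" by (rule psd_nonneg[OF psdw])
    have "?x\<^sup>2 \<le> (cmod (G 1 r))\<^sup>2"
      using x complex_Re_le_cmod[of "w (star r * r)"] by (intro power_mono) (simp_all add: G_def star_one r_star)
    also have "\<dots> \<le> Re (G 1 1) * Re (G r r)" by (rule Cauchy_Schwarz[OF G])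
    also have "\<dots> \<le> Re (w 1) * ?x"
      using G_le[of 1] G_le[of r] psd_nonneg[OF G] psd_nonneg[OF psdw, of 1]
      by (intro mult_mono) (simp_all add: star_one)
    finally show ?thesis
      by (rule square_le_mult_imp_le) (use x psd_nonneg[OF psdw, of 1] in \<open>simp_all add: star_one\<close>)
  qed
  then show ?thesis using K unfolding r_def by blast
qed

end

end

section \<open>Square roots in \<open>C\<^sup>*\<close>-algebras\<close>

instance cstar_algebra \<subseteq> banach ..

lemma norm_star: "norm (star x) = norm (x :: 'a::cstar_algebra)"
proof -
  have *: "norm x \<le> norm (star x)" for x :: 'a
  proof (cases "x = 0")
    case False
    have "norm x * norm x \<le> norm (star x) * norm x"
      using norm_mult_ineq[of "star x" x] by (simp add: cstar_identity power2_eq_square)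
    then show ?thesis using False by simp
  qed simp
  show ?thesis using *[of x] *[of "star x"] by (simp add: star_star)
qed

lemma tendsto_star:
  fixes f :: "'b \<Rightarrow> 'a::cstar_algebra"
  assumes "(f \<longlongrightarrow> a) F"
  shows "((\<lambda>x. star (f x)) \<longlongrightarrow> star a) F"
proof -
  have "dist (star x) (star y) = dist x y" for x y :: 'a
    by (simp add: dist_norm norm_star flip: star_diff)
  then show ?thesis using assms by (simp add: tendsto_iff)
qed

text \<open>The coefficients of the power series of \<open>sqrt (1 - t)\<close>, which converges absolutely
  for \<open>\<bar>t\<bar> \<le> 1\<close>.\<close>

definition sqrt_coef :: "nat \<Rightarrow> real" where "sqrt_coef n = pochhammer (- 1 / 2) n / fact n"

text \<open>These are the coefficients of \<open>sqrt (1 - t) / (1 - t) = 1 / sqrt (1 - t)\<close>.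
  Their positivity controls the series of \<open>sqrt (1 - t)\<close> at the end point
  \<open>t = 1\<close>.\<close>

lemma sum_sqrt_coef: "(\<Sum>k\<le>m. sqrt_coef k) = pochhammer (1 / 2) m / fact m"
proof (induction m)
  case 0
  show ?case by (simp add: sqrt_coef_def)
next
  case (Suc m)
  let ?P = "pochhammer (1 / 2 :: real) m"
  have "sqrt_coef (Suc m) = - 1 / 2 * ?P / ((1 + real m) * fact m)"
    unfolding sqrt_coef_def pochhammer_rec by simp
  then have "(\<Sum>k\<le>Suc m. sqrt_coef k) = ?P / fact m + - 1 / 2 * ?P / ((1 + real m) * fact m)"
    by (simp only: sum.atMost_Suc Suc)
  also have "\<dots> = (?P * (1 + real m) + - 1 / 2 * ?P) / ((1 + real m) * fact m)"
    unfolding add_divide_distrib by simp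
  also have "?P * (1 + real m) + - 1 / 2 * ?P = ?P * (1 / 2 + real m)"
    by (simp add: algebra_simps)
  also have "?P * (1 / 2 + real m) / ((1 + real m) * fact m) = pochhammer (1 / 2) (Suc m) / fact (Suc m)"
    unfolding pochhammer_Suc by simp
  finally show ?case .
qed

lemma sqrt_coef_0: "sqrt_coef 0 = 1" and sqrt_coef_Suc: "sqrt_coef (Suc n) \<le> 0"
proof -
  show "sqrt_coef 0 = 1" by (simp add: sqrt_coef_def)
  have "pochhammer (- 1 / 2 :: real) (Suc n) = - 1 / 2 * pochhammer (1 / 2) n"
    by (simp add: pochhammer_rec)
  moreover have "0 < pochhammer (1 / 2 :: real) n" by (rule pochhammer_pos) simp
  ultimately show "sqrt_coef (Suc n) \<le> 0"
    unfolding sqrt_coef_def by (simp add: divide_nonpos_pos)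
qed

lemma summable_abs_sqrt_coef: "summable (\<lambda>n. \<bar>sqrt_coef n\<bar>)"
proof (rule summableI_nonneg_bounded[where x = 2])
  fix n
  \<comment> \<open>Only the zeroth coefficient is positive, so taking absolute values flips every
    sign but that one.\<close>
  have abs: "\<bar>sqrt_coef k\<bar> = (if k = 0 then 2 else 0) - sqrt_coef k" for k
    using sqrt_coef_Suc[of "k - 1"] by (cases k) (simp_all add: sqrt_coef_0)
  have "(\<Sum>k<n. \<bar>sqrt_coef k\<bar>) \<le> (\<Sum>k\<le>n. \<bar>sqrt_coef k\<bar>)" by (intro sum_mono2) auto
  also have "\<dots> = 2 - pochhammer (1 / 2) n / fact n"
    unfolding abs sum_subtractf sum_sqrt_coef by simp
  also have "\<dots> \<le> 2" using pochhammer_pos[of "1 / 2 :: real" n] by simp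
  finally show "(\<Sum>k<n. \<bar>sqrt_coef k\<bar>) \<le> 2" .
qed simp

text \<open>The Vandermonde identity for rising factorials, with both parameters
  \<open>- 1 / 2\<close>; the rising factorial of \<open>- 1\<close> vanishes from order two
  on.\<close>

lemma sqrt_coef_convolution:
  "(\<Sum>k\<le>n. sqrt_coef k * sqrt_coef (n - k)) = (if n = 0 then 1 else if n = 1 then - 1 else 0)"
proof -
  have "(\<Sum>k\<le>n. sqrt_coef k * sqrt_coef (n - k)) =
      (\<Sum>k\<le>n. of_nat (n choose k) * pochhammer (- 1 / 2) k * pochhammer (- 1 / 2) (n - k)) / fact n"
    unfolding sum_divide_distrib
    by (intro sum.cong refl) (simp add: sqrt_coef_def binomial_fact field_simps)
  also have "\<dots> = pochhammer (- 1) n / fact n"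
    using pochhammer_binomial_sum[of "- 1 / 2 :: real" "- 1 / 2" n] by simp
  also have "\<dots> = (if n = 0 then 1 else if n = 1 then - 1 else 0)"
  proof (cases "n \<le> 1")
    case True
    then show ?thesis by (cases n) auto
  next
    case False
    then have "pochhammer (- 1 :: real) n = 0"
      using pochhammer_of_nat_eq_0_iff[of 1 n, where 'a = real] by simp
    then show ?thesis using False by simp
  qed
  finally show ?thesis .
qed

text \<open>Convergence of the partial sums is part of the conclusion because it places
  \<open>b\<close> in every closed subspace that contains the powers of \<open>x\<close>.\<close>

lemma exists_sqrt:
  fixes x :: "'a::cstar_algebra"
  assumes norm: "norm x \<le> 1" and star: "star x = x"
  shows "\<exists>b. star b = b \<and> b * b = 1 - x \<and> (\<lambda>n. \<Sum>k<n. sqrt_coef k *\<^sub>R x ^ k) \<longlonglongrightarrow> b"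
proof -
  let ?f = "\<lambda>k. sqrt_coef k *\<^sub>R x ^ k"
  have norm_le: "norm (?f k) \<le> \<bar>sqrt_coef k\<bar>" for k
  proof -
    have "norm (x ^ k) \<le> 1"
      using norm_power_ineq[of x k] power_le_one[OF norm_ge_zero norm, of k] by linarith
    then show ?thesis by (simp add: mult_left_le)
  qed
  have abs: "summable (\<lambda>k. norm (?f k))"
    by (rule summable_comparison_test[OF _ summable_abs_sqrt_coef]) (use norm_le in auto)
  define b where "b = suminf ?f"
  have lim: "(\<lambda>n. \<Sum>k<n. ?f k) \<longlonglongrightarrow> b"
    unfolding b_def by (rule summable_LIMSEQ[OF summable_norm_cancel[OF abs]])
  have star_pow: "star (x ^ k) = x ^ k" for k
    by (induction k) (simp_all add: star_one star_mult star power_commutes)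
  have "star (\<Sum>k<n. ?f k) = (\<Sum>k<n. ?f k)" for n
    by (simp add: star_sum scaleR_scaleC star_scaleC star_pow)
  with tendsto_star[OF lim] have "(\<lambda>n. \<Sum>k<n. ?f k) \<longlonglongrightarrow> star b" by simp
  then have "star b = b" using lim by (rule LIMSEQ_unique)
  moreover have "b * b = 1 - x"
  proof -
    have "(\<Sum>i\<le>k. ?f i * ?f (k - i)) = (\<Sum>i\<le>k. sqrt_coef i * sqrt_coef (k - i)) *\<^sub>R x ^ k" for k
      unfolding scaleR_left.sum by (intro sum.cong refl) (simp flip: power_add)
    then have eq: "(\<Sum>i\<le>k. ?f i * ?f (k - i)) = (if k = 0 then 1 else if k = 1 then - x else 0)" for k
      by (simp add: sqrt_coef_convolution)
    have "(\<lambda>k. \<Sum>i\<le>k. ?f i * ?f (k - i)) sums (b * b)"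
      unfolding b_def by (rule Cauchy_product_sums[OF abs abs])
    moreover have "(\<lambda>k. if k = 0 then 1 else if k = 1 then - x else 0) sums
        (\<Sum>k\<in>{0, 1 :: nat}. if k = 0 then 1 else if k = 1 then - x else 0)"
      by (rule sums_finite) auto
    ultimately show ?thesis unfolding eq using sums_unique2 by fastforce
  qed
  ultimately show ?thesis using lim by blast
qed

section \<open>Representations and the universal norm\<close>

lemma l2_summable: "f \<in> l2 B \<Longrightarrow> (\<lambda>i. (cmod (f i))\<^sup>2) summable_on UNIV"
  by (simp add: l2_def)

lemma l2_product_summable:
  assumes "f \<in> l2 B" "g \<in> l2 B"
  shows "(\<lambda>i. cnj (f i) * g i) summable_on UNIV"
proof (rule abs_summable_summable, rule summable_on_comparison_test)
  show "(\<lambda>i. (cmod (f i))\<^sup>2 + (cmod (g i))\<^sup>2) summable_on UNIV"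
    using assms by (intro summable_on_add l2_summable)
  show "norm (cnj (f i) * g i) \<le> (cmod (f i))\<^sup>2 + (cmod (g i))\<^sup>2" for i
  proof -
    have "2 * (cmod (f i) * cmod (g i)) \<le> (cmod (f i))\<^sup>2 + (cmod (g i))\<^sup>2"
      using sum_squares_bound[of "cmod (f i)" "cmod (g i)"] by simp
    moreover have "0 \<le> cmod (f i) * cmod (g i)" by simp
    ultimately show ?thesis unfolding norm_mult complex_mod_cnj by linarith
  qed
qed simp

lemma zero_l2: "0 \<in> l2 B"
  by (simp add: l2_def)

lemma l2_norm_zero: "l2_norm 0 = 0"
  by (simp add: l2_norm_def)

lemma l2_norm_nonneg: "0 \<le> l2_norm f"
  by (simp add: l2_norm_def infsum_nonneg)

lemma scale_l2:
  assumes "f \<in> l2 B"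
  shows "c *\<^sub>C f \<in> l2 B" and "l2_norm (c *\<^sub>C f) = cmod c * l2_norm f"
proof -
  have e: "(\<lambda>i. (cmod ((c *\<^sub>C f) i))\<^sup>2) = (\<lambda>i. (cmod c)\<^sup>2 * (cmod (f i))\<^sup>2)"
    by (simp add: scaleC_fun_def norm_mult power_mult_distrib)
  show "c *\<^sub>C f \<in> l2 B"
    using assms summable_on_cmult_right[OF l2_summable[OF assms], of "(cmod c)\<^sup>2"]
    by (simp add: l2_def e) (simp add: scaleC_fun_def)
  show "l2_norm (c *\<^sub>C f) = cmod c * l2_norm f"
    by (simp add: l2_norm_def e infsum_cmult_right' real_sqrt_mult)
qed

lemma l2_inner_self:
  assumes "f \<in> l2 B"
  shows "l2_inner f f = complex_of_real ((l2_norm f)\<^sup>2)"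
proof -
  have s: "(\<lambda>i. complex_of_real ((cmod (f i))\<^sup>2)) summable_on UNIV"
    using l2_product_summable[OF assms assms]
    by (simp add: complex_norm_square mult.commute del: of_real_power)
  have "l2_inner f f = infsum (\<lambda>i. complex_of_real ((cmod (f i))\<^sup>2)) UNIV"
    by (simp add: l2_inner_def complex_norm_square mult.commute del: of_real_power)
  also have "\<dots> = complex_of_real (infsum (\<lambda>i. (cmod (f i))\<^sup>2) UNIV)"
  proof (rule complex_eqI)
    show "Re (infsum (\<lambda>i. complex_of_real ((cmod (f i))\<^sup>2)) UNIV) =
        Re (complex_of_real (infsum (\<lambda>i. (cmod (f i))\<^sup>2) UNIV))"
      using infsum_Re[OF s] by simp
    show "Im (infsum (\<lambda>i. complex_of_real ((cmod (f i))\<^sup>2)) UNIV) =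
        Im (complex_of_real (infsum (\<lambda>i. (cmod (f i))\<^sup>2) UNIV))"
      using infsum_Im[OF s] by simp
  qed
  also have "\<dots> = complex_of_real ((l2_norm f)\<^sup>2)"
    by (simp add: l2_norm_def infsum_nonneg)
  finally show ?thesis .
qed

lemma star_rep_in: "star_rep B \<rho> \<Longrightarrow> f \<in> l2 B \<Longrightarrow> \<rho> x f \<in> l2 B"
  unfolding star_rep_def bounded_operator_def by blast

lemma star_rep_pos_fun:
  fixes \<rho> :: "'h::star_algebra \<Rightarrow> ('i \<Rightarrow> complex) \<Rightarrow> 'i \<Rightarrow> complex"
  assumes \<rho>: "star_rep B \<rho>" and f: "f \<in> l2 B"
  defines "w \<equiv> \<lambda>x. l2_inner f (\<rho> x f)"
  shows "pos_fun w" and "w (star x * x) = complex_of_real ((l2_norm (\<rho> x f))\<^sup>2)"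
    and "w 1 = complex_of_real ((l2_norm f)\<^sup>2)"
proof -
  note inb = star_rep_in[OF \<rho> f]
  have r: "\<rho> 1 f = f" "\<rho> (x + y) f = \<rho> x f + \<rho> y f" "\<rho> (c *\<^sub>C x) f = c *\<^sub>C \<rho> x f"
    "\<rho> (x * y) f = \<rho> x (\<rho> y f)" for x y c
    using \<rho> f unfolding star_rep_def by blast+
  have adj: "l2_inner (\<rho> (star x) f) g = l2_inner f (\<rho> x g)" if "g \<in> l2 B" for x g
    using \<rho> f that unfolding star_rep_def by blast
  have lin: "clinear w"
  proof (rule clinearI)
    show "w (x + y) = w x + w y" for x y
      unfolding w_def r l2_inner_def
      by (simp add: distrib_left infsum_add l2_product_summable[OF f inb])
    show "w (c *\<^sub>C x) = c *\<^sub>C w x" for c x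
      unfolding w_def r l2_inner_def
      by (simp add: scaleC_fun_def mult.left_commute infsum_cmult_right')
  qed
  show sq: "w (star x * x) = complex_of_real ((l2_norm (\<rho> x f))\<^sup>2)" for x
  proof -
    have "w (star x * x) = l2_inner (\<rho> (star (star x)) f) (\<rho> x f)"
      unfolding w_def r by (rule adj[OF inb, symmetric])
    then show ?thesis by (simp add: star_star l2_inner_self[OF inb])
  qed
  show "pos_fun w" unfolding pos_fun_def sq by (simp add: lin)
  show "w 1 = complex_of_real ((l2_norm f)\<^sup>2)" unfolding w_def r by (rule l2_inner_self[OF f])
qed

lemma operator_norm_le:
  assumes "star_rep B \<rho>" "0 \<le> c" "\<And>w. pos_fun w \<Longrightarrow> Re (w (star x * x)) \<le> c\<^sup>2 * Re (w 1)"
  shows "operator_norm B (\<rho> x) \<le> c" and "f \<in> l2 B \<Longrightarrow> l2_norm f \<le> 1 \<Longrightarrow> l2_norm (\<rho> x f) \<le> c"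
proof -
  show *: "l2_norm (\<rho> x f) \<le> c" if f: "f \<in> l2 B" "l2_norm f \<le> 1" for f
  proof -
    note w = star_rep_pos_fun[OF assms(1) f(1)]
    have "(l2_norm (\<rho> x f))\<^sup>2 \<le> c\<^sup>2 * (l2_norm f)\<^sup>2"
      using assms(3)[OF w(1)] w(2)[of x] w(3) by simp
    also have "\<dots> \<le> c\<^sup>2 * 1"
      using f(2) l2_norm_nonneg[of f] by (intro mult_left_mono) (simp_all add: power_le_one)
    finally have "(l2_norm (\<rho> x f))\<^sup>2 \<le> c\<^sup>2" by simp
    then show ?thesis by (rule power2_le_imp_le) (rule assms(2))
  qed
  have "0 \<in> {f \<in> l2 B. l2_norm f \<le> 1}" by (simp add: zero_l2 l2_norm_zero)
  then show "operator_norm B (\<rho> x) \<le> c"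
    unfolding operator_norm_def using * by (intro cSUP_least) auto
qed

lemma universal_norm_le:
  fixes x :: "'h::star_algebra"
  assumes "0 \<le> c" "\<And>w. pos_fun w \<Longrightarrow> Re (w (star x * x)) \<le> c\<^sup>2 * Re (w 1)"
  shows "universal_norm x \<le> c"
  unfolding universal_norm_def
proof (rule cSup_least)
  \<comment> \<open>A bound on \<open>Sup\<close> needs a nonempty set; the representation on the
    zero space provides a member.\<close>
  have l2e: "l2 {} = {0 :: 'h \<Rightarrow> complex}"
    by (auto simp: l2_def fun_eq_iff)
  have "star_rep ({} :: 'h set) (\<lambda>(x :: 'h) f. 0)"
    by (auto simp: star_rep_def bounded_operator_def l2e l2_norm_zero)
  then show "{operator_norm B (\<rho> x) | (B :: 'h set) \<rho>. star_rep B \<rho>} \<noteq> {}" by blast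
qed (use operator_norm_le(1)[OF _ assms] in blast)

context hopf
begin

lemma counit_star_rep: "star_rep {1 :: 'h} (\<lambda>x f. \<epsilon> x *\<^sub>C f)"
proof -
  have "bounded_operator {1 :: 'h} (\<lambda>f. \<epsilon> x *\<^sub>C f)" for x
    unfolding bounded_operator_def
  proof (intro conjI)
    show "\<exists>K. \<forall>f\<in>l2 {1 :: 'h}. l2_norm (\<epsilon> x *\<^sub>C f) \<le> K * l2_norm f"
      by (intro exI[of _ "cmod (\<epsilon> x)"]) (simp add: scale_l2(2))
  qed (auto simp: scale_l2(1) scaleC_add_right scaleC_scaleC mult.commute)
  moreover have "l2_inner (\<epsilon> (star x) *\<^sub>C f) g = l2_inner f (\<epsilon> x *\<^sub>C g)" for x and f g :: "'h \<Rightarrow> complex"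
    by (simp add: l2_inner_def scaleC_fun_def counit_star mult.assoc mult.left_commute)
  ultimately show ?thesis
    by (simp add: star_rep_def counit_one counit_mult scaleC_one scaleC_scaleC
        clin[OF clinear_counit] scaleC_add_left)
qed

end

context cqg
begin

text \<open>\<epsilon> is itself one of the representations in the supremum. The boundedness
  certificate of \<open>x\<close> makes both suprema bounded above, without which they could not be
  compared with their members.\<close>

lemma counit_le_universal_norm: "cmod (\<epsilon> x) \<le> universal_norm x"
proof -
  obtain K where K: "K \<ge> 0"
    "\<And>w b. pos_fun w \<Longrightarrow> Re (w (star (x * b) * (x * b))) \<le> K * Re (w (star b * b))"
    using bounded_element_pos_fun[OF bounded_all[of x]] by blast
  have b: "Re (w (star x * x)) \<le> (sqrt K)\<^sup>2 * Re (w 1)" if "pos_fun w" for w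
    using K(2)[OF that, of 1] K(1) by (simp add: star_one)
  have s: "0 \<le> sqrt K" using K(1) by simp
  define f :: "'h \<Rightarrow> complex" where "f = (\<lambda>i. if i = 1 then 1 else 0)"
  have n: "(\<lambda>i. (cmod (f i))\<^sup>2) = (\<lambda>i. if i = 1 then 1 else 0)" by (auto simp: f_def)
  have "(\<lambda>i. if i = 1 then 1 else 0 :: real) summable_on (UNIV :: 'h set)"
    using summable_on_cong_neutral[of UNIV "{1 :: 'h}" "\<lambda>i. if i = 1 then 1 else 0 :: real"
        "\<lambda>i. if i = 1 then 1 else 0"] by auto
  then have f: "f \<in> l2 {1}" unfolding l2_def mem_Collect_eq n by (simp add: f_def)
  have "infsum (\<lambda>i :: 'h. if i = 1 then 1 else 0 :: real) UNIV =
      infsum (\<lambda>i. if i = 1 then 1 else 0) {1 :: 'h}"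
    by (rule infsum_cong_neutral) auto
  then have f1: "l2_norm f = 1" unfolding l2_norm_def n by simp
  let ?\<rho> = "\<lambda>x f. \<epsilon> x *\<^sub>C f :: 'h \<Rightarrow> complex"
  have "cmod (\<epsilon> x) = l2_norm (?\<rho> x f)" by (simp add: scale_l2(2)[OF f] f1)
  also have "\<dots> \<le> operator_norm {1} (?\<rho> x)"
    unfolding operator_norm_def
  proof (rule cSUP_upper)
    show "bdd_above ((\<lambda>f. l2_norm (\<epsilon> x *\<^sub>C f)) ` {f \<in> l2 {1 :: 'h}. l2_norm f \<le> 1})"
      using operator_norm_le(2)[OF counit_star_rep s b] by (intro bdd_aboveI2[where M = "sqrt K"]) auto
  qed (use f f1 in simp)
  also have "\<dots> \<le> universal_norm x"
    unfolding universal_norm_def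
  proof (rule cSup_upper)
    show "operator_norm {1} (?\<rho> x) \<in> {operator_norm B (\<rho> x) | (B :: 'h set) \<rho>. star_rep B \<rho>}"
      by (rule CollectI, intro exI[of _ "{1}"] exI[of _ ?\<rho>] conjI refl counit_star_rep)
    show "bdd_above {operator_norm B (\<rho> x) | (B :: 'h set) \<rho>. star_rep B \<rho>}"
      using operator_norm_le(1)[OF _ s b] by (intro bdd_aboveI[of _ "sqrt K"]) auto
  qed
  finally show ?thesis .
qed

end

section \<open>Positivity in the closure of \<open>A\<close>\<close>

context coideal
begin

context
  fixes j :: "'h \<Rightarrow> 'u::cstar_algebra"
  assumes j: "universal_completion j"
begin

lemma j_lin: "clinear j" and j_one: "j 1 = 1" and j_mult: "j (x * y) = j x * j y"
  and j_star: "j (star x) = star (j x)" and j_norm: "norm (j x) = universal_norm x"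
  using j by (auto simp: universal_completion_def)

text \<open>\<epsilon> is continuous for the universal norm, so \<epsilon>(z) is the limit of the
  squared moduli of \<epsilon>(a n) along an approximation of \<open>b\<close> from
  \<open>A\<close>.\<close>

lemma counit_positive:
  assumes "positive_in (closure (j ` A)) (j z)"
  shows "0 \<le> Re (\<epsilon> z) \<and> Im (\<epsilon> z) = 0"
proof -
  obtain b where "b \<in> closure (j ` A)" and z: "j z = star b * b"
    using assms by (auto simp: positive_in_def)
  then obtain s where s: "\<And>n. s n \<in> j ` A" "s \<longlonglongrightarrow> b"
    unfolding closure_sequential by blast
  then have "\<forall>n. \<exists>a. s n = j a" by blast
  from choice[OF this] obtain a where a: "\<forall>n. s n = j (a n)" ..
  have "(\<lambda>n. star (s n) * s n) \<longlonglongrightarrow> star b * b"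
    by (intro tendsto_mult tendsto_star s)
  then have "(\<lambda>n. j (star (a n) * a n)) \<longlonglongrightarrow> j z"
    by (simp add: a j_mult j_star z)
  then have "(\<lambda>n. norm (j (star (a n) * a n) - j z)) \<longlonglongrightarrow> 0"
    by (simp add: LIM_zero tendsto_norm_zero)
  then have 0: "(\<lambda>n. universal_norm (star (a n) * a n - z)) \<longlonglongrightarrow> 0"
    by (simp add: clin[OF j_lin] flip: j_norm)
  have "(\<lambda>n. \<epsilon> (star (a n) * a n) - \<epsilon> z) \<longlonglongrightarrow> 0"
  proof (rule Lim_null_comparison[OF _ 0])
    show "\<forall>\<^sub>F n in sequentially. norm (\<epsilon> (star (a n) * a n) - \<epsilon> z) \<le> universal_norm (star (a n) * a n - z)"
      using counit_le_universal_norm by (simp flip: clinear_diff[OF clinear_counit])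
  qed
  then have "(\<lambda>n. \<epsilon> (star (a n) * a n)) \<longlonglongrightarrow> \<epsilon> z" by (simp add: LIM_zero_iff)
  moreover have "\<epsilon> (star (a n) * a n) = complex_of_real ((cmod (\<epsilon> (a n)))\<^sup>2)" for n
    by (simp add: counit_mult counit_star complex_norm_square mult.commute del: of_real_power)
  ultimately have lim: "(\<lambda>n. complex_of_real ((cmod (\<epsilon> (a n)))\<^sup>2)) \<longlonglongrightarrow> \<epsilon> z" by simp
  have "0 \<le> Re (\<epsilon> z)"
    by (rule LIMSEQ_le_const[OF tendsto_Re[OF lim]]) auto
  moreover have "Im (\<epsilon> z) = 0"
    using tendsto_Im[OF lim] LIMSEQ_unique[OF tendsto_const] by fastforce
  ultimately show ?thesis ..
qed

text \<open>The projected square is \<open>K (1 - r)\<close> with \<open>r\<close> in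
  \<open>A\<close> self-adjoint and of norm at most one in the completion. The root of
  \<open>1 - r\<close> is a limit of polynomials in \<open>r\<close>, hence lies in the closure of
  \<open>A\<close> itself.\<close>

lemma proj_positive:
  assumes inv: "(S \<circ> S) ` A = A"
  shows "positive_in (closure (j ` A)) (j (proj (star y * y)))"
proof -
  define z where "z = proj (star y * y)"
  have z_star: "star z = z"
    unfolding z_def by (simp add: star_mult star_star flip: proj_star[OF inv])
  obtain K where K: "K > 0" and Kw: "\<And>w. pos_fun w \<Longrightarrow>
      Re (w (star (1 - complex_of_real (1 / K) *\<^sub>C z) * (1 - complex_of_real (1 / K) *\<^sub>C z))) \<le> Re (w 1)"
    using proj_contraction[OF inv, of y] unfolding z_def by blast
  define r where "r = 1 - complex_of_real (1 / K) *\<^sub>C z"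
  have rA: "r \<in> A" unfolding r_def z_def by (intro A_intros proj_in)
  have "universal_norm r \<le> 1"
    by (rule universal_norm_le) (use Kw in \<open>simp_all add: r_def\<close>)
  then have "norm (j r) \<le> 1" by (simp add: j_norm)
  moreover have "star (j r) = j r"
    by (simp add: r_def star_diff star_one star_scaleC z_star flip: j_star)
  ultimately obtain b where b: "star b = b" "b * b = 1 - j r"
    "(\<lambda>n. \<Sum>k<n. sqrt_coef k *\<^sub>R j r ^ k) \<longlonglongrightarrow> b"
    using exists_sqrt by blast
  define b' where "b' = sqrt K *\<^sub>R b"
  have powA: "r ^ k \<in> A" for k by (induction k) (auto intro: A_intros rA)
  have j_pow: "j (r ^ k) = j r ^ k" for k by (induction k) (simp_all add: j_one j_mult)
  define s where "s n = sqrt K *\<^sub>R (\<Sum>k<n. sqrt_coef k *\<^sub>R j r ^ k)" for n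
  have "s \<longlonglongrightarrow> b'"
    unfolding b'_def s_def by (intro tendsto_scaleR tendsto_const b)
  moreover have "\<forall>n. s n \<in> j ` A"
  proof
    fix n
    have "sqrt K *\<^sub>R (\<Sum>k<n. sqrt_coef k *\<^sub>R j r ^ k) =
        j (complex_of_real (sqrt K) *\<^sub>C (\<Sum>k<n. complex_of_real (sqrt_coef k) *\<^sub>C r ^ k))"
      by (simp add: clin[OF j_lin] scaleR_scaleC j_pow)
    moreover have "complex_of_real (sqrt K) *\<^sub>C (\<Sum>k<n. complex_of_real (sqrt_coef k) *\<^sub>C r ^ k) \<in> A"
      by (intro A_intros powA)
    ultimately show "s n \<in> j ` A" unfolding s_def by blast
  qed
  ultimately have "b' \<in> closure (j ` A)" unfolding closure_sequential by blast
  moreover have "j z = star b' * b'"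
  proof -
    have "star b' = b'" using b(1) by (simp add: b'_def scaleR_scaleC star_scaleC)
    then have "star b' * b' = K *\<^sub>R (b * b)" using K by (simp add: b'_def)
    also have "b * b = (1 / K) *\<^sub>R j z"
      by (simp add: b(2) r_def clin[OF j_lin] j_one scaleR_scaleC)
    finally show ?thesis using K by simp
  qed
  ultimately show ?thesis by (auto simp: positive_in_def z_def)
qed

end

end

theorem theorem4p2:
  fixes \<Delta> :: "'h::star_algebra \<Rightarrow> ('h, 'h) tensor" and \<epsilon> :: "'h \<Rightarrow> complex" and S :: "'h \<Rightarrow> 'h"
    and A :: "'h set"
    and \<pi> :: "'h \<Rightarrow> 'c::complex_vector" and \<Delta>\<^sub>C :: "'c \<Rightarrow> ('c, 'c) tensor"
    and \<epsilon>\<^sub>C :: "'c \<Rightarrow> complex" and h\<^sub>C :: "'c \<Rightarrow> complex"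
    and j :: "'h \<Rightarrow> 'u::cstar_algebra"
  defines "E \<equiv> coideal_expectation \<Delta> \<pi> h\<^sub>C"
    and "A\<^sub>u \<equiv> closure (j ` A)"
  assumes "CQG_algebra \<Delta> \<epsilon> S"
    and "right_coideal_star_subalgebra \<Delta> A"
    and "quotient_coalgebra \<Delta> \<epsilon> (ideal_plus \<epsilon> A) \<pi> \<Delta>\<^sub>C \<epsilon>\<^sub>C"
    and "unital_integral \<Delta>\<^sub>C (\<pi> 1) h\<^sub>C"
    and "universal_completion j"
  shows "(\<forall>(n::nat) (x :: nat \<Rightarrow> 'h) (a :: nat \<Rightarrow> 'h). (\<forall>i\<in>{1..n}. a i \<in> A) \<longrightarrow>
      positive_in A\<^sub>u (j (\<Sum>i=1..n. \<Sum>k=1..n. star (a i) * E (star (x i) * x k) * a k)))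
    \<longleftrightarrow> (S \<circ> S) ` A = A"
proof -
  interpret coideal \<Delta> \<epsilon> S A
    using assms(3,4) by unfold_locales (auto simp: CQG_algebra_def)
  define \<phi> where "\<phi> x = h\<^sub>C (\<pi> x)" for x
  have \<pi>: "clinear \<pi>" "{x. \<pi> x = 0} = ideal_plus \<epsilon> A" "\<And>x. \<Delta>\<^sub>C (\<pi> x) = tmap \<pi> \<pi> (\<Delta> x)"
    using assms(5) by (auto simp: quotient_coalgebra_def)
  have h: "clinear h\<^sub>C" "h\<^sub>C (\<pi> 1) = 1" "\<And>c. lslice h\<^sub>C (\<Delta>\<^sub>C c) = h\<^sub>C c *\<^sub>C \<pi> 1"
    using assms(6) by (auto simp: unital_integral_def lslice_def)
  have \<phi>: "clinear \<phi>" unfolding \<phi>_def by (rule clinear_compose[OF h(1) \<pi>(1)])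
  have E_ls: "E = ls \<phi>"
    by (simp add: fun_eq_iff E_def coideal_expectation_def ls_def lslice_def \<phi>_def)
  have ls_proj: "ls \<phi> x = proj x" for x
  proof (rule ls_eq_proj[OF \<phi>])
    show "\<phi> 1 = 1" by (simp add: \<phi>_def h)
    show "\<phi> (x * a) = \<phi> x * \<epsilon> a" if a: "a \<in> A" for x a
    proof -
      have "a - \<epsilon> a *\<^sub>C 1 \<in> A" by (intro A_intros a)
      moreover have "\<epsilon> (a - \<epsilon> a *\<^sub>C 1) = 0" by (simp add: clin[OF clinear_counit] counit_one)
      ultimately have "x * (a - \<epsilon> a *\<^sub>C 1) \<in> ideal_plus \<epsilon> A"
        unfolding ideal_plus_def by (intro cvec.span_base) blast
      then have "\<pi> (x * (a - \<epsilon> a *\<^sub>C 1)) = 0" using \<pi>(2) by blast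
      then have "\<phi> (x * (a - \<epsilon> a *\<^sub>C 1)) = 0" by (simp add: \<phi>_def clinear_zero[OF h(1)])
      then show ?thesis
        by (simp add: right_diff_distrib scaleC_mult_right clin[OF \<phi>] mult.commute)
    qed
    show "ls \<phi> x - \<phi> x *\<^sub>C 1 \<in> ideal_plus \<epsilon> A" for x
    proof -
      have "\<pi> (ls \<phi> x) = lslice h\<^sub>C (\<Delta>\<^sub>C (\<pi> x))"
        unfolding \<pi>(3) lslice_tmap[OF h(1) \<pi>(1) \<pi>(1)] ls_def \<phi>_def ..
      then have "\<pi> (ls \<phi> x - \<phi> x *\<^sub>C 1) = 0"
        by (simp add: h(3) clin[OF \<pi>(1)] \<phi>_def)
      then show ?thesis using \<pi>(2) by blast
    qed
  qed
  then have E: "E = proj" by (simp add: E_ls fun_eq_iff)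
  show ?thesis
  proof (intro iffI allI impI)
    assume cp: "\<forall>(n::nat) (x :: nat \<Rightarrow> 'h) (a :: nat \<Rightarrow> 'h). (\<forall>i\<in>{1..n}. a i \<in> A) \<longrightarrow>
      positive_in A\<^sub>u (j (\<Sum>i=1..n. \<Sum>k=1..n. star (a i) * E (star (x i) * x k) * a k))"
    have "pos_fun psi"
      unfolding pos_fun_def
    proof (intro conjI allI clinear_psi)
      fix x
      have "positive_in A\<^sub>u (j (proj (star x * x)))"
        using cp[rule_format, of 1 "\<lambda>_. 1" "\<lambda>_. x"] A_one by (simp add: E star_one)
      then have "0 \<le> Re (\<epsilon> (proj (star x * x))) \<and> Im (\<epsilon> (proj (star x * x))) = 0"
        unfolding A\<^sub>u_def by (rule counit_positive[OF assms(7)])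
      then show "0 \<le> Re (psi (star x * x))" "Im (psi (star x * x)) = 0"
        by (simp_all add: psi_def)
    qed
    then show "(S \<circ> S) ` A = A" by (rule antipode_invariant_if_pos)
  next
    fix n :: nat and x a :: "nat \<Rightarrow> 'h"
    assume inv: "(S \<circ> S) ` A = A" and a: "\<forall>i\<in>{1..n}. a i \<in> A"
    \<comment> \<open>As \<open>proj\<close> is linear over \<open>A\<close> on both sides, the
      double sum collapses to \<open>proj (star y * y)\<close>; this reduces complete positivity to
      positivity.\<close>
    define y where "y = (\<Sum>k=1..n. x k * a k)"
    have "(\<Sum>i=1..n. \<Sum>k=1..n. star (a i) * E (star (x i) * x k) * a k) =
        (\<Sum>i=1..n. \<Sum>k=1..n. proj (star (x i * a i) * (x k * a k)))"
    proof (intro sum.cong refl)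
      fix i k assume "i \<in> {1..n}" "k \<in> {1..n}"
      then have ik: "star (a i) \<in> A" "a k \<in> A" using a A_star by auto
      have "star (a i) * E (star (x i) * x k) * a k = proj (star (a i) * (star (x i) * x k) * a k)"
        by (simp add: E proj_mult[OF ik(2)] proj_mult_left[OF inv ik(1)])
      then show "star (a i) * E (star (x i) * x k) * a k = proj (star (x i * a i) * (x k * a k))"
        by (simp add: star_mult mult.assoc)
    qed
    also have "\<dots> = proj (star y * y)"
      by (simp add: y_def star_sum sum_product clin[OF clinear_proj])
    finally show "positive_in A\<^sub>u (j (\<Sum>i=1..n. \<Sum>k=1..n. star (a i) * E (star (x i) * x k) * a k))"
      unfolding A\<^sub>u_def using proj_positive[OF assms(7) inv] by simp
  qed
qed

end
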